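(* Let $K$ be a field and $\mathcal{D}$ a finite-dimensional $K$-algebra all of whose local factors have residue field $K$. Let $(R,e)$ be a $\mathcal{D}^*$-ring with injective associated endomorphisms, such that $R$ is a $\mathbb{Q}$-algebra, and let $\bar{x}=(x_1,\ldots,x_n)$ be a finite tuple of indeterminates. If $R$ has the ascending chain condition on perfect $\mathcal{D}$-ideals, then so does the $\mathcal{D}^*$-polynomial ring $R\{\bar{x}\}_{\mathcal{D}^*}$.
   Context: All rings and algebras are commutative with $1$. $\mathcal{D}$-rings. A $\mathcal{D}$-ring is a pair $(R,e)$ with $R$ a $K$-algebra and $e\colon R\to R\otimes_K\mathcal{D}$ a $K$-algebra homomorphism. For a $K$-basis $\epsilon_0,\ldots,\epsilon_m$ of $\mathcal{D}$, the coordinate maps of $e$ are the $K$-linear maps $\partial_0,\ldots,\partial_m\colon R\to R$ with $e(r)=\sum_i\partial_i(r)\otimes\epsilon_i$. $(R,e)$ is a $\mathcal{D}^*$-ring if $(\mathrm{id}_R\otimes\beta)\circ(e\otimes\mathrm{id}_{\mathcal{D}})\circ e=(e\otimes\mathrm{id}_{\mathcal{D}})\circ e$, where $\beta(x\otimes y)=y\otimes x$ on $\mathcal{D}\otimes_K\mathcal{D}$; equivalently, the coordinate maps with respect to some (equivalently any) basis commute pairwise. Associated endomorphisms. Write $\mathcal{D}=\mathcal{D}_1\times\cdots\times\mathcal{D}_t$ as a product of local $K$-algebras; it is assumed that each $\mathcal{D}_i$ has residue field $K$. The associated endomorphism $\sigma_i\colon R\to R$ ($1\le i\le t$) is the composite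 of $e$ with the map $R\otimes_K\mathcal{D}\to R\otimes_K\mathcal{D}_i\to R\otimes_K K=R$ induced by the projection $\mathcal{D}\to\mathcal{D}_i$ and the residue map $\mathcal{D}_i\to K$. It is assumed that every $\sigma_i$ is injective on $R$. Ideals. A $\mathcal{D}$-ideal of a $\mathcal{D}$-ring is an ideal $I$ with $\partial_i(I)\subseteq I$ for all coordinate maps $\partial_i$ (with respect to any basis of $\mathcal{D}$). It is perfect if it is radical and, for all $a$ in the ring and $1\le i\le t$, $a\,\sigma_i(a)\in I$ implies $a\in I$. The ascending chain condition on perfect $\mathcal{D}$-ideals means that every ascending chain of perfect $\mathcal{D}$-ideals stabilises. Polynomial ring. Fix a basis $\epsilon_0,\ldots,\epsilon_m$ of $\mathcal{D}$. $R\{\bar{x}\}_{\mathcal{D}^*}$ is the polynomial ring over $R$ in the algebraically independent indeterminates $d^{\theta}x_j$ ($1\le j\le n$, $\theta\in\mathbb{N}^{m+1}$), with $x_j=d^0x_j$, equipped with the unique $K$-algebra homomorphism $e\colon R\{\bar{x}\}_{\mathcal{D}^*}\to R\{\bar{x}\}_{\mathcal{D}^*}\otimes_K\mathcal{D}$ extending that of $R$ and satisfying $d^{\theta}x_j\mapsto\sum_{k=0}^m d^{\theta+1_k}x_j\otimes\epsilon_k$, where $1_k$ is the $k$-th unit vector. It is a $\mathcal{D}^*$-ring, independent of the chosen basis up to isomorphism over $(R,e)$. *)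

theory Defs
  imports "HOL-Algebra.Algebra" "HOL-Algebra.Algebraic_Closure_Type" "HOL-Library.Poly_Mapping"
begin

section \<open>Algebras over a commutative ring\<close>

definition type_algebra :: "('k \<Rightarrow> 'a \<Rightarrow> 'a) \<Rightarrow> ('k, 'a::comm_ring_1) module" where
  "type_algebra s = \<lparr>carrier = UNIV, monoid.mult = (\<lambda>x y. x * y), one = 1,
     ring.zero = 0, add = (\<lambda>x y. x + y), module.smult = s\<rparr>"

definition self_algebra :: "'k ring \<Rightarrow> ('k, 'k) module" where
  "self_algebra K = \<lparr>carrier = carrier K, monoid.mult = monoid.mult K, one = one K,
     ring.zero = ring.zero K, add = ring.add K, module.smult = monoid.mult K\<rparr>"

definition alg_hom :: "'k ring \<Rightarrow> ('k, 'a) module \<Rightarrow> ('k, 'b) module \<Rightarrow> ('a \<Rightarrow> 'b) set" where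
  "alg_hom K A B = {h \<in> ring_hom A B.
     \<forall>c\<in>carrier K. \<forall>x\<in>carrier A. h (c \<odot>\<^bsub>A\<^esub> x) = c \<odot>\<^bsub>B\<^esub> h x}"

definition is_basis :: "'k ring \<Rightarrow> ('k, 'd) module \<Rightarrow> 'i set \<Rightarrow> ('i \<Rightarrow> 'd) \<Rightarrow> bool" where
  "is_basis K D J \<epsilon> \<longleftrightarrow> finite J \<and> \<epsilon> \<in> J \<rightarrow> carrier D \<and>
     (\<forall>x\<in>carrier D. \<exists>!c. c \<in> J \<rightarrow>\<^sub>E carrier K \<and> x = (\<Oplus>\<^bsub>D\<^esub>i\<in>J. c i \<odot>\<^bsub>D\<^esub> \<epsilon> i))"


section \<open>Tensor products\<close>

text \<open>
  The tensor product of two algebras is the free abelian group on pairs modulo the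
  biadditive, \<open>K\<close>-balanced relations; its elements are cosets.  On formal sums,
  multiplication extends \<open>(x \<otimes> y) (x' \<otimes> y') = x x' \<otimes> y y'\<close>, and scalars act on
  the first factor.
\<close>

definition tensor_rel :: "'k ring \<Rightarrow> ('k, 'a) module \<Rightarrow> ('k, 'b) module \<Rightarrow> ('a \<times> 'b \<Rightarrow>\<^sub>0 int) set" where
  "tensor_rel K A B =
     {frag_of (x \<oplus>\<^bsub>A\<^esub> x', y) - frag_of (x, y) - frag_of (x', y) | x x' y.
        x \<in> carrier A \<and> x' \<in> carrier A \<and> y \<in> carrier B} \<union>
     {frag_of (x, y \<oplus>\<^bsub>B\<^esub> y') - frag_of (x, y) - frag_of (x, y') | x y y'.
        x \<in> carrier A \<and> y \<in> carrier B \<and> y' \<in> carrier B} \<union>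
     {frag_of (c \<odot>\<^bsub>A\<^esub> x, y) - frag_of (x, c \<odot>\<^bsub>B\<^esub> y) | c x y.
        c \<in> carrier K \<and> x \<in> carrier A \<and> y \<in> carrier B}"

definition tensor_free :: "('k, 'a) module \<Rightarrow> ('k, 'b) module \<Rightarrow> ('a \<times> 'b \<Rightarrow>\<^sub>0 int) monoid" where
  "tensor_free A B = free_Abelian_group (carrier A \<times> carrier B)"

definition tensor_null :: "'k ring \<Rightarrow> ('k, 'a) module \<Rightarrow> ('k, 'b) module \<Rightarrow> ('a \<times> 'b \<Rightarrow>\<^sub>0 int) set" where
  "tensor_null K A B = generate (tensor_free A B) (tensor_rel K A B)"

definition tensor_class ::
  "'k ring \<Rightarrow> ('k, 'a) module \<Rightarrow> ('k, 'b) module \<Rightarrow> ('a \<times> 'b \<Rightarrow>\<^sub>0 int) \<Rightarrow> ('a \<times> 'b \<Rightarrow>\<^sub>0 int) set" where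
  "tensor_class K A B f = tensor_null K A B #>\<^bsub>tensor_free A B\<^esub> f"

definition tensor :: "'k ring \<Rightarrow> ('k, 'a) module \<Rightarrow> ('k, 'b) module \<Rightarrow> ('k, ('a \<times> 'b \<Rightarrow>\<^sub>0 int) set) module" where
  "tensor K A B =
     \<lparr>carrier = rcosets\<^bsub>tensor_free A B\<^esub> (tensor_null K A B),
      monoid.mult = (\<lambda>u v. \<Union>f\<in>u. \<Union>g\<in>v. tensor_class K A B
        (frag_extend (\<lambda>(x, y). frag_extend (\<lambda>(x', y'). frag_of (x \<otimes>\<^bsub>A\<^esub> x', y \<otimes>\<^bsub>B\<^esub> y')) g) f)),
      one = tensor_class K A B (frag_of (\<one>\<^bsub>A\<^esub>, \<one>\<^bsub>B\<^esub>)),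
      ring.zero = tensor_null K A B,
      add = (\<lambda>u v. u <#>\<^bsub>tensor_free A B\<^esub> v),
      module.smult = (\<lambda>c u. \<Union>f\<in>u. tensor_class K A B (frag_extend (\<lambda>(x, y). frag_of (c \<odot>\<^bsub>A\<^esub> x, y)) f))\<rparr>"

definition pure_tensor ::
  "'k ring \<Rightarrow> ('k, 'a) module \<Rightarrow> ('k, 'b) module \<Rightarrow> 'a \<Rightarrow> 'b \<Rightarrow> ('a \<times> 'b \<Rightarrow>\<^sub>0 int) set" where
  "pure_tensor K A B x y = tensor_class K A B (frag_of (x, y))"

text \<open>
  The unique additive map \<open>A \<otimes> B \<rightarrow> M\<close> with \<open>x \<otimes> y \<mapsto> \<phi> x y\<close>, for \<open>\<phi>\<close> biadditive and
  \<open>K\<close>-balanced: the extension of \<open>\<phi>\<close> to formal sums is then constant on each coset.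
\<close>

definition tensor_lift :: "('k, 'm) module \<Rightarrow> ('a \<Rightarrow> 'b \<Rightarrow> 'm) \<Rightarrow> ('a \<times> 'b \<Rightarrow>\<^sub>0 int) set \<Rightarrow> 'm" where
  "tensor_lift M \<phi> u = the_elem
     ((\<lambda>f. \<Oplus>\<^bsub>M\<^esub>p\<in>Poly_Mapping.keys f. add_pow M (Poly_Mapping.lookup f p) (\<phi> (fst p) (snd p))) ` u)"

definition tensor_map ::
  "'k ring \<Rightarrow> ('k, 'c) module \<Rightarrow> ('k, 'd) module \<Rightarrow> ('a \<Rightarrow> 'c) \<Rightarrow> ('b \<Rightarrow> 'd) \<Rightarrow>
   ('a \<times> 'b \<Rightarrow>\<^sub>0 int) set \<Rightarrow> ('c \<times> 'd \<Rightarrow>\<^sub>0 int) set" where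
  "tensor_map K C D f g = tensor_lift (tensor K C D) (\<lambda>x y. pure_tensor K C D (f x) (g y))"

definition tensor_swap :: "'k ring \<Rightarrow> ('k, 'd) module \<Rightarrow> ('d \<times> 'd \<Rightarrow>\<^sub>0 int) set \<Rightarrow> ('d \<times> 'd \<Rightarrow>\<^sub>0 int) set" where
  "tensor_swap K D = tensor_lift (tensor K D D) (\<lambda>x y. pure_tensor K D D y x)"

text \<open>The canonical identification \<open>(A \<otimes> B) \<otimes> C = A \<otimes> (B \<otimes> C)\<close>.\<close>

definition tensor_assoc ::
  "'k ring \<Rightarrow> ('k, 'a) module \<Rightarrow> ('k, 'b) module \<Rightarrow> ('k, 'c) module \<Rightarrow>
   (('a \<times> 'b \<Rightarrow>\<^sub>0 int) set \<times> 'c \<Rightarrow>\<^sub>0 int) set \<Rightarrow> ('a \<times> ('b \<times> 'c \<Rightarrow>\<^sub>0 int) set \<Rightarrow>\<^sub>0 int) set" where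
  "tensor_assoc K A B C =
     tensor_lift (tensor K A (tensor K B C))
       (\<lambda>v z. tensor_lift (tensor K A (tensor K B C))
         (\<lambda>x y. pure_tensor K A (tensor K B C) x (pure_tensor K B C y z)) v)"


section \<open>\<open>\<D>\<close>-rings\<close>

definition D_ring ::
  "'k ring \<Rightarrow> ('k, 'd) module \<Rightarrow> ('k, 'a) module \<Rightarrow> ('a \<Rightarrow> ('a \<times> 'd \<Rightarrow>\<^sub>0 int) set) \<Rightarrow> bool" where
  "D_ring K D A e \<longleftrightarrow> algebra K A \<and> e \<in> alg_hom K A (tensor K A D)"

definition D_star_ring ::
  "'k ring \<Rightarrow> ('k, 'd) module \<Rightarrow> ('k, 'a) module \<Rightarrow> ('a \<Rightarrow> ('a \<times> 'd \<Rightarrow>\<^sub>0 int) set) \<Rightarrow> bool" where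
  "D_star_ring K D A e \<longleftrightarrow> D_ring K D A e \<and>
     (\<forall>r\<in>carrier A.
        let u = tensor_assoc K A D D (tensor_map K (tensor K A D) D e (\<lambda>d. d) (e r))
        in tensor_map K A (tensor K D D) (\<lambda>x. x) (tensor_swap K D) u = u)"

definition coordinate_maps ::
  "'k ring \<Rightarrow> ('k, 'd) module \<Rightarrow> ('k, 'a) module \<Rightarrow> ('a \<Rightarrow> ('a \<times> 'd \<Rightarrow>\<^sub>0 int) set) \<Rightarrow>
   'i set \<Rightarrow> ('i \<Rightarrow> 'd) \<Rightarrow> ('i \<Rightarrow> 'a \<Rightarrow> 'a) \<Rightarrow> bool" where
  "coordinate_maps K D A e J \<epsilon> \<delta> \<longleftrightarrow> (\<forall>i\<in>J. \<delta> i \<in> carrier A \<rightarrow> carrier A) \<and>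
     (\<forall>r\<in>carrier A. e r = (\<Oplus>\<^bsub>tensor K A D\<^esub>i\<in>J. pure_tensor K A D (\<delta> i r) (\<epsilon> i)))"


section \<open>Associated endomorphisms\<close>

definition is_local_ring :: "('k, 'l) module \<Rightarrow> bool" where
  "is_local_ring L \<longleftrightarrow> cring L \<and> (\<exists>!m. maximalideal m L)"

definition max_ideal :: "('k, 'l) module \<Rightarrow> 'l set" where
  "max_ideal L = (THE m. maximalideal m L)"

definition scalar_residue :: "('k, 'l) module \<Rightarrow> 'k \<Rightarrow> 'l set" where
  "scalar_residue L c = max_ideal L +>\<^bsub>L\<^esub> (c \<odot>\<^bsub>L\<^esub> \<one>\<^bsub>L\<^esub>)"

definition has_residue_field :: "'k ring \<Rightarrow> ('k, 'l) module \<Rightarrow> bool" where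
  "has_residue_field K L \<longleftrightarrow> bij_betw (scalar_residue L) (carrier K) (carrier (L Quot max_ideal L))"

definition residue_map :: "'k ring \<Rightarrow> ('k, 'l) module \<Rightarrow> 'l \<Rightarrow> 'k" where
  "residue_map K L x = the_inv_into (carrier K) (scalar_residue L) (max_ideal L +>\<^bsub>L\<^esub> x)"

text \<open>\<open>p\<close> is the family of projections exhibiting \<open>D\<close> as the product of \<open>L 0, \<dots>, L (t - 1)\<close>.\<close>

definition local_decomposition ::
  "'k ring \<Rightarrow> ('k, 'd) module \<Rightarrow> nat \<Rightarrow> (nat \<Rightarrow> ('k, 'l) module) \<Rightarrow> (nat \<Rightarrow> 'd \<Rightarrow> 'l) \<Rightarrow> bool" where
  "local_decomposition K D t L p \<longleftrightarrow>
     (\<forall>i<t. algebra K (L i) \<and> is_local_ring (L i) \<and> p i \<in> alg_hom K D (L i)) \<and>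
     bij_betw (\<lambda>x. \<lambda>i\<in>{..<t}. p i x) (carrier D) (\<Pi>\<^sub>E i\<in>{..<t}. carrier (L i))"

text \<open>The composite \<open>A \<rightarrow> A \<otimes> D \<rightarrow> A \<otimes> L \<rightarrow> A \<otimes> K = A\<close>.\<close>

definition assoc_endo ::
  "'k ring \<Rightarrow> ('k, 'a) module \<Rightarrow> ('a \<Rightarrow> ('a \<times> 'd \<Rightarrow>\<^sub>0 int) set) \<Rightarrow>
   ('k, 'l) module \<Rightarrow> ('d \<Rightarrow> 'l) \<Rightarrow> 'a \<Rightarrow> 'a" where
  "assoc_endo K A e L p r =
     tensor_lift A (\<lambda>x c. c \<odot>\<^bsub>A\<^esub> x)
       (tensor_map K A (self_algebra K) (\<lambda>x. x) (residue_map K L)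
         (tensor_map K A L (\<lambda>x. x) p (e r)))"


section \<open>Perfect \<open>\<D>\<close>-ideals\<close>

definition D_ideal ::
  "'k ring \<Rightarrow> ('k, 'd) module \<Rightarrow> ('k, 'a) module \<Rightarrow> ('a \<Rightarrow> ('a \<times> 'd \<Rightarrow>\<^sub>0 int) set) \<Rightarrow> 'a set \<Rightarrow> bool" where
  "D_ideal K D A e I \<longleftrightarrow> ideal I A \<and>
     (\<forall>(m::nat) \<epsilon> \<delta>. is_basis K D {..m} \<epsilon> \<and> coordinate_maps K D A e {..m} \<epsilon> \<delta> \<longrightarrow>
        (\<forall>i\<le>m. \<delta> i ` I \<subseteq> I))"

definition perfect_D_ideal ::
  "'k ring \<Rightarrow> ('k, 'd) module \<Rightarrow> nat \<Rightarrow> (nat \<Rightarrow> ('k, 'l) module) \<Rightarrow> (nat \<Rightarrow> 'd \<Rightarrow> 'l) \<Rightarrow>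
   ('k, 'a) module \<Rightarrow> ('a \<Rightarrow> ('a \<times> 'd \<Rightarrow>\<^sub>0 int) set) \<Rightarrow> 'a set \<Rightarrow> bool" where
  "perfect_D_ideal K D t L p A e I \<longleftrightarrow> D_ideal K D A e I \<and>
     (\<forall>a\<in>carrier A. \<forall>n::nat. a [^]\<^bsub>A\<^esub> n \<in> I \<longrightarrow> a \<in> I) \<and>
     (\<forall>a\<in>carrier A. \<forall>i<t. a \<otimes>\<^bsub>A\<^esub> assoc_endo K A e (L i) (p i) a \<in> I \<longrightarrow> a \<in> I)"

definition acc_perfect_D_ideals ::
  "'k ring \<Rightarrow> ('k, 'd) module \<Rightarrow> nat \<Rightarrow> (nat \<Rightarrow> ('k, 'l) module) \<Rightarrow> (nat \<Rightarrow> 'd \<Rightarrow> 'l) \<Rightarrow>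
   ('k, 'a) module \<Rightarrow> ('a \<Rightarrow> ('a \<times> 'd \<Rightarrow>\<^sub>0 int) set) \<Rightarrow> bool" where
  "acc_perfect_D_ideals K D t L p A e \<longleftrightarrow>
     (\<forall>I :: nat \<Rightarrow> 'a set.
        (\<forall>n. perfect_D_ideal K D t L p A e (I n)) \<and> (\<forall>n. I n \<subseteq> I (Suc n)) \<longrightarrow>
        (\<exists>N. \<forall>n\<ge>N. I n = I N))"


section \<open>The \<open>\<D>\<^sup>*\<close>-polynomial ring\<close>

text \<open>
  Polynomials over \<open>'r\<close> in the indeterminates \<open>d\<^sup>\<theta> x\<^sub>j\<close>, encoded as pairs \<open>(j, \<theta>)\<close>: the finite
  type \<open>'n\<close> indexes the tuple \<open>x\<close> and the finite type \<open>'i\<close> the chosen basis of \<open>\<D>\<close>.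
  A monomial is a finitely supported exponent function on indeterminates.
\<close>

type_synonym ('n, 'i, 'r) D_poly = "(('n \<times> ('i \<Rightarrow> nat)) \<Rightarrow>\<^sub>0 nat) \<Rightarrow>\<^sub>0 'r"

definition D_poly_const :: "'r \<Rightarrow> ('n, 'i, 'r::comm_ring_1) D_poly" where
  "D_poly_const r = Poly_Mapping.single 0 r"

definition D_poly_var :: "'n \<Rightarrow> ('i \<Rightarrow> nat) \<Rightarrow> ('n, 'i, 'r::comm_ring_1) D_poly" where
  "D_poly_var j \<theta> = Poly_Mapping.single (Poly_Mapping.single (j, \<theta>) 1) 1"

definition D_poly_algebra :: "('k \<Rightarrow> 'r \<Rightarrow> 'r) \<Rightarrow> ('k, ('n, 'i, 'r::comm_ring_1) D_poly) module" where
  "D_poly_algebra s = type_algebra (\<lambda>c q. D_poly_const (s c 1) * q)"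

text \<open>\<open>E\<close> is the \<open>\<D>\<close>-structure on the polynomial ring; these conditions determine it uniquely.\<close>

definition is_D_poly_structure ::
  "'k ring \<Rightarrow> ('k, 'd) module \<Rightarrow> ('i::finite \<Rightarrow> 'd) \<Rightarrow> ('k \<Rightarrow> 'r::comm_ring_1 \<Rightarrow> 'r) \<Rightarrow>
   ('r \<Rightarrow> ('r \<times> 'd \<Rightarrow>\<^sub>0 int) set) \<Rightarrow>
   (('n::finite, 'i, 'r) D_poly \<Rightarrow> (('n, 'i, 'r) D_poly \<times> 'd \<Rightarrow>\<^sub>0 int) set) \<Rightarrow> bool" where
  "is_D_poly_structure K D \<epsilon> s e E \<longleftrightarrow>
     (let S = D_poly_algebra s; T = tensor K S D in
       E \<in> alg_hom K S T \<and>
       (\<forall>r. E (D_poly_const r) = tensor_map K S D D_poly_const (\<lambda>d. d) (e r)) \<and>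
       (\<forall>j \<theta>. E (D_poly_var j \<theta>) =
          (\<Oplus>\<^bsub>T\<^esub>k\<in>UNIV. pure_tensor K S D (D_poly_var j (\<theta>(k := Suc (\<theta> k)))) (\<epsilon> k))))"

end

theory Submission
  imports Defs
begin

text \<open>
  For a \<open>K\<close>-linear functional \<open>\<phi>\<close> on \<open>\<D>\<close> put \<open>\<partial>\<^sub>\<phi> = (id \<otimes> \<phi>) \<circ> e\<close>.  The associated endomorphisms
  are the \<open>\<partial>\<^sub>\<phi>\<close> for the residue characters \<open>\<phi> = \<chi>\<^sub>i\<close> (\<open>assoc_endo_eq_op\<close>), and a \<open>\<D>\<close>-ideal is an
  ideal stable under all \<open>\<partial>\<^sub>\<phi>\<close> (\<open>D_ideal_iff\<close>), so a basis of \<open>\<D>\<close> can be chosen to suit the proof.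
  As the residue fields are \<open>K\<close>, the common kernel of the characters is filtered by ideals whose
  successive quotients are lines on which \<open>\<D>\<close> acts through a character.  Dually, the functionals
  are spanned by a finite list that starts with the characters and continues with functionals
  \<open>\<phi>\<^sub>l\<close> such that \<open>\<phi>\<^sub>l(x y) = \<chi>(x) \<phi>\<^sub>l(y) + \<phi>\<^sub>l(x) \<chi>(y)\<close> up to products of earlier members
  (\<open>triangular_exists\<close>).  Hence \<open>\<partial>\<close> of a character is an endomorphism, and each other \<open>\<partial>\<close> in the
  list is a twisted derivation up to products of earlier operators.

  From here the argument is that of Ritt and Raudenbush.  If \<open>I\<close> is a perfect \<open>\<D>\<close>-ideal, so is
  \<open>{x. x y \<in> I}\<close> (\<open>perfect_colon\<close>).  Therefore a maximal perfect \<open>\<D>\<close>-ideal \<open>P\<close> that is not finitely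
  generated is prime (\<open>maximal_not_fin_generated_prime\<close>).  Rank the derivatives of the
  indeterminates by a well-order compatible with the operators, and call a derivative algebraic
  if modulo \<open>P\<close> it satisfies a polynomial relation over the ring generated by the coefficients
  and the lower derivatives.  A character carries a minimal relation to one of the same degree.
  Any other operator makes it linear, and the new leading coefficient is a conjugate of the
  separant, which is not in \<open>P\<close> because positive integers are invertible (\<open>alg_act\<close>).  The degrees
  thus never grow, and by Dickson's lemma finitely many relations produce all the others
  (\<open>finite_leaders\<close>).

  Let \<open>H\<close> be the product of their leading coefficients.  By pseudo-division, \<open>H P\<close> lies in the
  perfect ideal generated by these relations and \<open>P \<inter> R\<close> (\<open>reduction\<close>).  The ideal \<open>P \<inter> R\<close> is
  finitely generated by the hypothesis on \<open>R\<close>, and so is the perfect ideal generated by \<open>P\<close> and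
  \<open>H\<close>, by maximality of \<open>P\<close>.  Together these make \<open>P\<close> finitely generated, a contradiction
  (\<open>all_fin_generated\<close>).
\<close>

section \<open>Finite generation in closure systems\<close>

definition fin_generated :: "('a set \<Rightarrow> bool) \<Rightarrow> 'a set \<Rightarrow> bool" where
  "fin_generated \<P> I \<longleftrightarrow> (\<exists>F. finite F \<and> F \<subseteq> I \<and> (\<forall>J. \<P> J \<longrightarrow> F \<subseteq> J \<longrightarrow> I \<subseteq> J))"

definition chains_stabilise :: "('a set \<Rightarrow> bool) \<Rightarrow> bool" where
  "chains_stabilise \<P> \<longleftrightarrow> (\<forall>I :: nat \<Rightarrow> 'a set.
     (\<forall>n. \<P> (I n)) \<and> (\<forall>n. I n \<subseteq> I (Suc n)) \<longrightarrow> (\<exists>N. \<forall>n\<ge>N. I n = I N))"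

text \<open>
  Otherwise one can keep adjoining elements that lie outside the closure of the earlier ones,
  which gives a chain that never stabilises.
\<close>

lemma fin_generated_if_chains_stabilise:
  assumes Inter: "\<And>\<A>. (\<And>I. I \<in> \<A> \<Longrightarrow> \<P> I) \<Longrightarrow> \<P> (\<Inter>\<A>)"
    and stab: "chains_stabilise \<P>" and "\<P> I"
  shows "fin_generated \<P> I"
proof (rule ccontr)
  assume not_fg: "\<not> fin_generated \<P> I"
  define pclosure where "pclosure F = \<Inter>{J. \<P> J \<and> F \<subseteq> J}" for F
  have pclosure: "\<P> (pclosure F)" for F
    unfolding pclosure_def by (rule Inter) simp
  have "\<exists>y. y \<in> I \<and> y \<notin> pclosure F" if "finite F" "F \<subseteq> I" for F
    using not_fg that unfolding fin_generated_def pclosure_def by blast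
  then obtain pick where pick: "\<And>F. finite F \<Longrightarrow> F \<subseteq> I \<Longrightarrow> pick F \<in> I \<and> pick F \<notin> pclosure F"
    by metis
  define G where "G n = ((\<lambda>F. insert (pick F) F) ^^ n) {}" for n
  have G_Suc: "G (Suc n) = insert (pick (G n)) (G n)" for n
    by (simp add: G_def)
  have G: "finite (G n) \<and> G n \<subseteq> I" for n
    by (induction n) (auto simp: G_Suc pick, simp_all add: G_def)
  have mono: "pclosure (G n) \<subseteq> pclosure (G (Suc n))" for n
    unfolding G_Suc pclosure_def by blast
  have "\<exists>n. \<forall>k\<ge>n. pclosure (G k) = pclosure (G n)"
    by (rule stab[unfolded chains_stabilise_def, rule_format, of "\<lambda>n. pclosure (G n)"])
      (use mono pclosure in blast)
  then obtain n where n: "pclosure (G (Suc n)) = pclosure (G n)"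
    using le_SucI by blast
  have "pick (G n) \<in> pclosure (G (Suc n))"
    unfolding G_Suc pclosure_def by blast
  with n G pick show False
    by metis
qed

lemma finite_subset_Union_chain_member:
  assumes "finite F" "F \<subseteq> \<Union>C" "C \<noteq> {}" and chain: "\<And>A B. A \<in> C \<Longrightarrow> B \<in> C \<Longrightarrow> A \<subseteq> B \<or> B \<subseteq> A"
  shows "\<exists>A\<in>C. F \<subseteq> A"
  using assms(1,2)
proof (induction F)
  case empty
  then show ?case using \<open>C \<noteq> {}\<close> by auto
next
  case (insert y F)
  then obtain A B where "A \<in> C" "F \<subseteq> A" "B \<in> C" "y \<in> B"
    by auto
  with chain[of A B] show ?case
    by auto
qed

text \<open>
  The generators of the union of a chain already lie in one of its members.
\<close>

lemma chains_stabilise_if_fin_generated: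
  assumes Union: "\<And>C. C \<noteq> {} \<Longrightarrow> (\<And>A. A \<in> C \<Longrightarrow> \<P> A) \<Longrightarrow>
      (\<And>A B. A \<in> C \<Longrightarrow> B \<in> C \<Longrightarrow> A \<subseteq> B \<or> B \<subseteq> A) \<Longrightarrow> \<P> (\<Union>C)"
    and fg: "\<And>I. \<P> I \<Longrightarrow> fin_generated \<P> I"
  shows "chains_stabilise \<P>"
  unfolding chains_stabilise_def
proof (intro allI impI, elim conjE)
  fix I :: "nat \<Rightarrow> 'a set"
  assume I: "\<forall>n. \<P> (I n)" and Suc: "\<forall>n. I n \<subseteq> I (Suc n)"
  have mono: "I m \<subseteq> I n" if "m \<le> n" for m n
    using lift_Suc_mono_le[of I m n] Suc that by auto
  have chain: "A \<subseteq> B \<or> B \<subseteq> A" if AB: "A \<in> range I" "B \<in> range I" for A B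
  proof -
    obtain m n where "A = I m" "B = I n"
      using AB by blast
    then show ?thesis
      using mono nat_le_linear[of m n] by blast
  qed
  have "\<P> (\<Union>(range I))"
    by (rule Union) (use I chain in auto)
  then obtain F where F: "finite F" "F \<subseteq> \<Union>(range I)" "\<And>J. \<P> J \<Longrightarrow> F \<subseteq> J \<Longrightarrow> \<Union>(range I) \<subseteq> J"
    using fg unfolding fin_generated_def by metis
  then obtain N where N: "F \<subseteq> I N"
    using finite_subset_Union_chain_member[OF F(1,2) _ chain] by auto
  have "I n = I N" if "n \<ge> N" for n
    using F(3)[of "I N"] N I mono[OF that] by auto
  then show "\<exists>N. \<forall>n\<ge>N. I n = I N"
    by blast
qed

lemma maximal_not_fin_generated:
  assumes Union: "\<And>C. C \<noteq> {} \<Longrightarrow> (\<And>A. A \<in> C \<Longrightarrow> \<P> A) \<Longrightarrow>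
      (\<And>A B. A \<in> C \<Longrightarrow> B \<in> C \<Longrightarrow> A \<subseteq> B \<or> B \<subseteq> A) \<Longrightarrow> \<P> (\<Union>C)"
    and "\<P> I" "\<not> fin_generated \<P> I"
  obtains P where "\<P> P" "\<not> fin_generated \<P> P"
    "\<And>J. \<P> J \<Longrightarrow> P \<subset> J \<Longrightarrow> fin_generated \<P> J"
proof -
  define Z where "Z = {J. \<P> J \<and> \<not> fin_generated \<P> J}"
  have "\<Union>C \<in> Z" if C: "C \<noteq> {}" "subset.chain Z C" for C
  proof -
    have CZ: "C \<subseteq> Z" and chain: "\<And>A B. A \<in> C \<Longrightarrow> B \<in> C \<Longrightarrow> A \<subseteq> B \<or> B \<subseteq> A"
      using C unfolding subset.chain_def by auto
    have "\<P> (\<Union>C)"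
      by (rule Union) (use C CZ chain in \<open>auto simp: Z_def\<close>)
    moreover have "\<not> fin_generated \<P> (\<Union>C)"
    proof
      assume "fin_generated \<P> (\<Union>C)"
      then obtain F where F: "finite F" "F \<subseteq> \<Union>C" "\<And>J. \<P> J \<Longrightarrow> F \<subseteq> J \<Longrightarrow> \<Union>C \<subseteq> J"
        unfolding fin_generated_def by metis
      then obtain A where "A \<in> C" "F \<subseteq> A"
        using finite_subset_Union_chain_member[OF F(1,2) C(1) chain] by auto
      then have "fin_generated \<P> A"
        unfolding fin_generated_def using F(1) F(3) by (metis Union_upper order.trans)
      with \<open>A \<in> C\<close> CZ show False
        by (auto simp: Z_def)
    qed
    ultimately show ?thesis
      by (simp add: Z_def)
  qed
  moreover have "Z \<noteq> {}"
    using assms by (auto simp: Z_def)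
  ultimately obtain P where "P \<in> Z" "\<And>J. J \<in> Z \<Longrightarrow> P \<subseteq> J \<Longrightarrow> J = P"
    using subset_Zorn_nonempty[of Z] by blast
  then show thesis
    using that[of P] unfolding Z_def by blast
qed

section \<open>Rings with twisted derivations\<close>

text \<open>
  The operator \<open>\<delta> l\<close> is a ring endomorphism if \<open>\<kappa> l = l\<close>.  Otherwise it is a derivation twisted by
  the endomorphism \<open>\<delta> (\<kappa> l)\<close>, up to products of operators of smaller index.
\<close>

locale twisted_operators =
  fixes N :: nat and \<delta> :: "nat \<Rightarrow> 's::comm_ring_1 \<Rightarrow> 's" and \<kappa> :: "nat \<Rightarrow> nat" and base :: "'s set"
  assumes \<kappa>_le: "l < N \<Longrightarrow> \<kappa> l \<le> l"
    and \<kappa>_idem: "l < N \<Longrightarrow> \<kappa> (\<kappa> l) = \<kappa> l"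
    and \<delta>_add: "l < N \<Longrightarrow> \<delta> l (a + b) = \<delta> l a + \<delta> l b"
    and \<delta>_mult: "l < N \<Longrightarrow> \<kappa> l = l \<Longrightarrow> \<delta> l (a * b) = \<delta> l a * \<delta> l b"
    and \<delta>_Leibniz: "l < N \<Longrightarrow> \<kappa> l < l \<Longrightarrow> \<exists>c. (\<forall>j k. c j k \<in> base) \<and> (\<forall>a b. \<delta> l (a * b) =
        \<delta> (\<kappa> l) a * \<delta> l b + \<delta> l a * \<delta> (\<kappa> l) b + (\<Sum>j<l. \<Sum>k<l. c j k * (\<delta> j a * \<delta> k b)))"
    and base_const: "of_int z \<in> base"
    and base_add: "a \<in> base \<Longrightarrow> b \<in> base \<Longrightarrow> a + b \<in> base"
    and base_mult: "a \<in> base \<Longrightarrow> b \<in> base \<Longrightarrow> a * b \<in> base"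
    and base_\<delta>: "l < N \<Longrightarrow> a \<in> base \<Longrightarrow> \<delta> l a \<in> base"
begin

definition perfect :: "'s set \<Rightarrow> bool" where
  "perfect I \<longleftrightarrow> 0 \<in> I \<and> (\<forall>a\<in>I. \<forall>b\<in>I. a + b \<in> I) \<and> (\<forall>a\<in>I. \<forall>r. r * a \<in> I) \<and>
     (\<forall>a. \<forall>n::nat. a ^ n \<in> I \<longrightarrow> a \<in> I) \<and> (\<forall>l<N. \<forall>a\<in>I. \<delta> l a \<in> I) \<and>
     (\<forall>l<N. \<kappa> l = l \<longrightarrow> (\<forall>a. a * \<delta> l a \<in> I \<longrightarrow> a \<in> I))"

lemma \<delta>_0 [simp]: "l < N \<Longrightarrow> \<delta> l 0 = 0"
  using \<delta>_add[of l 0 0] by simp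

lemma perfectD:
  assumes "perfect I"
  shows "0 \<in> I" "a \<in> I \<Longrightarrow> b \<in> I \<Longrightarrow> a + b \<in> I" "a \<in> I \<Longrightarrow> r * a \<in> I" "a \<in> I \<Longrightarrow> a * r \<in> I"
    "a ^ n \<in> I \<Longrightarrow> a \<in> I" "a * a \<in> I \<Longrightarrow> a \<in> I" "l < N \<Longrightarrow> a \<in> I \<Longrightarrow> \<delta> l a \<in> I"
    "l < N \<Longrightarrow> \<kappa> l = l \<Longrightarrow> a * \<delta> l a \<in> I \<Longrightarrow> a \<in> I"
proof -
  show "0 \<in> I" "a \<in> I \<Longrightarrow> b \<in> I \<Longrightarrow> a + b \<in> I" "a \<in> I \<Longrightarrow> r * a \<in> I"
    "a ^ n \<in> I \<Longrightarrow> a \<in> I" "l < N \<Longrightarrow> a \<in> I \<Longrightarrow> \<delta> l a \<in> I"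
    "l < N \<Longrightarrow> \<kappa> l = l \<Longrightarrow> a * \<delta> l a \<in> I \<Longrightarrow> a \<in> I"
    using assms unfolding perfect_def by blast+
  show "a \<in> I \<Longrightarrow> a * r \<in> I"
    using assms unfolding perfect_def by (metis mult.commute)
  show "a * a \<in> I \<Longrightarrow> a \<in> I"
    using assms unfolding perfect_def by (metis power2_eq_square)
qed

lemma perfect_minus: "perfect I \<Longrightarrow> a \<in> I \<Longrightarrow> - a \<in> I"
  using perfectD(3)[of I a "-1"] by simp

lemma perfect_diff: "perfect I \<Longrightarrow> a \<in> I \<Longrightarrow> b \<in> I \<Longrightarrow> a - b \<in> I"
  using perfectD(2)[of I a "-b"] perfect_minus[of I b] by simp

lemma perfect_sum: "perfect I \<Longrightarrow> (\<And>i. i \<in> Z \<Longrightarrow> f i \<in> I) \<Longrightarrow> sum f Z \<in> I"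
  by (induction Z rule: infinite_finite_induct) (simp_all add: perfectD(1,2))

lemma perfect_Inter: "(\<And>I. I \<in> \<A> \<Longrightarrow> perfect I) \<Longrightarrow> perfect (\<Inter>\<A>)"
  unfolding perfect_def by blast

lemma perfect_Union_directed:
  assumes "C \<noteq> {}" "\<And>A. A \<in> C \<Longrightarrow> perfect A"
    and directed: "\<And>A B. A \<in> C \<Longrightarrow> B \<in> C \<Longrightarrow> \<exists>D\<in>C. A \<subseteq> D \<and> B \<subseteq> D"
  shows "perfect (\<Union>C)"
  unfolding perfect_def
proof (intro conjI ballI allI impI)
  fix a b assume "a \<in> \<Union>C" "b \<in> \<Union>C"
  then obtain A B where AB: "A \<in> C" "B \<in> C" "a \<in> A" "b \<in> B" by auto
  then obtain D where D: "D \<in> C" "a \<in> D" "b \<in> D"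
    using directed[OF AB(1,2)] by blast
  show "a + b \<in> \<Union>C"
    using D(1) perfectD(2)[OF assms(2)[OF D(1)] D(2,3)] by blast
next
  show "0 \<in> \<Union>C"
    using assms(1,2) perfectD(1) by blast
next
  fix a r assume "a \<in> \<Union>C"
  then show "r * a \<in> \<Union>C"
    using assms(2) perfectD(3) by blast
next
  fix a :: 's and n assume "a ^ n \<in> \<Union>C"
  then show "a \<in> \<Union>C"
    using assms(2) perfectD(5) by blast
next
  fix l a assume "l < N" "a \<in> \<Union>C"
  then show "\<delta> l a \<in> \<Union>C"
    using assms(2) perfectD(7) by blast
next
  fix l a assume "l < N" "\<kappa> l = l" "a * \<delta> l a \<in> \<Union>C"
  then show "a \<in> \<Union>C"
    using assms(2) perfectD(8) by blast
qed

lemma perfect_Union_chain: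
  assumes "C \<noteq> {}" "\<And>A. A \<in> C \<Longrightarrow> perfect A" "\<And>A B. A \<in> C \<Longrightarrow> B \<in> C \<Longrightarrow> A \<subseteq> B \<or> B \<subseteq> A"
  shows "perfect (\<Union>C)"
proof (rule perfect_Union_directed[OF assms(1,2)])
  show "\<exists>D\<in>C. A \<subseteq> D \<and> B \<subseteq> D" if "A \<in> C" "B \<in> C" for A B
    using assms(3)[OF that] that by blast
qed

lemma perfect_\<delta>_cancel:
  assumes "perfect I" "l < N" "\<kappa> l = l" "\<delta> l a \<in> I"
  shows "a \<in> I"
  using assms perfectD(3,8) by metis

text \<open>
  For an endomorphism \<open>\<sigma>\<close>, the product of \<open>a \<sigma>(b)\<close> with its image under \<open>\<sigma>\<close> is a multiple of
  \<open>\<sigma>(a b)\<close>.  For the other operators, the Leibniz rule reduces the claim to smaller indices.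
\<close>

lemma perfect_mult_\<delta>:
  assumes I: "perfect I" and ab: "a * b \<in> I" and "l < N"
  shows "a * \<delta> l b \<in> I"
  using \<open>l < N\<close>
proof (induction l rule: less_induct)
  case (less l)
  show ?case
  proof (cases "\<kappa> l = l")
    case True
    have "\<delta> l a * \<delta> l b \<in> I"
      using perfectD(7)[OF I less.prems ab] \<delta>_mult[OF less.prems True] by simp
    then have "(a * \<delta> l (\<delta> l b)) * (\<delta> l a * \<delta> l b) \<in> I"
      using perfectD(3)[OF I] by blast
    then have "(a * \<delta> l b) * \<delta> l (a * \<delta> l b) \<in> I"
      by (simp add: \<delta>_mult[OF less.prems True] mult_ac)
    then show ?thesis
      using perfectD(8)[OF I less.prems True] by blast
  next
    case False
    then have lt: "\<kappa> l < l"
      using \<kappa>_le[OF less.prems] by simp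
    then have \<kappa>: "\<kappa> l < N" "\<kappa> (\<kappa> l) = \<kappa> l"
      using less.prems \<kappa>_idem by auto
    obtain c where c: "\<And>a b. \<delta> l (a * b) =
        \<delta> (\<kappa> l) a * \<delta> l b + \<delta> l a * \<delta> (\<kappa> l) b + (\<Sum>j<l. \<Sum>k<l. c j k * (\<delta> j a * \<delta> k b))"
      using \<delta>_Leibniz[OF less.prems lt] by blast
    \<comment> \<open>Multiplying the Leibniz rule by \<open>a\<close> puts every term but one into \<open>I\<close>.\<close>
    have low: "a * \<delta> k b \<in> I" if "k < l" for k
      using less.IH[OF that] less.prems that by simp
    have "a * (\<Sum>j<l. \<Sum>k<l. c j k * (\<delta> j a * \<delta> k b)) = (\<Sum>j<l. \<Sum>k<l. (c j k * \<delta> j a) * (a * \<delta> k b))"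
      by (simp add: sum_distrib_left mult_ac)
    also have "\<dots> \<in> I"
      by (intro perfect_sum[OF I] perfectD(3)[OF I] low) auto
    finally have s: "a * (\<Sum>j<l. \<Sum>k<l. c j k * (\<delta> j a * \<delta> k b)) \<in> I" .
    have "a * \<delta> l (a * b) \<in> I"
      using perfectD(3)[OF I] perfectD(7)[OF I less.prems ab] by blast
    moreover have "\<delta> l a * (a * \<delta> (\<kappa> l) b) \<in> I"
      using perfectD(3)[OF I] low[OF lt] by blast
    ultimately have "a * \<delta> l (a * b) - \<delta> l a * (a * \<delta> (\<kappa> l) b)
        - a * (\<Sum>j<l. \<Sum>k<l. c j k * (\<delta> j a * \<delta> k b)) \<in> I"
      using s perfect_diff[OF I] by blast
    moreover have "a * \<delta> l (a * b) - \<delta> l a * (a * \<delta> (\<kappa> l) b)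
        - a * (\<Sum>j<l. \<Sum>k<l. c j k * (\<delta> j a * \<delta> k b)) = a * (\<delta> (\<kappa> l) a * \<delta> l b)"
      by (simp add: c algebra_simps)
    ultimately have "a * (\<delta> (\<kappa> l) a * \<delta> l b) \<in> I"
      by simp
    then have "\<delta> (\<kappa> l) (\<delta> l b) * (a * (\<delta> (\<kappa> l) a * \<delta> l b)) \<in> I"
      using perfectD(3)[OF I] by blast
    then have "(a * \<delta> l b) * \<delta> (\<kappa> l) (a * \<delta> l b) \<in> I"
      by (simp add: \<delta>_mult[OF \<kappa>] mult_ac)
    then show ?thesis
      using perfectD(8)[OF I \<kappa>] by blast
  qed
qed

text \<open>
  This is why perfect ideals behave like radical ideals: a statement about a product can be
  checked on generators of either factor.
\<close>

lemma perfect_colon: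
  assumes I: "perfect I"
  shows "perfect {x. x * y \<in> I}"
  unfolding perfect_def mem_Collect_eq Ball_def
proof (intro conjI allI impI)
  fix a n assume a: "a ^ n * y \<in> I"
  have "(a * y) ^ Suc n = (y ^ n * a) * (a ^ n * y)"
    by (simp add: power_mult_distrib mult_ac)
  then have "(a * y) ^ Suc n \<in> I"
    using perfectD(3)[OF I a] by metis
  then show "a * y \<in> I"
    using perfectD(5)[OF I] by blast
next
  fix l a assume l: "l < N" and a: "a * y \<in> I"
  have "y * \<delta> l a \<in> I"
    by (rule perfect_mult_\<delta>[OF I _ l]) (use a in \<open>simp add: mult_ac\<close>)
  then show "\<delta> l a * y \<in> I"
    by (simp add: mult_ac)
next
  fix l a assume l: "l < N" "\<kappa> l = l" and a: "a * \<delta> l a * y \<in> I"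
  have "(a * y) * \<delta> l (a * y) = \<delta> l y * (a * \<delta> l a * y)"
    by (simp add: \<delta>_mult[OF l] mult_ac)
  then show "a * y \<in> I"
    using perfectD(8)[OF I l] perfectD(3)[OF I a] by metis
qed (simp_all add: perfectD(1-3)[OF I] distrib_right mult.assoc)

definition pclosure :: "'s set \<Rightarrow> 's set" where
  "pclosure Z = \<Inter>{J. perfect J \<and> Z \<subseteq> J}"

lemma perfect_pclosure: "perfect (pclosure Z)"
  unfolding pclosure_def by (rule perfect_Inter) simp

lemma pclosure_subset: "Z \<subseteq> pclosure Z"
  unfolding pclosure_def by blast

lemma pclosure_least: "perfect J \<Longrightarrow> Z \<subseteq> J \<Longrightarrow> pclosure Z \<subseteq> J"
  unfolding pclosure_def by blast

lemma pclosure_mono: "Z \<subseteq> Y \<Longrightarrow> pclosure Z \<subseteq> pclosure Y"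
  unfolding pclosure_def by blast

lemma pclosure_finitary:
  assumes "y \<in> pclosure Z"
  shows "\<exists>F. finite F \<and> F \<subseteq> Z \<and> y \<in> pclosure F"
proof -
  define C where "C = pclosure ` {F. finite F \<and> F \<subseteq> Z}"
  have C: "pclosure F \<in> C" if "finite F" "F \<subseteq> Z" for F
    unfolding C_def using that by blast
  have "perfect (\<Union>C)"
  proof (rule perfect_Union_directed)
    show "C \<noteq> {}"
      using C[of "{}"] by auto
    fix A B assume "A \<in> C" "B \<in> C"
    then obtain F G where FG: "finite F" "F \<subseteq> Z" "A = pclosure F" "finite G" "G \<subseteq> Z" "B = pclosure G"
      unfolding C_def by blast
    show "\<exists>D\<in>C. A \<subseteq> D \<and> B \<subseteq> D"
      using C[of "F \<union> G"] FG pclosure_mono[of F "F \<union> G"] pclosure_mono[of G "F \<union> G"] by auto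
  qed (auto simp: C_def perfect_pclosure)
  moreover have "Z \<subseteq> \<Union>C"
    using C[of "{z}" for z] pclosure_subset[of "{z}" for z] by blast
  ultimately have "pclosure Z \<subseteq> \<Union>C"
    by (rule pclosure_least)
  then show ?thesis
    using assms unfolding C_def by blast
qed

text \<open>
  Only finitely many elements of \<open>P\<close> are needed to express given generators, so the element
  adjoined to \<open>P\<close> can itself serve as a generator.
\<close>

lemma fin_generated_insert:
  assumes "fin_generated perfect (pclosure (insert a P))"
  obtains F where "finite F" "F \<subseteq> P" "\<And>J. perfect J \<Longrightarrow> insert a F \<subseteq> J \<Longrightarrow> pclosure (insert a P) \<subseteq> J"
proof -
  obtain G where G: "finite G" "G \<subseteq> pclosure (insert a P)" "\<And>J. perfect J \<Longrightarrow> G \<subseteq> J \<Longrightarrow> pclosure (insert a P) \<subseteq> J"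
    using assms unfolding fin_generated_def by metis
  have "\<forall>g\<in>G. \<exists>F. finite F \<and> F \<subseteq> insert a P \<and> g \<in> pclosure F"
    using pclosure_finitary G(2) by blast
  then obtain f where f: "\<And>g. g \<in> G \<Longrightarrow> finite (f g) \<and> f g \<subseteq> insert a P \<and> g \<in> pclosure (f g)"
    by metis
  define F where "F = (\<Union>g\<in>G. f g) - {a}"
  have "pclosure (insert a P) \<subseteq> J" if J: "perfect J" "insert a F \<subseteq> J" for J
  proof (rule G(3)[OF J(1)], rule subsetI)
    fix g assume g: "g \<in> G"
    then have "f g \<subseteq> J"
      using J(2) F_def by auto
    then show "g \<in> J"
      using f[OF g] pclosure_least[OF J(1)] by blast
  qed
  then show thesis
    using that[of F] f G(1) unfolding F_def by blast
qed

text \<open>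
  If \<open>a b \<in> P\<close>, then \<open>P\<close> with \<open>a\<close> and \<open>P\<close> with \<open>b\<close> have finitely many generators \<open>a, F\<close> and \<open>b, G\<close>.
  An element \<open>z\<close> of \<open>P\<close> is then a consequence of \<open>F\<close>, \<open>G\<close> and \<open>a b\<close>: passing to colon ideals twice puts
  \<open>z b\<close>, then \<open>z\<^sup>2\<close>, into every perfect ideal that contains them.
\<close>

lemma maximal_not_fin_generated_prime:
  assumes P: "perfect P" "\<not> fin_generated perfect P"
    and max: "\<And>J. perfect J \<Longrightarrow> P \<subset> J \<Longrightarrow> fin_generated perfect J"
    and ab: "a * b \<in> P"
  shows "a \<in> P \<or> b \<in> P"
proof (rule ccontr)
  assume n: "\<not> (a \<in> P \<or> b \<in> P)"
  have fg: "fin_generated perfect (pclosure (insert z P))" if "z \<notin> P" for z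
    by (rule max[OF perfect_pclosure]) (use that pclosure_subset[of "insert z P"] in blast)
  obtain F where F: "finite F" "F \<subseteq> P" "\<And>J. perfect J \<Longrightarrow> insert a F \<subseteq> J \<Longrightarrow> pclosure (insert a P) \<subseteq> J"
    using fin_generated_insert[OF fg[of a]] n by blast
  obtain G where G: "finite G" "G \<subseteq> P" "\<And>J. perfect J \<Longrightarrow> insert b G \<subseteq> J \<Longrightarrow> pclosure (insert b P) \<subseteq> J"
    using fin_generated_insert[OF fg[of b]] n by blast
  have "P \<subseteq> Q" if Q: "perfect Q" "insert (a * b) (F \<union> G) \<subseteq> Q" for Q
  proof
    fix z assume z: "z \<in> P"
    have "insert a F \<subseteq> {x. x * b \<in> Q}"
      using Q perfectD(4)[OF Q(1)] by auto
    then have "z * b \<in> Q"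
      using F(3)[OF perfect_colon[OF Q(1)]] z pclosure_subset[of "insert a P"] by blast
    then have "insert b G \<subseteq> {x. x * z \<in> Q}"
      using Q perfectD(4)[OF Q(1)] by (auto simp: mult.commute)
    then have "z * z \<in> Q"
      using G(3)[OF perfect_colon[OF Q(1)]] z pclosure_subset[of "insert b P"] by blast
    then show "z \<in> Q"
      by (rule perfectD(6)[OF Q(1)])
  qed
  then have "fin_generated perfect P"
    unfolding fin_generated_def using F G ab
    by (intro exI[of _ "insert (a * b) (F \<union> G)"]) auto
  with P show False
    by blast
qed

text \<open>
  For a maximal counterexample \<open>P\<close>, the perfect ideal generated by \<open>P\<close> and \<open>h\<close> has finitely many
  generators \<open>h, G\<close> with \<open>G \<subseteq> P\<close>.  If \<open>Q\<close> contains \<open>G\<close> and \<open>h P\<close>, then for \<open>z \<in> P\<close> the colon ideal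
  \<open>{x. x z \<in> Q}\<close> contains \<open>h\<close> and \<open>G\<close>, hence \<open>z\<close>, so \<open>z\<^sup>2 \<in> Q\<close>.
\<close>

lemma all_fin_generated:
  assumes red: "\<And>P. perfect P \<Longrightarrow> 1 \<notin> P \<Longrightarrow> (\<And>a b. a * b \<in> P \<Longrightarrow> a \<in> P \<or> b \<in> P) \<Longrightarrow>
      \<exists>F h. finite F \<and> F \<subseteq> P \<and> h \<notin> P \<and> (\<forall>Q. perfect Q \<longrightarrow> F \<subseteq> Q \<longrightarrow> (\<forall>g\<in>P. h * g \<in> Q))"
    and I: "perfect I"
  shows "fin_generated perfect I"
proof (rule ccontr)
  assume nfg: "\<not> fin_generated perfect I"
  obtain P where P: "perfect P" "\<not> fin_generated perfect P"
      "\<And>J. perfect J \<Longrightarrow> P \<subset> J \<Longrightarrow> fin_generated perfect J"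
  proof (rule maximal_not_fin_generated[of perfect I])
    show "C \<noteq> {} \<Longrightarrow> (\<And>A. A \<in> C \<Longrightarrow> perfect A) \<Longrightarrow>
        (\<And>A B. A \<in> C \<Longrightarrow> B \<in> C \<Longrightarrow> A \<subseteq> B \<or> B \<subseteq> A) \<Longrightarrow> perfect (\<Union>C)" for C
      by (rule perfect_Union_chain)
  qed (use I nfg in auto)
  have "1 \<notin> P"
  proof
    assume "1 \<in> P"
    moreover have "P \<subseteq> J" if "perfect J" "{1} \<subseteq> J" for J
      using perfectD(3)[OF that(1), of 1] that(2) by auto
    ultimately have "fin_generated perfect P"
      unfolding fin_generated_def by (intro exI[of _ "{1}"]) auto
    with P show False by blast
  qed
  moreover have "a \<in> P \<or> b \<in> P" if "a * b \<in> P" for a b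
    using maximal_not_fin_generated_prime[OF P(1,2) _ that] P(3) by blast
  ultimately have "\<exists>F h. finite F \<and> F \<subseteq> P \<and> h \<notin> P \<and>
      (\<forall>Q. perfect Q \<longrightarrow> F \<subseteq> Q \<longrightarrow> (\<forall>g\<in>P. h * g \<in> Q))"
    by (rule red[OF P(1)])
  then obtain F h where F: "finite F" "F \<subseteq> P" "h \<notin> P"
      and FQ': "\<forall>Q. perfect Q \<longrightarrow> F \<subseteq> Q \<longrightarrow> (\<forall>g\<in>P. h * g \<in> Q)"
    by blast
  have FQ: "h * g \<in> Q" if "perfect Q" "F \<subseteq> Q" "g \<in> P" for Q g
    using FQ' that by blast
  have "fin_generated perfect (pclosure (insert h P))"
    by (rule P(3)[OF perfect_pclosure]) (use F(3) pclosure_subset[of "insert h P"] in blast)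
  then obtain G where G: "finite G" "G \<subseteq> P"
      "\<And>J. perfect J \<Longrightarrow> insert h G \<subseteq> J \<Longrightarrow> pclosure (insert h P) \<subseteq> J"
    by (rule fin_generated_insert) blast
  have "P \<subseteq> Q" if Q: "perfect Q" "F \<union> G \<subseteq> Q" for Q
  proof
    fix z assume z: "z \<in> P"
    have "insert h G \<subseteq> {x. x * z \<in> Q}"
      using Q perfectD(4)[OF Q(1)] FQ[OF Q(1) _ z] by auto
    then have "z * z \<in> Q"
      using G(3)[OF perfect_colon[OF Q(1)]] z pclosure_subset[of "insert h P"] by blast
    then show "z \<in> Q"
      by (rule perfectD(6)[OF Q(1)])
  qed
  then have "fin_generated perfect P"
    unfolding fin_generated_def using F G
    by (intro exI[of _ "F \<union> G"]) auto
  with P show False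
    by blast
qed

end

section \<open>Elimination in a ranked system of generators\<close>

inductive_set gen_subring :: "'s::comm_ring_1 set \<Rightarrow> 's set" for G where
  gen: "g \<in> G \<Longrightarrow> g \<in> gen_subring G"
| add: "a \<in> gen_subring G \<Longrightarrow> b \<in> gen_subring G \<Longrightarrow> a + b \<in> gen_subring G"
| mult: "a \<in> gen_subring G \<Longrightarrow> b \<in> gen_subring G \<Longrightarrow> a * b \<in> gen_subring G"

lemma gen_subring_mono: "G \<subseteq> H \<Longrightarrow> gen_subring G \<subseteq> gen_subring H"
proof
  fix y assume "G \<subseteq> H" "y \<in> gen_subring G"
  from this(2,1) show "y \<in> gen_subring H"
    by (induction rule: gen_subring.induct) (auto intro: gen_subring.intros)
qed

text \<open>
  The Leibniz rule for \<open>\<delta> k\<close> only involves operators of index at most \<open>k\<close>, so an initial segment of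
  the operators can be controlled on generators.
\<close>

lemma (in twisted_operators) \<delta>_gen_subring:
  assumes y: "y \<in> gen_subring G" and m: "m \<le> N" and H: "base \<subseteq> H"
    and G: "\<And>g k. g \<in> G \<Longrightarrow> k < m \<Longrightarrow> \<delta> k g \<in> gen_subring H"
  shows "k < m \<Longrightarrow> \<delta> k y \<in> gen_subring H"
  using y
proof (induction arbitrary: k rule: gen_subring.induct)
  case (gen g)
  then show ?case using G by blast
next
  case (add a b)
  then show ?case using m \<delta>_add[of k a b] by (simp add: gen_subring.add)
next
  case (mult a b)
  have sum_closed: "sum f Z \<in> gen_subring H" if "\<And>i. i \<in> Z \<Longrightarrow> f i \<in> gen_subring H" for f and Z :: "nat set"
    using that base_const[of 0] H
    by (induction Z rule: infinite_finite_induct) (auto intro: gen_subring.intros)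
  have k: "k < N" using mult.prems m by simp
  show ?case
  proof (cases "\<kappa> k = k")
    case True
    then show ?thesis
      using mult.IH[OF mult.prems] \<delta>_mult[OF k True] by (simp add: gen_subring.mult)
  next
    case False
    then have lt: "\<kappa> k < k" using \<kappa>_le[OF k] by simp
    obtain c where c: "\<And>i j. c i j \<in> base" "\<And>a b. \<delta> k (a * b) =
        \<delta> (\<kappa> k) a * \<delta> k b + \<delta> k a * \<delta> (\<kappa> k) b + (\<Sum>i<k. \<Sum>j<k. c i j * (\<delta> i a * \<delta> j b))"
      using \<delta>_Leibniz[OF k lt] by blast
    have "c i j \<in> gen_subring H" for i j
      using c(1) H gen_subring.gen by blast
    then show ?thesis
      unfolding c(2) using mult.IH mult.prems lt
      by (intro gen_subring.add gen_subring.mult sum_closed) auto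
  qed
qed

text \<open>The derivative is taken coefficientwise because the coefficient ring may have zero divisors.\<close>

definition formal_deriv :: "'a::comm_ring_1 poly \<Rightarrow> 'a poly" where
  "formal_deriv f = Abs_poly (\<lambda>i. of_nat (Suc i) * coeff f (Suc i))"

lemma coeff_formal_deriv: "coeff (formal_deriv f) i = of_nat (Suc i) * coeff f (Suc i)"
  unfolding formal_deriv_def
  by (subst coeff_Abs_poly[where n = "degree f"]) (auto simp: coeff_eq_0)

lemma formal_deriv_0 [simp]: "formal_deriv 0 = 0"
  by (simp add: poly_eq_iff coeff_formal_deriv)

lemma formal_deriv_pCons: "formal_deriv (pCons a f) = f + pCons 0 (formal_deriv f)"
  by (rule poly_eqI)
    (simp add: coeff_formal_deriv coeff_pCons algebra_simps split: nat.split)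

text \<open>
  The indices \<open>V\<close> stand for the derivatives \<open>x v\<close> of finitely many elements, and \<open>act\<close> for the
  effect of an operator on such an index.  The order is monotone under the operators and ranks
  \<open>\<delta> k (x v)\<close> below \<open>\<delta> l (x v)\<close> for \<open>k < l\<close>, so that the leading derivative of \<open>\<delta> l y\<close> can be read
  off from that of \<open>y\<close>.  The last assumption is Dickson's lemma with one additional coordinate \<open>d\<close>,
  to be used for degrees.
\<close>

locale ranked_generators = twisted_operators N \<delta> \<kappa> base
  for N :: nat and \<delta> :: "nat \<Rightarrow> 's::comm_ring_1 \<Rightarrow> 's" and \<kappa> :: "nat \<Rightarrow> nat" and base :: "'s set" +
  fixes V :: "'v set" and lt :: "'v \<Rightarrow> 'v \<Rightarrow> bool" (infix "\<lless>" 50)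
    and act :: "nat \<Rightarrow> 'v \<Rightarrow> 'v" and x :: "'v \<Rightarrow> 's"
  assumes act_V: "v \<in> V \<Longrightarrow> l < N \<Longrightarrow> act l v \<in> V"
    and \<delta>_x: "v \<in> V \<Longrightarrow> l < N \<Longrightarrow> \<delta> l (x v) = x (act l v)"
    and wf_lt: "wf {(v, w). v \<lless> w}"
    and lt_trans: "u \<lless> v \<Longrightarrow> v \<lless> w \<Longrightarrow> u \<lless> w"
    and lt_total: "v \<in> V \<Longrightarrow> w \<in> V \<Longrightarrow> v \<lless> w \<or> v = w \<or> w \<lless> v"
    and act_mono: "v \<in> V \<Longrightarrow> w \<in> V \<Longrightarrow> l < N \<Longrightarrow> v \<lless> w \<Longrightarrow> act l v \<lless> act l w"
    and act_index: "v \<in> V \<Longrightarrow> l < N \<Longrightarrow> k < l \<Longrightarrow> act k v \<lless> act l v"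
    and of_nat_unit: "n > 0 \<Longrightarrow> \<exists>y. of_nat n * y = (1::'s)"
    and generates: "y \<in> gen_subring (base \<union> x ` V)"
    and dickson: "\<And>(f :: nat \<Rightarrow> 'v) (d :: nat \<Rightarrow> nat). (\<And>n. f n \<in> V) \<Longrightarrow>
      \<exists>i j w. i < j \<and> d i \<le> d j \<and> set w \<subseteq> {..<N} \<and> f j = foldr act w (f i)"
begin

definition below :: "'v \<Rightarrow> 's set" where
  "below v = gen_subring (base \<union> x ` {w \<in> V. w \<lless> v})"

definition upto :: "'v \<Rightarrow> 's set" where
  "upto v = gen_subring (base \<union> x ` {w \<in> V. w \<lless> v \<or> w = v})"

definition coeffs_below :: "'v \<Rightarrow> 's poly \<Rightarrow> bool" where
  "coeffs_below v f \<longleftrightarrow> (\<forall>i. coeff f i \<in> below v)"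

lemma base_below: "b \<in> base \<Longrightarrow> b \<in> below v"
  unfolding below_def by (blast intro: gen_subring.gen)

lemma below_add: "a \<in> below v \<Longrightarrow> b \<in> below v \<Longrightarrow> a + b \<in> below v"
  unfolding below_def by (rule gen_subring.add)

lemma below_mult: "a \<in> below v \<Longrightarrow> b \<in> below v \<Longrightarrow> a * b \<in> below v"
  unfolding below_def by (rule gen_subring.mult)

lemma below_of_int: "of_int z \<in> below v"
  by (rule base_below[OF base_const])

lemma below_of_nat: "of_nat z \<in> below v"
  using below_of_int[of "int z"] by simp

lemma below_0: "0 \<in> below v" and below_1: "1 \<in> below v"
  using below_of_int[of 0 v] below_of_int[of 1 v] by simp_all

lemma below_minus: "a \<in> below v \<Longrightarrow> - a \<in> below v"
  using below_mult[OF below_of_int[of "-1"]] by simp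

lemma below_sum: "(\<And>i. i \<in> Z \<Longrightarrow> f i \<in> below v) \<Longrightarrow> sum f Z \<in> below v"
  by (induction Z rule: infinite_finite_induct) (auto simp: below_0 below_add)

lemma below_x: "w \<in> V \<Longrightarrow> w \<lless> v \<Longrightarrow> x w \<in> below v"
  unfolding below_def by (blast intro: gen_subring.gen)

lemma \<delta>_generated_below:
  assumes "y \<in> gen_subring G" "m \<le> N" "\<And>g k. g \<in> G \<Longrightarrow> k < m \<Longrightarrow> \<delta> k g \<in> below v" "k < m"
  shows "\<delta> k y \<in> below v"
  using \<delta>_gen_subring[of y G m "base \<union> x ` {w \<in> V. w \<lless> v}" k] assms unfolding below_def by simp

lemma \<delta>_below:
  assumes "y \<in> below v" "v \<in> V" "l < N" "k \<le> l"
  shows "\<delta> k y \<in> below (act l v)"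
proof (rule \<delta>_generated_below[of y _ "Suc l"])
  fix g k assume g: "g \<in> base \<union> x ` {w \<in> V. w \<lless> v}" and k: "k < Suc l"
  then consider "g \<in> base" | w where "g = x w" "w \<in> V" "w \<lless> v"
    by blast
  then show "\<delta> k g \<in> below (act l v)"
  proof cases
    case 1
    then show ?thesis using base_\<delta> k assms(3) base_below by simp
  next
    case 2
    then have "act k w \<lless> act k v"
      using act_mono assms k by simp
    then have "act k w \<lless> act l v"
      using lt_trans act_index[OF assms(2,3), of k] k by (cases "k = l") auto
    then show ?thesis
      using 2 \<delta>_x below_x act_V k assms(3) by simp
  qed
qed (use assms in \<open>auto simp: below_def\<close>)

lemma below_upto: "below v \<subseteq> upto v"
  unfolding below_def upto_def by (rule gen_subring_mono) blast

lemma \<delta>_upto: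
  assumes "y \<in> upto v" "v \<in> V" "l < N" "k < l"
  shows "\<delta> k y \<in> below (act l v)"
proof (rule \<delta>_generated_below[of y _ l])
  fix g k assume g: "g \<in> base \<union> x ` {w \<in> V. w \<lless> v \<or> w = v}" and k: "k < l"
  then consider "g \<in> below v" | "g = x v"
    using base_below below_x by blast
  then show "\<delta> k g \<in> below (act l v)"
  proof cases
    case 1
    then show ?thesis using \<delta>_below assms k by simp
  next
    case 2
    then show ?thesis
      using \<delta>_x assms k below_x act_V act_index by simp
  qed
qed (use assms in \<open>auto simp: upto_def\<close>)

lemma coeffs_below_pCons: "coeffs_below v (pCons a f) \<longleftrightarrow> a \<in> below v \<and> coeffs_below v f"
  unfolding coeffs_below_def by (metis (no_types, lifting) coeff_pCons_0 coeff_pCons_Suc not0_implies_Suc)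

lemma coeffs_below_0 [simp]: "coeffs_below v 0"
  by (simp add: coeffs_below_def below_0)

lemma coeffs_below_monom: "a \<in> below v \<Longrightarrow> coeffs_below v (monom a n)"
  by (simp add: coeffs_below_def below_0)

lemma coeffs_below_add: "coeffs_below v f \<Longrightarrow> coeffs_below v g \<Longrightarrow> coeffs_below v (f + g)"
  by (simp add: coeffs_below_def below_add)

lemma coeffs_below_minus: "coeffs_below v f \<Longrightarrow> coeffs_below v (- f)"
  by (simp add: coeffs_below_def below_minus)

lemma coeffs_below_diff: "coeffs_below v f \<Longrightarrow> coeffs_below v g \<Longrightarrow> coeffs_below v (f - g)"
  using coeffs_below_add[of v f "- g"] coeffs_below_minus[of v g] by simp

lemma coeffs_below_mult: "coeffs_below v f \<Longrightarrow> coeffs_below v g \<Longrightarrow> coeffs_below v (f * g)"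
  by (simp add: coeffs_below_def coeff_mult below_sum below_mult)

lemma coeffs_below_smult: "a \<in> below v \<Longrightarrow> coeffs_below v f \<Longrightarrow> coeffs_below v (smult a f)"
  by (simp add: coeffs_below_def below_mult)

lemma coeffs_below_formal_deriv: "coeffs_below v f \<Longrightarrow> coeffs_below v (formal_deriv f)"
  unfolding coeffs_below_def by (simp add: coeff_formal_deriv below_mult below_of_nat del: of_nat_Suc)

lemma upto_x: "v \<in> V \<Longrightarrow> x v \<in> upto v"
  unfolding upto_def by (blast intro: gen_subring.gen)

lemma poly_upto:
  assumes "v \<in> V" "coeffs_below v f"
  shows "poly f (x v) \<in> upto v"
  using assms(2)
proof (induction f)
  case 0
  then show ?case using below_0 below_upto by auto
next
  case (pCons a f)
  then have "a \<in> upto v" "poly f (x v) \<in> upto v"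
    using below_upto by (auto simp: coeffs_below_pCons)
  then show ?case
    using upto_x[OF assms(1)] unfolding upto_def
    by (simp add: gen_subring.add gen_subring.mult)
qed

lemma upto_poly:
  assumes "y \<in> upto v"
  shows "\<exists>f. coeffs_below v f \<and> y = poly f (x v)"
  using assms unfolding upto_def
proof (induction rule: gen_subring.induct)
  case (gen g)
  then consider "g \<in> below v" | "g = x v"
    using base_below below_x by blast
  then show ?case
  proof cases
    case 1
    then show ?thesis
      by (intro exI[of _ "[:g:]"]) (simp add: coeffs_below_pCons)
  next
    case 2
    then show ?thesis
      by (intro exI[of _ "[:0, 1:]"]) (simp add: coeffs_below_pCons below_0 below_1)
  qed
next
  case (add a b)
  then obtain f g where "coeffs_below v f" "a = poly f (x v)" "coeffs_below v g" "b = poly g (x v)"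
    by blast
  then show ?case
    by (intro exI[of _ "f + g"]) (simp add: coeffs_below_add)
next
  case (mult a b)
  then obtain f g where "coeffs_below v f" "a = poly f (x v)" "coeffs_below v g" "b = poly g (x v)"
    by blast
  then show ?case
    by (intro exI[of _ "f * g"]) (simp add: coeffs_below_mult)
qed

lemma \<delta>_character_poly:
  assumes "l < N" "\<kappa> l = l" "v \<in> V"
  shows "\<delta> l (poly f (x v)) = poly (map_poly (\<delta> l) f) (x (act l v))"
  by (induction f) (use assms in \<open>simp_all add: \<delta>_add \<delta>_mult \<delta>_x map_poly_pCons\<close>)

text \<open>
  Expanding \<open>\<delta> l\<close> of a polynomial in \<open>x v\<close>, the derivative \<open>\<delta> l (x v)\<close> occurs only linearly, because
  products in the Leibniz rule involve operators of smaller index.  Its coefficient is the twisted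
  separant.
\<close>

lemma \<delta>_poly_separant:
  assumes l: "l < N" "\<kappa> l < l" and v: "v \<in> V" and f: "coeffs_below v f"
  shows "\<exists>T\<in>below (act l v).
    \<delta> l (poly f (x v)) = \<delta> (\<kappa> l) (poly (formal_deriv f) (x v)) * x (act l v) + T"
  using f
proof (induction f)
  case 0
  then show ?case using l below_0 by (intro bexI[of _ 0]) auto
next
  case (pCons a f)
  have \<kappa>: "\<kappa> l < N" "\<kappa> (\<kappa> l) = \<kappa> l"
    using l \<kappa>_idem by auto
  have af: "a \<in> below v" "coeffs_below v f"
    using pCons.prems by (auto simp: coeffs_below_pCons)
  obtain T where T: "T \<in> below (act l v)"
      "\<delta> l (poly f (x v)) = \<delta> (\<kappa> l) (poly (formal_deriv f) (x v)) * x (act l v) + T"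
    using pCons.IH[OF af(2)] by blast
  obtain c where c: "\<And>i j. c i j \<in> base" "\<And>a b. \<delta> l (a * b) =
      \<delta> (\<kappa> l) a * \<delta> l b + \<delta> l a * \<delta> (\<kappa> l) b + (\<Sum>i<l. \<Sum>j<l. c i j * (\<delta> i a * \<delta> j b))"
    using \<delta>_Leibniz[OF l] by blast
  define U where "U = \<delta> l a + \<delta> (\<kappa> l) (x v) * T +
      (\<Sum>i<l. \<Sum>j<l. c i j * (\<delta> i (x v) * \<delta> j (poly f (x v))))"
  have "U \<in> below (act l v)"
    unfolding U_def using \<delta>_below[OF af(1) v l(1)] \<delta>_upto[OF upto_x[OF v] v l(1)]
      \<delta>_upto[OF poly_upto[OF v af(2)] v l(1)] base_below[OF c(1)] T(1) l(2)
    by (intro below_add below_mult below_sum) auto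
  moreover have "\<delta> l (poly (pCons a f) (x v)) =
      \<delta> (\<kappa> l) (poly (formal_deriv (pCons a f)) (x v)) * x (act l v) + U"
    unfolding U_def
    by (simp add: \<delta>_add[OF l(1)] \<delta>_add[OF \<kappa>(1)] \<delta>_mult[OF \<kappa>] c(2) T(2) \<delta>_x[OF v l(1)]
        formal_deriv_pCons algebra_simps)
  ultimately show ?case
    by blast
qed

lemma upto_mono:
  assumes "w \<lless> v \<or> w = v"
  shows "upto w \<subseteq> upto v"
  unfolding upto_def by (rule gen_subring_mono) (use assms lt_trans in blast)

lemma base_upto: "base \<subseteq> upto v"
  unfolding upto_def by (blast intro: gen_subring.gen)

lemma generated_upto_one:
  assumes "y \<in> gen_subring (base \<union> x ` Z)" "Z \<subseteq> V"
  shows "y \<in> base \<or> (\<exists>w\<in>Z. y \<in> upto w)"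
proof -
  have upper: "\<exists>w\<in>Z. A \<subseteq> upto w \<and> B \<subseteq> upto w"
    if "A \<subseteq> upto u" "B \<subseteq> upto v" "u \<in> Z" "v \<in> Z" for A B u v
    using that lt_total[of u v] upto_mono[of u v] upto_mono[of v u] assms(2) by blast
  have both: "a \<in> base \<and> b \<in> base \<or> (\<exists>w\<in>Z. a \<in> upto w \<and> b \<in> upto w)"
    if "a \<in> base \<or> (\<exists>w\<in>Z. a \<in> upto w)" "b \<in> base \<or> (\<exists>w\<in>Z. b \<in> upto w)" for a b
    using that upper[of "{a}" _ "{b}"] base_upto by blast
  have ops: "a + b \<in> upto w" "a * b \<in> upto w" if "a \<in> upto w" "b \<in> upto w" for a b w
    using that unfolding upto_def by (auto intro: gen_subring.intros)
  show ?thesis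
    using assms(1)
  proof (induction rule: gen_subring.induct)
    case (gen g)
    then show ?case using upto_x assms(2) by blast
  next
    case (add a b)
    then show ?case
      using both[of a b] ops base_add by blast
  next
    case (mult a b)
    then show ?case
      using both[of a b] ops base_mult by blast
  qed
qed

end

section \<open>Reduction modulo a prime\<close>

locale perfect_prime = ranked_generators N \<delta> \<kappa> base V lt act x
  for N :: nat and \<delta> :: "nat \<Rightarrow> 's::comm_ring_1 \<Rightarrow> 's" and \<kappa> :: "nat \<Rightarrow> nat" and base :: "'s set"
    and V :: "'v set" and lt :: "'v \<Rightarrow> 'v \<Rightarrow> bool" (infix "\<lless>" 50)
    and act :: "nat \<Rightarrow> 'v \<Rightarrow> 'v" and x :: "'v \<Rightarrow> 's" +
  fixes P :: "'s set"
  assumes perfect_P: "perfect P" and one_P: "1 \<notin> P"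
    and prime_P: "a * b \<in> P \<Longrightarrow> a \<in> P \<or> b \<in> P"
begin

text \<open>
  A relation of degree \<open>d\<close> exhibits \<open>x v\<close> as algebraic modulo \<open>P\<close> over the subring below \<open>v\<close>; its
  leading coefficient is required to be nonzero modulo \<open>P\<close>.
\<close>

definition relation :: "'v \<Rightarrow> nat \<Rightarrow> 's poly \<Rightarrow> bool" where
  "relation v d f \<longleftrightarrow> coeffs_below v f \<and> (\<forall>i>d. coeff f i = 0) \<and> coeff f d \<notin> P \<and> poly f (x v) \<in> P"

definition alg :: "'v \<Rightarrow> bool" where
  "alg v \<longleftrightarrow> (\<exists>d f. relation v d f)"

definition alg_degree :: "'v \<Rightarrow> nat" where
  "alg_degree v = (LEAST d. \<exists>f. relation v d f)"

lemma alg_degree_relation: "alg v \<Longrightarrow> \<exists>f. relation v (alg_degree v) f"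
  unfolding alg_def alg_degree_def by (rule LeastI_ex)

lemma alg_degree_le: "relation v d f \<Longrightarrow> alg_degree v \<le> d"
  unfolding alg_degree_def by (rule Least_le) blast

lemma not_relation_below: "d < alg_degree v \<Longrightarrow> \<not> relation v d f"
  using alg_degree_le by (meson linorder_not_le)

text \<open>
  A top coefficient outside \<open>P\<close> would give a relation of too small a degree.  So it lies in \<open>P\<close>, and
  the polynomial without its top term satisfies the same hypotheses.
\<close>

lemma coeffs_in_P:
  assumes "coeffs_below v f" "\<And>i. i \<ge> n \<Longrightarrow> coeff f i = 0" "\<And>d g. d < n \<Longrightarrow> \<not> relation v d g"
    "poly f (x v) \<in> P"
  shows "coeff f i \<in> P"
  using assms
proof (induction n arbitrary: f)
  case 0
  then show ?case using perfectD(1)[OF perfect_P] by simp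
next
  case (Suc n)
  have top: "coeff f n \<in> P"
    using Suc.prems unfolding relation_def by (metis Suc_leI lessI)
  define g where "g = f - monom (coeff f n) n"
  have "coeffs_below v g"
    unfolding g_def using Suc.prems(1) by (intro coeffs_below_diff coeffs_below_monom) (auto simp: coeffs_below_def)
  moreover have "coeff g i = 0" if "i \<ge> n" for i
    using Suc.prems(2)[of i] that unfolding g_def by (cases "i = n") auto
  moreover have "poly g (x v) \<in> P"
    unfolding g_def using Suc.prems(4) top perfectD(4)[OF perfect_P]
    by (auto simp: poly_monom intro: perfect_diff[OF perfect_P])
  ultimately have "coeff g i \<in> P"
    using Suc.IH Suc.prems(3) by simp
  then show ?case
    using top unfolding g_def by (cases "i = n") auto
qed

lemma relation_degree_pos: "relation v d f \<Longrightarrow> d > 0"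
proof (rule ccontr)
  assume r: "relation v d f" and "\<not> d > 0"
  then have "degree f = 0"
    unfolding relation_def by (metis degree_le le_zero_eq not_gr_zero)
  then have "poly f (x v) = coeff f 0"
    by (auto elim: degree_eq_zeroE)
  then show False
    using r \<open>\<not> d > 0\<close> unfolding relation_def by simp
qed

text \<open>
  The separant has smaller degree than the minimal relation, and its leading coefficient is a
  positive integer, hence a unit, times that of the relation.
\<close>

lemma separant_not_in_P:
  assumes "relation v (alg_degree v) f"
  shows "poly (formal_deriv f) (x v) \<notin> P"
proof
  assume s: "poly (formal_deriv f) (x v) \<in> P"
  obtain d where d: "alg_degree v = Suc d"
    using relation_degree_pos[OF assms] by (metis gr0_implies_Suc)
  have "coeff (formal_deriv f) d \<in> P"
  proof (rule coeffs_in_P[OF _ _ _ s])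
    show "coeffs_below v (formal_deriv f)"
      using assms coeffs_below_formal_deriv unfolding relation_def by blast
    show "coeff (formal_deriv f) i = 0" if "i \<ge> Suc d" for i
      using assms that d unfolding relation_def coeff_formal_deriv by simp
    show "\<not> relation v k g" if "k < Suc d" for k g
      using not_relation_below that d by simp
  qed
  moreover obtain y :: 's where y: "of_nat (Suc d) * y = 1"
    using of_nat_unit[of "Suc d"] by blast
  ultimately have "y * (of_nat (Suc d) * coeff f (Suc d)) \<in> P"
    using perfectD(3)[OF perfect_P] unfolding coeff_formal_deriv by blast
  moreover have "y * (of_nat (Suc d) * coeff f (Suc d)) = (of_nat (Suc d) * y) * coeff f (Suc d)"
    by (simp only: mult_ac)
  ultimately have "coeff f (Suc d) \<in> P"
    by (simp only: y mult_1)
  then show False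
    using assms d unfolding relation_def by simp
qed

lemma character_relation:
  assumes "l < N" "\<kappa> l = l" "v \<in> V" "coeffs_below v f" "\<And>i. i > d \<Longrightarrow> coeff f i = 0"
  defines "h \<equiv> map_poly (\<delta> l) f"
  shows "coeffs_below (act l v) h" "\<And>i. i > d \<Longrightarrow> coeff h i = 0" "coeff h d = \<delta> l (coeff f d)"
    "poly h (x (act l v)) = \<delta> l (poly f (x v))"
  using assms \<delta>_below[OF _ assms(3,1) order_refl]
  by (auto simp: h_def coeffs_below_def coeff_map_poly \<delta>_character_poly)

text \<open>
  A character keeps the degree of a relation; every other operator turns it into a linear
  relation whose leading coefficient is a twist of the separant.
\<close>

lemma alg_act:
  assumes "alg v" "v \<in> V" "l < N"
  shows "alg (act l v)" "alg_degree (act l v) \<le> alg_degree v"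
    "\<kappa> l \<noteq> l \<Longrightarrow> alg_degree (act l v) = 1"
proof -
  obtain f where f: "relation v (alg_degree v) f"
    using alg_degree_relation assms(1) by blast
  have pos: "alg_degree v > 0"
    using relation_degree_pos f by blast
  have lin: "\<exists>h. relation (act l v) 1 h" if "\<kappa> l \<noteq> l"
  proof -
    have lt: "\<kappa> l < l" and \<kappa>: "\<kappa> l < N" "\<kappa> (\<kappa> l) = \<kappa> l"
      using that \<kappa>_le[OF assms(3)] \<kappa>_idem assms(3) by auto
    obtain T where T: "T \<in> below (act l v)"
        "\<delta> l (poly f (x v)) = \<delta> (\<kappa> l) (poly (formal_deriv f) (x v)) * x (act l v) + T"
      using \<delta>_poly_separant[OF assms(3) lt assms(2)] f unfolding relation_def by blast
    define s where "s = \<delta> (\<kappa> l) (poly (formal_deriv f) (x v))"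
    have "s \<notin> P"
      unfolding s_def using perfect_\<delta>_cancel[OF perfect_P \<kappa>] separant_not_in_P[OF f] by blast
    moreover have "s \<in> below (act l v)"
      unfolding s_def using f unfolding relation_def
      by (intro \<delta>_upto[OF poly_upto[OF assms(2)] assms(2,3) lt] coeffs_below_formal_deriv) blast
    moreover have "poly [:T, s:] (x (act l v)) = \<delta> l (poly f (x v))"
      unfolding T(2) s_def by simp
    moreover have "\<delta> l (poly f (x v)) \<in> P"
      using f perfectD(7)[OF perfect_P assms(3)] unfolding relation_def by blast
    ultimately have "relation (act l v) 1 [:T, s:]"
      using T(1) unfolding relation_def by (simp add: coeffs_below_pCons coeff_pCons split: nat.split)
    then show ?thesis by blast
  qed
  have char: "\<exists>h. relation (act l v) (alg_degree v) h" if \<kappa>: "\<kappa> l = l"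
  proof -
    note h = character_relation[OF assms(3) \<kappa> assms(2), of f "alg_degree v"]
    have "coeffs_below v f" "\<And>i. i > alg_degree v \<Longrightarrow> coeff f i = 0" "coeff f (alg_degree v) \<notin> P"
        "poly f (x v) \<in> P"
      using f unfolding relation_def by blast+
    note f' = this
    have "coeff (map_poly (\<delta> l) f) (alg_degree v) \<notin> P"
      using h(3)[OF f'(1,2)] perfect_\<delta>_cancel[OF perfect_P assms(3) \<kappa>] f'(3) by metis
    moreover have "poly (map_poly (\<delta> l) f) (x (act l v)) \<in> P"
      using h(4)[OF f'(1,2)] perfectD(7)[OF perfect_P assms(3) f'(4)] by simp
    ultimately have "relation (act l v) (alg_degree v) (map_poly (\<delta> l) f)"
      using h(1,2)[OF f'(1,2)] unfolding relation_def by blast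
    then show ?thesis by blast
  qed
  show "alg (act l v)"
    using lin char unfolding alg_def by blast
  show "alg_degree (act l v) \<le> alg_degree v"
  proof (cases "\<kappa> l = l")
    case True
    then show ?thesis using char alg_degree_le by blast
  next
    case False
    then obtain h where "relation (act l v) 1 h"
      using lin[OF False] by blast
    then have "alg_degree (act l v) \<le> 1"
      by (rule alg_degree_le)
    then show ?thesis using pos by simp
  qed
  show "alg_degree (act l v) = 1" if "\<kappa> l \<noteq> l"
  proof -
    obtain h where "relation (act l v) 1 h"
      using lin[OF \<open>\<kappa> l \<noteq> l\<close>] by blast
    then have "alg_degree (act l v) \<le> 1"
      by (rule alg_degree_le)
    moreover obtain g where "relation (act l v) (alg_degree (act l v)) g"
      using alg_degree_relation \<open>alg (act l v)\<close> by blast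
    then have "alg_degree (act l v) > 0"
      by (rule relation_degree_pos)
    ultimately show ?thesis by simp
  qed
qed

lemma alg_word:
  assumes "alg a" "a \<in> V" "set w \<subseteq> {..<N}"
  shows "alg (foldr act w a) \<and> foldr act w a \<in> V \<and> alg_degree (foldr act w a) \<le> alg_degree a"
  using assms(3)
proof (induction w)
  case Nil
  then show ?case using assms by simp
next
  case (Cons l w)
  then have IH: "alg (foldr act w a)" "foldr act w a \<in> V" "alg_degree (foldr act w a) \<le> alg_degree a"
    and l: "l < N"
    by simp_all
  show ?case
    using alg_act(1,2)[OF IH(1,2) l] act_V[OF IH(2) l] IH(3) by simp
qed

text \<open>
  A counterexample would give an infinite sequence of algebraic indices, none produced by an
  earlier one at the same degree.  Dickson's lemma finds \<open>i < j\<close> where \<open>f j\<close> comes from \<open>f i\<close> and has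
  no smaller degree; as operators do not raise degrees, the degrees agree.
\<close>

lemma finite_leaders:
  "\<exists>A. finite A \<and> (\<forall>a\<in>A. a \<in> V \<and> alg a) \<and> (\<forall>v. v \<in> V \<longrightarrow> alg v \<longrightarrow>
      (\<exists>a\<in>A. \<exists>w. set w \<subseteq> {..<N} \<and> v = foldr act w a \<and> alg_degree v = alg_degree a))"
proof (rule ccontr)
  assume none: "\<not> ?thesis"
  define covers where "covers A v \<longleftrightarrow>
      (\<exists>a\<in>A. \<exists>w. set w \<subseteq> {..<N} \<and> v = foldr act w a \<and> alg_degree v = alg_degree a)" for A v
  have "\<not> (\<exists>A. finite A \<and> (\<forall>a\<in>A. a \<in> V \<and> alg a) \<and> (\<forall>v. v \<in> V \<longrightarrow> alg v \<longrightarrow> covers A v))"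
    using none unfolding covers_def .
  then have ex: "\<exists>v. v \<in> V \<and> alg v \<and> \<not> covers A v" if A: "finite A" "\<forall>a\<in>A. a \<in> V \<and> alg a" for A
    using A by blast
  define pick where "pick A = (SOME v. v \<in> V \<and> alg v \<and> \<not> covers A v)" for A
  have pick: "pick A \<in> V \<and> alg (pick A) \<and> \<not> covers A (pick A)"
    if "finite A" "\<forall>a\<in>A. a \<in> V \<and> alg a" for A
    unfolding pick_def by (rule someI_ex[OF ex[OF that]])
  define G where "G n = ((\<lambda>A. insert (pick A) A) ^^ n) {}" for n
  define f where "f n = pick (G n)" for n
  have G_Suc: "G (Suc n) = insert (f n) (G n)" for n
    by (simp add: G_def f_def)
  have G: "finite (G n) \<and> (\<forall>a\<in>G n. a \<in> V \<and> alg a)" for n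
  proof (induction n)
    case 0
    then show ?case by (simp add: G_def)
  next
    case (Suc n)
    then show ?case using pick[of "G n"] by (simp add: G_Suc f_def)
  qed
  have f: "f n \<in> V" "alg (f n)" "\<not> covers (G n) (f n)" for n
    using pick[of "G n"] G[of n] by (auto simp: f_def)
  have in_G: "f i \<in> G n" if "i < n" for i n
    using that by (induction n) (auto simp: G_Suc less_Suc_eq)
  obtain i j w where ij: "i < j" "alg_degree (f i) \<le> alg_degree (f j)" "set w \<subseteq> {..<N}"
      "f j = foldr act w (f i)"
    using dickson[of f "\<lambda>n. alg_degree (f n)"] f(1) by blast
  then have "alg_degree (f j) = alg_degree (f i)"
    using alg_word[OF f(2,1), of w i] by simp
  then have "covers (G j) (f j)"
    unfolding covers_def using in_G[OF ij(1)] ij by blast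
  then show False
    using f(3) by blast
qed

text \<open>
  The relation of \<open>a\<close> is carried along the word \<open>w\<close>.  Its leading coefficient becomes a conjugate
  of the original one under endomorphisms, and a perfect ideal containing the conjugate contains
  the original.
\<close>

lemma transported_relation:
  assumes a: "a \<in> V" "alg a" "relation a (alg_degree a) f" and Q: "perfect Q" "poly f (x a) \<in> Q"
    and w: "set w \<subseteq> {..<N}" "alg_degree (foldr act w a) = alg_degree a"
  shows "\<exists>h. coeffs_below (foldr act w a) h \<and> (\<forall>i>alg_degree a. coeff h i = 0) \<and>
      poly h (x (foldr act w a)) \<in> Q \<and>
      (\<forall>J. perfect J \<longrightarrow> coeff h (alg_degree a) \<in> J \<longrightarrow> coeff f (alg_degree a) \<in> J)"
  using w
proof (induction w)
  case Nil
  then show ?case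
    using a(3) Q(2) unfolding relation_def by auto
next
  case (Cons l w)
  define v where "v = foldr act w a"
  have l: "l < N" and w: "set w \<subseteq> {..<N}"
    using Cons.prems by auto
  have v: "alg v" "v \<in> V" "alg_degree v \<le> alg_degree a"
    using alg_word[OF a(2,1) w] by (auto simp: v_def)
  have dv: "alg_degree v = alg_degree a"
    using alg_act(2)[OF v(1,2) l] v(3) Cons.prems(2) by (simp add: v_def)
  obtain h where h: "coeffs_below v h" "\<And>i. i > alg_degree a \<Longrightarrow> coeff h i = 0" "poly h (x v) \<in> Q"
      "\<And>J. perfect J \<Longrightarrow> coeff h (alg_degree a) \<in> J \<Longrightarrow> coeff f (alg_degree a) \<in> J"
    using Cons.IH[OF w] dv unfolding v_def by blast
  have hQ: "\<delta> l (poly h (x v)) \<in> Q"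
    using perfectD(7)[OF Q(1) l h(3)] .
  show ?case
  proof (cases "\<kappa> l = l")
    case True
    note h' = character_relation[OF l True v(2) h(1,2)]
    have "coeff f (alg_degree a) \<in> J" if "perfect J" "coeff (map_poly (\<delta> l) h) (alg_degree a) \<in> J" for J
      using perfect_\<delta>_cancel[OF that(1) l True] that h'(3) h(4) by metis
    moreover have "foldr act (l # w) a = act l v"
      by (simp add: v_def)
    ultimately show ?thesis
      using h'(1,2,4) hQ by metis
  next
    case False
    \<comment> \<open>Such an operator forces degree \<open>1\<close>, so the separant of \<open>h\<close> is its leading coefficient.\<close>
    then have lt: "\<kappa> l < l" and \<kappa>: "\<kappa> l < N" "\<kappa> (\<kappa> l) = \<kappa> l"
      using \<kappa>_le[OF l] \<kappa>_idem l by auto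
    have d: "alg_degree a = 1"
      using alg_act(3)[OF v(1,2) l False] Cons.prems(2) by (simp add: v_def)
    have "formal_deriv h = [:coeff h 1:]"
      by (rule poly_eqI) (use h(2) d in \<open>auto simp: coeff_formal_deriv coeff_pCons split: nat.split\<close>)
    then have s: "poly (formal_deriv h) (x v) = coeff h 1"
      by simp
    obtain T where T: "T \<in> below (act l v)"
        "\<delta> l (poly h (x v)) = \<delta> (\<kappa> l) (coeff h 1) * x (act l v) + T"
      using \<delta>_poly_separant[OF l lt v(2) h(1)] unfolding s by blast
    have "\<delta> (\<kappa> l) (coeff h 1) \<in> below (act l v)"
      by (rule \<delta>_below[OF _ v(2) l]) (use h(1) lt in \<open>auto simp: coeffs_below_def\<close>)
    then have "coeffs_below (act l v) [:T, \<delta> (\<kappa> l) (coeff h 1):]"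
      using T(1) by (simp add: coeffs_below_pCons)
    moreover have "\<forall>i>alg_degree a. coeff [:T, \<delta> (\<kappa> l) (coeff h 1):] i = 0"
      by (simp add: d coeff_pCons split: nat.split)
    moreover have "poly [:T, \<delta> (\<kappa> l) (coeff h 1):] (x (act l v)) \<in> Q"
      using hQ T(2) by (simp add: mult.commute add.commute)
    moreover have "coeff f (alg_degree a) \<in> J"
      if "perfect J" "coeff [:T, \<delta> (\<kappa> l) (coeff h 1):] (alg_degree a) \<in> J" for J
      using perfect_\<delta>_cancel[OF that(1) \<kappa>] that h(4) d by simp
    moreover have "foldr act (l # w) a = act l v"
      by (simp add: v_def)
    ultimately show ?thesis
      by metis
  qed
qed

lemma poly_in_perfect:
  assumes "perfect Q" "\<And>i. coeff f i \<in> Q"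
  shows "poly f y \<in> Q"
  unfolding poly_altdef by (intro perfect_sum perfectD(4) assms)

text \<open>
  Each division step multiplies by the leading coefficient of \<open>h\<close>, which \<open>cancel\<close> removes again.
  Once the degree drops below \<open>alg_degree v\<close>, all coefficients lie in \<open>P\<close> by minimality.
\<close>

lemma pseudo_division:
  assumes Q: "perfect Q" and v: "v \<in> V" "alg v"
    and below: "\<And>y. y \<in> below v \<Longrightarrow> y \<in> P \<Longrightarrow> y \<in> Q"
    and h: "coeffs_below v h" "\<And>i. i > alg_degree v \<Longrightarrow> coeff h i = 0" "poly h (x v) \<in> Q" "poly h (x v) \<in> P"
    and cancel: "\<And>y. coeff h (alg_degree v) * y \<in> Q \<Longrightarrow> y \<in> Q"
    and g: "coeffs_below v g" "poly g (x v) \<in> P" "\<And>i. i \<ge> n \<Longrightarrow> coeff g i = 0"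
  shows "poly g (x v) \<in> Q"
  using g
proof (induction n arbitrary: g)
  case 0
  then have "g = 0" by (simp add: poly_eq_iff)
  then show ?case using perfectD(1)[OF Q] by simp
next
  case (Suc n)
  define d where "d = alg_degree v"
  show ?case
  proof (cases "Suc n \<le> d")
    case True
    have "coeff g i \<in> P" for i
      by (rule coeffs_in_P[OF Suc.prems(1,3) _ Suc.prems(2)])
        (use True not_relation_below in \<open>auto simp: d_def\<close>)
    then show ?thesis
      using below Suc.prems(1) by (intro poly_in_perfect[OF Q]) (auto simp: coeffs_below_def)
  next
    case False
    define u where "u = coeff h d"
    define g' where "g' = smult u g - monom (coeff g n) (n - d) * h"
    have "coeffs_below v g'"
      unfolding g'_def u_def using Suc.prems(1) h(1)
      by (intro coeffs_below_diff coeffs_below_smult coeffs_below_mult coeffs_below_monom) (auto simp: coeffs_below_def)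
    moreover have "coeff g' i = 0" if "i \<ge> n" for i
    proof (cases "i = n")
      case True
      then show ?thesis
        using False by (simp add: g'_def u_def coeff_monom_mult)
    next
      case neq: False
      then have "i > n" "i - (n - d) > d"
        using that False by auto
      then show ?thesis
        using Suc.prems(3)[of i] h(2)[of "i - (n - d)"]
        by (simp add: g'_def coeff_monom_mult d_def)
    qed
    moreover have eval: "poly g' (x v) = u * poly g (x v) - poly (monom (coeff g n) (n - d)) (x v) * poly h (x v)"
      by (simp add: g'_def)
    moreover have "poly g' (x v) \<in> P"
      unfolding eval by (intro perfect_diff perfectD(3) perfect_P Suc.prems h)
    ultimately have "poly g' (x v) \<in> Q"
      using Suc.IH by blast
    then have "poly g' (x v) + poly (monom (coeff g n) (n - d)) (x v) * poly h (x v) \<in> Q"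
      using h(3) Q perfectD(2,3) by blast
    then have "u * poly g (x v) \<in> Q"
      unfolding eval by simp
    then show ?thesis
      using cancel unfolding u_def d_def by blast
  qed
qed

lemma transcendental_coeffs:
  assumes "\<not> alg v" "coeffs_below v g" "poly g (x v) \<in> P"
  shows "coeff g i \<in> P"
proof (rule coeffs_in_P[OF assms(2) _ _ assms(3)])
  show "coeff g i = 0" if "i \<ge> Suc (degree g)" for i
    using that by (simp add: coeff_eq_0)
qed (use assms(1) in \<open>auto simp: alg_def\<close>)

lemma prod_in_P: "finite A \<Longrightarrow> prod f A \<in> P \<Longrightarrow> \<exists>a\<in>A. f a \<in> P"
  by (induction A rule: finite_induct) (use one_P prime_P in auto)

text \<open>
  With \<open>H\<close> the product of the leading coefficients at the finitely many leaders, well-founded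
  induction on \<open>v\<close> shows that the part of \<open>P\<close> generated up to \<open>v\<close> lies in the colon ideal
  \<open>{y. y H \<in> Q}\<close>.
\<close>

lemma reduction:
  assumes base_fg: "\<exists>F. finite F \<and> F \<subseteq> P \<inter> base \<and> (\<forall>Q. perfect Q \<longrightarrow> F \<subseteq> Q \<longrightarrow> P \<inter> base \<subseteq> Q)"
  shows "\<exists>F h. finite F \<and> F \<subseteq> P \<and> h \<notin> P \<and> (\<forall>Q. perfect Q \<longrightarrow> F \<subseteq> Q \<longrightarrow> (\<forall>g\<in>P. h * g \<in> Q))"
proof -
  obtain F0 where F0: "finite F0" "F0 \<subseteq> P" "\<And>Q. perfect Q \<Longrightarrow> F0 \<subseteq> Q \<Longrightarrow> P \<inter> base \<subseteq> Q"
    using base_fg by blast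
  obtain A where A: "finite A" "\<And>a. a \<in> A \<Longrightarrow> a \<in> V \<and> alg a"
    "\<And>v. v \<in> V \<Longrightarrow> alg v \<Longrightarrow>
      \<exists>a\<in>A. \<exists>w. set w \<subseteq> {..<N} \<and> v = foldr act w a \<and> alg_degree v = alg_degree a"
    using finite_leaders by blast
  obtain f where f: "\<And>a. a \<in> A \<Longrightarrow> relation a (alg_degree a) (f a)"
    using alg_degree_relation A(2) by metis
  define c where "c a = coeff (f a) (alg_degree a)" for a
  define H where "H = prod c A"
  define F where "F = F0 \<union> (\<lambda>a. poly (f a) (x a)) ` A"
  have H: "H \<notin> P"
    using prod_in_P[OF A(1)] f unfolding H_def c_def relation_def by blast
  have "H * g \<in> Q" if Q: "perfect Q" "F \<subseteq> Q" "Q \<subseteq> P" and g: "g \<in> P" for Q g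
  proof -
    define Q' where "Q' = {y. y * H \<in> Q}"
    have Q': "perfect Q'"
      unfolding Q'_def by (rule perfect_colon[OF Q(1)])
    have QQ': "Q \<subseteq> Q'"
      unfolding Q'_def using perfectD(4)[OF Q(1)] by blast
    have base: "y \<in> Q'" if "y \<in> base" "y \<in> P" for y
      using F0(3)[OF Q(1)] Q(2) QQ' that unfolding F_def by blast
    have upto: "y \<in> Q'" if "v \<in> V" "y \<in> upto v" "y \<in> P" for v y
      using that
    proof (induction v arbitrary: y rule: wf_induct_rule[OF wf_lt])
      case (1 v)
      have below: "y \<in> Q'" if "y \<in> below v" "y \<in> P" for y
        using generated_upto_one[of y "{w \<in> V. w \<lless> v}"] that 1(1) base
        unfolding below_def by blast
      obtain g where g: "coeffs_below v g" "y = poly g (x v)"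
        using upto_poly 1(3) by blast
      show ?case
      proof (cases "alg v")
        case False
        then have "coeff g i \<in> P" for i
          by (rule transcendental_coeffs[OF _ g(1)]) (use 1(4) g(2) in simp)
        then have "coeff g i \<in> Q'" for i
          using below g(1) unfolding coeffs_below_def by blast
        then show ?thesis
          unfolding g(2) by (rule poly_in_perfect[OF Q'])
      next
        case True
        obtain a w where a: "a \<in> A" "set w \<subseteq> {..<N}" "v = foldr act w a" "alg_degree v = alg_degree a"
          using A(3)[OF 1(2) True] by blast
        have "poly (f a) (x a) \<in> Q"
          using Q(2) a(1) unfolding F_def by blast
        then obtain h where h: "coeffs_below v h" "\<And>i. i > alg_degree v \<Longrightarrow> coeff h i = 0" "poly h (x v) \<in> Q"
            "\<And>J. perfect J \<Longrightarrow> coeff h (alg_degree v) \<in> J \<Longrightarrow> c a \<in> J"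
          using transported_relation[OF _ _ f[OF a(1)] Q(1) _ a(2)] A(2)[OF a(1)] a(3,4)
          unfolding c_def by metis
        have cancel: "y \<in> Q'" if y: "coeff h (alg_degree v) * y \<in> Q'" for y
        proof -
          \<comment> \<open>The leading coefficient may be replaced by \<open>c a\<close>, which divides \<open>H\<close>.\<close>
          have "coeff h (alg_degree v) \<in> {z. z * (y * H) \<in> Q}"
            using y unfolding Q'_def by (simp add: mult.assoc)
          then have "c a * (y * H) \<in> Q"
            using h(4)[OF perfect_colon[OF Q(1)]] by blast
          moreover have "H = c a * prod c (A - {a})"
            unfolding H_def by (rule prod.remove[OF A(1) a(1)])
          then have "(y * H) * (y * H) = (y * prod c (A - {a})) * (c a * (y * H))"
            by (simp add: mult_ac)
          ultimately have "(y * H) * (y * H) \<in> Q"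
            using perfectD(3)[OF Q(1)] by metis
          then show ?thesis
            unfolding Q'_def using perfectD(6)[OF Q(1)] by blast
        qed
        have "poly g (x v) \<in> Q'"
        proof (rule pseudo_division[OF Q' 1(2) True below h(1,2) _ _ cancel g(1)])
          show "poly h (x v) \<in> Q'" "poly h (x v) \<in> P"
            using h(3) QQ' Q(3) by auto
          show "coeff g i = 0" if "i \<ge> Suc (degree g)" for i
            using that by (simp add: coeff_eq_0)
        qed (use 1(4) g(2) in auto)
        then show ?thesis
          using g(2) by simp
      qed
    qed
    have "g \<in> Q'"
      using generated_upto_one[OF generates order_refl, of g] upto base g by blast
    then show ?thesis
      unfolding Q'_def by (simp add: mult.commute)
  qed
  note * = this
  have FP: "F \<subseteq> P"
    using F0(2) f unfolding F_def relation_def by blast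
  have "H * g \<in> Q" if Q: "perfect Q" "F \<subseteq> Q" and g: "g \<in> P" for Q g
  proof -
    have "perfect (\<Inter>{Q, P})"
      by (rule perfect_Inter) (use Q perfect_P in auto)
    then have "H * g \<in> \<Inter>{Q, P}"
      by (rule *) (use Q FP g in auto)
    then show ?thesis by simp
  qed
  moreover have "finite F"
    using F0(1) A(1) unfolding F_def by simp
  ultimately show ?thesis
    using FP H by blast
qed

end

text \<open>
  What remains to be supplied for the coefficients is finite generation of the traces of perfect
  ideals on \<open>base\<close>.
\<close>

theorem (in ranked_generators) chains_stabilise_perfect:
  assumes base_fg: "\<And>P. perfect P \<Longrightarrow>
    \<exists>F. finite F \<and> F \<subseteq> P \<inter> base \<and> (\<forall>Q. perfect Q \<longrightarrow> F \<subseteq> Q \<longrightarrow> P \<inter> base \<subseteq> Q)"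
  shows "chains_stabilise perfect"
proof (rule chains_stabilise_if_fin_generated)
  fix I assume I: "perfect I"
  show "fin_generated perfect I"
  proof (rule all_fin_generated[OF _ I])
    fix P assume P: "perfect P" "1 \<notin> P" "\<And>a b. a * b \<in> P \<Longrightarrow> a \<in> P \<or> b \<in> P"
    interpret perfect_prime N \<delta> \<kappa> base V lt act x P
      by unfold_locales (use P in auto)
    show "\<exists>F h. finite F \<and> F \<subseteq> P \<and> h \<notin> P \<and> (\<forall>Q. perfect Q \<longrightarrow> F \<subseteq> Q \<longrightarrow> (\<forall>g\<in>P. h * g \<in> Q))"
      by (rule reduction[OF base_fg[OF P(1)]])
  qed
qed (rule perfect_Union_chain)

section \<open>Triangular systems of functionals\<close>

definition linear_functional :: "('k::field \<Rightarrow> 'd::ab_group_add \<Rightarrow> 'd) \<Rightarrow> ('d \<Rightarrow> 'k) \<Rightarrow> bool" where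
  "linear_functional s \<phi> \<longleftrightarrow> (\<forall>x y. \<phi> (x + y) = \<phi> x + \<phi> y) \<and> (\<forall>c x. \<phi> (s c x) = c * \<phi> x)"

lemma linear_functionalD:
  assumes "linear_functional s \<phi>"
  shows "\<phi> (x + y) = \<phi> x + \<phi> y" "\<phi> (s c x) = c * \<phi> x" "\<phi> 0 = 0" "\<phi> (x - y) = \<phi> x - \<phi> y"
    "\<phi> (sum f J) = (\<Sum>i\<in>J. \<phi> (f i))"
proof -
  show a: "\<phi> (x + y) = \<phi> x + \<phi> y" and "\<phi> (s c x) = c * \<phi> x" for x y c
    using assms unfolding linear_functional_def by auto
  have "\<phi> 0 + \<phi> 0 = \<phi> 0 + 0"
    using a[of 0 0] by simp
  then show z: "\<phi> 0 = 0"
    by (rule add_left_imp_eq)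
  show "\<phi> (x - y) = \<phi> x - \<phi> y"
    using a[of "x - y" y] by simp
  show "\<phi> (sum f J) = (\<Sum>i\<in>J. \<phi> (f i))"
    by (induction J rule: infinite_finite_induct) (auto simp: a z)
qed

text \<open>
  The characters \<open>\<chi> i\<close> stand for the residue maps of the local factors.  As they detect the units,
  every maximal ideal contains, and so is, the kernel of one of them.
\<close>

locale split_algebra = finite_dimensional_vector_space scale Basis
  for scale :: "'k::field \<Rightarrow> 'd::comm_ring_1 \<Rightarrow> 'd" (infixr "\<star>" 75) and Basis :: "'d set" +
  fixes t :: nat and \<chi> :: "nat \<Rightarrow> 'd \<Rightarrow> 'k"
  assumes scale_mult: "(c \<star> x) * y = c \<star> (x * y)"
    and \<chi>_add: "i < t \<Longrightarrow> \<chi> i (x + y) = \<chi> i x + \<chi> i y"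
    and \<chi>_scale: "i < t \<Longrightarrow> \<chi> i (c \<star> x) = c * \<chi> i x"
    and \<chi>_mult: "i < t \<Longrightarrow> \<chi> i (x * y) = \<chi> i x * \<chi> i y"
    and \<chi>_one: "i < t \<Longrightarrow> \<chi> i 1 = 1"
    and unit: "(\<And>i. i < t \<Longrightarrow> \<chi> i x \<noteq> 0) \<Longrightarrow> \<exists>y. x * y = 1"
begin

abbreviation functional :: "('d \<Rightarrow> 'k) \<Rightarrow> bool" where
  "functional \<equiv> linear_functional scale"

lemmas functionalD = linear_functionalD[where s = scale]

lemma functional_\<chi>: "i < t \<Longrightarrow> functional (\<chi> i)"
  by (simp add: linear_functional_def \<chi>_add \<chi>_scale)

lemma mult_scale: "x * (c \<star> y) = c \<star> (x * y)"
  using scale_mult[of c y x] by (simp add: mult.commute)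

definition is_ideal :: "'d set \<Rightarrow> bool" where
  "is_ideal I \<longleftrightarrow> 0 \<in> I \<and> (\<forall>a\<in>I. \<forall>b\<in>I. a + b \<in> I) \<and> (\<forall>a\<in>I. \<forall>r. r * a \<in> I)"

lemma is_ideal_subspace: "is_ideal I \<Longrightarrow> subspace I"
  unfolding is_ideal_def subspace_def by (metis mult_1 scale_mult)

lemma separating_functional:
  assumes W: "subspace W" and y: "y \<notin> W"
  obtains \<phi> where "functional \<phi>" "\<phi> y = 1" "\<And>w. w \<in> W \<Longrightarrow> \<phi> w = 0"
proof -
  interpret pair: vector_space_pair scale "(*) :: 'k \<Rightarrow> 'k \<Rightarrow> 'k"
    by unfold_locales (simp_all add: distrib_left distrib_right)
  obtain B where B: "B \<subseteq> W" "independent B" "W \<subseteq> span B"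
    by (rule maximal_independent_subset)
  have "y \<notin> span B"
    using B(1) W y span_minimal by blast
  then have "independent (insert y B)"
    using B(2) by (rule independent_insertI)
  then obtain \<phi> where \<phi>: "Vector_Spaces.linear scale (*) \<phi>"
      "\<And>x. x \<in> insert y B \<Longrightarrow> \<phi> x = (if x = y then 1 else 0)"
    using pair.linear_independent_extend[of "insert y B" "\<lambda>x. if x = y then 1 else 0"] by blast
  interpret \<phi>: Vector_Spaces.linear scale "(*)" \<phi>
    by (rule \<phi>(1))
  have "\<phi> w = 0" if "w \<in> span B" for w
    by (rule \<phi>.eq_0_on_span[OF _ that]) (use \<phi>(2) B(1) y in auto)
  moreover have "functional \<phi>"
    by (simp add: linear_functional_def \<phi>.add \<phi>.scale)
  ultimately show thesis
    using that \<phi>(2)[of y] B(3) by auto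
qed

lemma maximal_subideal:
  assumes "is_ideal I" "I \<noteq> {0}"
  shows "\<exists>I'. is_ideal I' \<and> I' \<subset> I \<and> (\<forall>J. is_ideal J \<longrightarrow> I' \<subset> J \<longrightarrow> J \<subseteq> I \<longrightarrow> J = I)"
proof -
  define Z where "Z = {J. is_ideal J \<and> J \<subset> I}"
  have "{0} \<in> Z"
    using assms unfolding Z_def is_ideal_def by auto
  moreover have "\<forall>J. J \<in> Z \<longrightarrow> dim J < Suc dimension"
    using dim_subset_UNIV by (simp add: le_imp_less_Suc)
  ultimately obtain I' where I': "I' \<in> Z" "\<And>J. J \<in> Z \<Longrightarrow> dim J \<le> dim I'"
    using ex_has_greatest_nat[of "\<lambda>J. J \<in> Z" "{0}" dim "Suc dimension"] by blast
  have "J = I" if J: "is_ideal J" "I' \<subset> J" "J \<subseteq> I" for J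
  proof (rule ccontr)
    assume "J \<noteq> I"
    then have "J \<in> Z"
      using J unfolding Z_def by blast
    then have "dim J \<le> dim I'"
      by (rule I'(2))
    then have "I' = J"
      using subspace_dim_equal[of I' J] I'(1) J is_ideal_subspace unfolding Z_def by blast
    then show False
      using J(2) by blast
  qed
  then show ?thesis
    using I'(1) unfolding Z_def by blast
qed

text \<open>
  A maximal proper subideal \<open>I'\<close> of \<open>I\<close> makes \<open>I / I'\<close> a simple module.  Its annihilator is the kernel
  of a character, so \<open>I / I'\<close> is a line on which the algebra acts through that character, and \<open>\<phi>\<close> is
  a coordinate on this line.
\<close>

lemma peel_functional:
  assumes I: "is_ideal I" "I \<noteq> {0}"
  obtains i \<phi> y where "i < t" "functional \<phi>" "y \<in> I" "\<phi> y = 1"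
    "\<And>r z. z \<in> I \<Longrightarrow> \<phi> (r * z) = \<chi> i r * \<phi> z"
proof -
  obtain I' where I': "is_ideal I'" "I' \<subset> I" "\<And>J. is_ideal J \<Longrightarrow> I' \<subset> J \<Longrightarrow> J \<subseteq> I \<Longrightarrow> J = I"
    using maximal_subideal[OF I] by blast
  then obtain y where y: "y \<in> I" "y \<notin> I'"
    by blast
  have mult: "r * a \<in> I'" if "a \<in> I'" for r a
    using I'(1) that unfolding is_ideal_def by blast
  have generate: "\<exists>b w. w \<in> I' \<and> z = b * u + w" if u: "u \<in> I" "u \<notin> I'" and z: "z \<in> I" for u z
  proof -
    define J where "J = {b * u + w | b w. w \<in> I'}"
    have JI: "b * u + w \<in> J" if "w \<in> I'" for b w
      unfolding J_def using that by blast
    have zero: "0 \<in> I'"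
      using I'(1) unfolding is_ideal_def by blast
    have "is_ideal J"
      unfolding is_ideal_def
    proof (intro conjI ballI allI)
      show "0 \<in> J"
        using JI[OF zero, of 0] by simp
      fix a assume a: "a \<in> J"
      then obtain b w where bw: "a = b * u + w" "w \<in> I'"
        unfolding J_def by blast
      show "r * a \<in> J" for r
        using JI[OF mult[OF bw(2)], of "r * b" r] by (simp add: bw(1) distrib_left mult.assoc)
      fix a' assume "a' \<in> J"
      then obtain b' w' where bw': "a' = b' * u + w'" "w' \<in> I'"
        unfolding J_def by blast
      have "w + w' \<in> I'"
        using bw(2) bw'(2) I'(1) unfolding is_ideal_def by blast
      then show "a + a' \<in> J"
        using JI[of "w + w'" "b + b'"] by (simp add: bw(1) bw'(1) algebra_simps)
    qed
    moreover have "I' \<subset> J"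
      using JI[of _ 0] JI[OF zero, of 1] u by auto
    moreover have "J \<subseteq> I"
      unfolding J_def using u(1) I(1) I'(2) unfolding is_ideal_def by blast
    ultimately have "J = I"
      by (rule I'(3))
    then show ?thesis
      using z unfolding J_def by blast
  qed
  define M where "M = {a. a * y \<in> I'}"
  have invert: "\<exists>b. 1 - b * a \<in> M" if a: "a \<notin> M" for a
  proof -
    obtain b w where bw: "w \<in> I'" "y = b * (a * y) + w"
      using generate[of "a * y" y] a y I(1) unfolding M_def is_ideal_def by blast
    have "(1 - b * a) * y = y - b * (a * y)"
      by (simp add: algebra_simps)
    also have "\<dots> = w"
      using bw(2) by (metis add_diff_cancel_left')
    finally have "(1 - b * a) * y \<in> I'"
      using bw(1) by simp
    then show ?thesis
      unfolding M_def by blast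
  qed
  have M_mult: "r * a \<in> M" if "a \<in> M" for r a
    using that mult unfolding M_def by (simp add: mult.assoc)
  have M_prime: "a * b \<notin> M" if a: "a \<notin> M" and b: "b \<notin> M" for a b
  proof
    assume ab: "a * b \<in> M"
    obtain c where c: "1 - c * a \<in> M"
      using invert a by blast
    have "b * y = c * (a * b * y) + b * ((1 - c * a) * y)"
      by (simp add: algebra_simps)
    moreover have "c * (a * b * y) \<in> I'" "b * ((1 - c * a) * y) \<in> I'"
      using ab c mult unfolding M_def by blast+
    ultimately have "b * y \<in> I'"
      using I'(1) unfolding is_ideal_def by metis
    then show False
      using b unfolding M_def by blast
  qed
  have one_M: "1 \<notin> M"
    using y unfolding M_def by simp
  \<comment> \<open>\<open>M\<close> is the annihilator of a simple module, hence maximal; a product of elements of the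
    kernels that avoid \<open>M\<close> would give a unit in \<open>M\<close>.\<close>
  have "\<exists>i<t. \<forall>a. \<chi> i a = 0 \<longrightarrow> a \<in> M"
  proof (rule ccontr)
    assume "\<not> ?thesis"
    then have "\<forall>i. \<exists>a. i < t \<longrightarrow> \<chi> i a = 0 \<and> a \<notin> M"
      by blast
    then obtain a where a: "\<And>i. i < t \<Longrightarrow> \<chi> i (a i) = 0 \<and> a i \<notin> M"
      by metis
    have "prod a {..<n} \<notin> M" if "n \<le> t" for n
      using that by (induction n) (use one_M M_prime a in auto)
    then obtain b where b: "1 - b * prod a {..<t} \<in> M"
      using invert by blast
    have "\<chi> i (1 - b * prod a {..<t}) \<noteq> 0" if "i < t" for i
    proof -
      have "prod a {..<t} = a i * prod a ({..<t} - {i})"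
        by (rule prod.remove) (use that in auto)
      then have "\<chi> i (prod a {..<t}) = 0"
        using a[OF that] \<chi>_mult[OF that] by simp
      then show ?thesis
        using \<chi>_mult[OF that] \<chi>_one[OF that] functionalD(4)[OF functional_\<chi>[OF that]] by simp
    qed
    then obtain u where "(1 - b * prod a {..<t}) * u = 1"
      using unit by blast
    then show False
      using M_mult[OF b, of u] one_M by (simp add: mult.commute)
  qed
  then obtain i where i: "i < t" "\<And>a. \<chi> i a = 0 \<Longrightarrow> a \<in> M"
    by blast
  obtain \<phi> where \<phi>: "functional \<phi>" "\<phi> y = 1" "\<And>w. w \<in> I' \<Longrightarrow> \<phi> w = 0"
    using separating_functional[OF is_ideal_subspace[OF I'(1)] y(2)] by metis
  have "\<phi> (r * z) = \<chi> i r * \<phi> z" if z: "z \<in> I" for r z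
  proof -
    have twist: "\<phi> (a * y) = \<chi> i a" for a
    proof -
      have "\<chi> i (a - \<chi> i a \<star> 1) = 0"
        using functionalD(2,4)[OF functional_\<chi>[OF i(1)]] \<chi>_one[OF i(1)] by simp
      then have "(a - \<chi> i a \<star> 1) * y \<in> I'"
        using i(2) unfolding M_def by blast
      moreover have "(a - \<chi> i a \<star> 1) * y = a * y - \<chi> i a \<star> y"
        by (simp add: left_diff_distrib scale_mult)
      ultimately show ?thesis
        using \<phi> functionalD[OF \<phi>(1)] by (metis eq_iff_diff_eq_0 mult.right_neutral)
    qed
    obtain b w where bw: "w \<in> I'" "z = b * y + w"
      using generate[OF y z] by blast
    have "\<phi> z = \<chi> i b"
      using bw \<phi>(3) twist functionalD(1)[OF \<phi>(1)] by simp
    moreover have "r * z = (r * b) * y + r * w"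
      using bw(2) by (simp add: algebra_simps)
    then have "\<phi> (r * z) = \<chi> i (r * b)"
      using \<phi>(3) mult[OF bw(1)] twist functionalD(1)[OF \<phi>(1)] by simp
    ultimately show ?thesis
      using \<chi>_mult[OF i(1)] by simp
  qed
  then show thesis
    using that i(1) \<phi>(1,2) y(1) by blast
qed

definition common_kernel :: "nat \<Rightarrow> (nat \<Rightarrow> 'd \<Rightarrow> 'k) \<Rightarrow> 'd set" where
  "common_kernel N \<phi> = {x. \<forall>l<N. \<phi> l x = 0}"

text \<open>
  The vectors \<open>v l\<close> are dual to the functionals modulo their common kernel.  The functionals may be
  dependent: one that vanishes on the kernel of its predecessors gets the vector \<open>0\<close>.
\<close>

lemma dual_vectors:
  assumes "\<And>l. l < N \<Longrightarrow> functional (\<phi> l)"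
  obtains v where "\<And>x. x - (\<Sum>l<N. \<phi> l x \<star> v l) \<in> common_kernel N \<phi>"
proof -
  have "\<exists>v. \<forall>x. x - (\<Sum>l<N. \<phi> l x \<star> v l) \<in> common_kernel N \<phi>"
    using assms
  proof (induction N)
    case 0
    then show ?case by (simp add: common_kernel_def)
  next
    case (Suc N)
    then obtain v where v: "\<And>x. x - (\<Sum>l<N. \<phi> l x \<star> v l) \<in> common_kernel N \<phi>"
      by auto
    have f: "functional (\<phi> l)" if "l \<le> N" for l
      using Suc.prems that by simp
    show ?case
    proof (cases "\<exists>y\<in>common_kernel N \<phi>. \<phi> N y \<noteq> 0")
      case False
      then have "x - (\<Sum>l<N. \<phi> l x \<star> v l) \<in> common_kernel (Suc N) \<phi>" for x
        using v[of x] unfolding common_kernel_def by (auto simp: less_Suc_eq)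
      then show ?thesis
        by (intro exI[of _ "v(N := 0)"]) simp
    next
      case True
      then obtain y0 where y0: "y0 \<in> common_kernel N \<phi>" "\<phi> N y0 \<noteq> 0"
        by blast
      define y where "y = inverse (\<phi> N y0) \<star> y0"
      have y: "y \<in> common_kernel N \<phi>" "\<phi> N y = 1"
        using y0 functionalD(2)[OF f] unfolding y_def common_kernel_def by auto
      define v' where "v' l = (if l = N then y else v l - \<phi> N (v l) \<star> y)" for l
      have "x - (\<Sum>l<Suc N. \<phi> l x \<star> v' l) \<in> common_kernel (Suc N) \<phi>" for x
      proof -
        define z where "z = x - (\<Sum>l<N. \<phi> l x \<star> v l)"
        have "(\<Sum>l<N. \<phi> l x \<star> v' l) = (\<Sum>l<N. \<phi> l x \<star> v l) - (\<Sum>l<N. \<phi> l x * \<phi> N (v l)) \<star> y"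
          by (simp add: v'_def scale_right_diff_distrib sum_subtractf scale_sum_left)
        moreover have "\<phi> N z = \<phi> N x - (\<Sum>l<N. \<phi> l x * \<phi> N (v l))"
          by (simp add: z_def functionalD[OF f])
        moreover have "v' N = y"
          by (simp add: v'_def)
        ultimately have e: "x - (\<Sum>l<Suc N. \<phi> l x \<star> v' l) = z - \<phi> N z \<star> y"
          unfolding z_def sum.lessThan_Suc by (simp add: scale_left_diff_distrib)
        have "\<phi> N (z - \<phi> N z \<star> y) = 0"
          by (simp add: functionalD(2,4)[OF f] y)
        moreover have "\<phi> l (z - \<phi> N z \<star> y) = 0" if "l < N" for l
          using v[of x, folded z_def] y that unfolding common_kernel_def
          by (simp add: functionalD(2,4)[OF f])
        ultimately show ?thesis
          unfolding e common_kernel_def by (simp add: less_Suc_eq)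
      qed
      then show ?thesis by blast
    qed
  qed
  then show thesis
    using that by blast
qed

text \<open>
  The list starts with the characters, and \<open>\<kappa> l\<close> names the character that twists \<open>\<phi> l\<close>.
\<close>

definition triangular :: "nat \<Rightarrow> (nat \<Rightarrow> 'd \<Rightarrow> 'k) \<Rightarrow> (nat \<Rightarrow> nat) \<Rightarrow> bool" where
  "triangular N \<phi> \<kappa> \<longleftrightarrow> t \<le> N \<and> (\<forall>l<t. \<phi> l = \<chi> l \<and> \<kappa> l = l) \<and> (\<forall>l<N. functional (\<phi> l)) \<and>
     (\<forall>l<N. t \<le> l \<longrightarrow> \<kappa> l < t \<and> (\<exists>c. \<forall>x y. \<phi> l (x * y) =
        \<phi> (\<kappa> l) x * \<phi> l y + \<phi> l x * \<phi> (\<kappa> l) y + (\<Sum>j<l. \<Sum>k<l. c j k * (\<phi> j x * \<phi> k y))))"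

lemma triangular_kernel_ideal:
  assumes T: "triangular N \<phi> \<kappa>"
  shows "is_ideal (common_kernel N \<phi>)"
proof -
  have f: "functional (\<phi> l)" if "l < N" for l
    using T that unfolding triangular_def by blast
  have "\<phi> l (r * a) = 0" if a: "\<And>l. l < N \<Longrightarrow> \<phi> l a = 0" and l: "l < N" for l r a
  proof (cases "l < t")
    case True
    then show ?thesis
      using T a[OF l] \<chi>_mult unfolding triangular_def by auto
  next
    case False
    then obtain c where "\<kappa> l < N" and c: "\<phi> l (r * a) =
        \<phi> (\<kappa> l) r * \<phi> l a + \<phi> l r * \<phi> (\<kappa> l) a + (\<Sum>j<l. \<Sum>k<l. c j k * (\<phi> j r * \<phi> k a))"
      using T l unfolding triangular_def by (meson leI less_le_trans)
    then show ?thesis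
      using a l by simp
  qed
  then show ?thesis
    using functionalD(1,3)[OF f] unfolding is_ideal_def common_kernel_def by simp
qed

text \<open>
  The new functional \<open>\<psi>\<close> comes from peeling a line off the common kernel \<open>I\<close>.  The bilinear defect \<open>b\<close>
  of the twisted product rule for \<open>\<psi>\<close> vanishes as soon as one argument lies in \<open>I\<close>, so dual vectors
  express it through products of the given functionals.
\<close>

lemma triangular_extend:
  assumes T: "triangular N \<phi> \<kappa>" and ne: "common_kernel N \<phi> \<noteq> {0}"
  obtains \<psi> i where "triangular (Suc N) (\<phi>(N := \<psi>)) (\<kappa>(N := i))"
    "common_kernel (Suc N) (\<phi>(N := \<psi>)) \<subset> common_kernel N \<phi>"
proof -
  have f: "functional (\<phi> l)" if "l < N" for l
    using T that unfolding triangular_def by blast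
  define I where "I = common_kernel N \<phi>"
  obtain i \<psi> y where i: "i < t" and \<psi>: "functional \<psi>" "y \<in> I" "\<psi> y = 1"
      "\<And>r z. z \<in> I \<Longrightarrow> \<psi> (r * z) = \<chi> i r * \<psi> z"
    using peel_functional[OF triangular_kernel_ideal[OF T] ne] unfolding I_def by metis
  have tN: "t \<le> N" and \<phi>i: "\<phi> i = \<chi> i"
    using T i unfolding triangular_def by auto
  obtain v where v: "\<And>x. x - (\<Sum>l<N. \<phi> l x \<star> v l) \<in> I"
    using dual_vectors[of N \<phi>] f unfolding I_def by blast
  define b where "b x y = \<psi> (x * y) - \<chi> i x * \<psi> y - \<psi> x * \<chi> i y" for x y
  have b_sym: "b x y = b y x" for x y
    by (simp add: b_def mult.commute)
  have b_I: "b x z = 0" if "z \<in> I" for x z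
  proof -
    have "\<phi> i z = 0"
      using that i tN unfolding I_def common_kernel_def by auto
    then have "\<chi> i z = 0"
      by (simp add: \<phi>i)
    then show ?thesis
      using \<psi>(4)[OF that] by (simp add: b_def)
  qed
  have b_fun: "functional (b x)" for x
    unfolding linear_functional_def b_def
    by (simp add: functionalD(1,2)[OF \<psi>(1)] \<chi>_add[OF i] \<chi>_scale[OF i] mult_scale algebra_simps)
  have b_expand: "b x y = (\<Sum>k<N. \<phi> k y * b x (v k))" for x y
  proof -
    have "b x (y - (\<Sum>k<N. \<phi> k y \<star> v k)) = 0"
      by (rule b_I[OF v])
    then show ?thesis
      by (simp add: functionalD(2,4,5)[OF b_fun])
  qed
  have b_eq: "b x y = (\<Sum>j<N. \<Sum>k<N. b (v j) (v k) * (\<phi> j x * \<phi> k y))" for x y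
  proof -
    have "b x y = (\<Sum>k<N. \<phi> k y * (\<Sum>j<N. \<phi> j x * b (v k) (v j)))"
      unfolding b_expand[of x y] by (subst b_sym, subst b_expand) simp
    also have "\<dots> = (\<Sum>k<N. \<Sum>j<N. b (v j) (v k) * (\<phi> j x * \<phi> k y))"
      by (simp add: sum_distrib_left mult_ac b_sym)
    also have "\<dots> = (\<Sum>j<N. \<Sum>k<N. b (v j) (v k) * (\<phi> j x * \<phi> k y))"
      by (rule sum.swap)
    finally show ?thesis .
  qed
  have Leibniz: "\<psi> (x * y) = \<phi> i x * \<psi> y + \<psi> x * \<phi> i y +
      (\<Sum>j<N. \<Sum>k<N. b (v j) (v k) * (\<phi> j x * \<phi> k y))" for x y
    unfolding b_eq[symmetric] \<phi>i by (simp add: b_def)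
  have "triangular (Suc N) (\<phi>(N := \<psi>)) (\<kappa>(N := i))"
    unfolding triangular_def
  proof (intro conjI allI impI)
    fix l assume l: "l < Suc N" "t \<le> l"
    show "(\<kappa>(N := i)) l < t"
      using T l i unfolding triangular_def by (auto simp: less_Suc_eq)
    show "\<exists>c. \<forall>x y. (\<phi>(N := \<psi>)) l (x * y) =
        (\<phi>(N := \<psi>)) ((\<kappa>(N := i)) l) x * (\<phi>(N := \<psi>)) l y +
        (\<phi>(N := \<psi>)) l x * (\<phi>(N := \<psi>)) ((\<kappa>(N := i)) l) y +
        (\<Sum>j<l. \<Sum>k<l. c j k * ((\<phi>(N := \<psi>)) j x * (\<phi>(N := \<psi>)) k y))"
    proof (cases "l = N")
      case True
      then show ?thesis
        using Leibniz i tN by (intro exI[of _ "\<lambda>j k. b (v j) (v k)"]) auto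
    next
      case False
      then have lN: "l < N"
        using l by simp
      then obtain c where c: "\<And>x y. \<phi> l (x * y) =
          \<phi> (\<kappa> l) x * \<phi> l y + \<phi> l x * \<phi> (\<kappa> l) y + (\<Sum>j<l. \<Sum>k<l. c j k * (\<phi> j x * \<phi> k y))"
          and "\<kappa> l < t"
        using T l(2) unfolding triangular_def by blast
      then show ?thesis
        using lN tN by (intro exI[of _ c]) (auto intro!: sum.cong)
    qed
  qed (use T \<psi>(1) f tN in \<open>auto simp: triangular_def less_Suc_eq\<close>)
  moreover have "common_kernel (Suc N) (\<phi>(N := \<psi>)) \<subset> common_kernel N \<phi>"
  proof
    show "common_kernel (Suc N) (\<phi>(N := \<psi>)) \<subseteq> common_kernel N \<phi>"
      unfolding common_kernel_def by (auto simp: less_Suc_eq)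
    have "y \<notin> common_kernel (Suc N) (\<phi>(N := \<psi>))"
      unfolding common_kernel_def using \<psi>(3) by auto
    then show "common_kernel (Suc N) (\<phi>(N := \<psi>)) \<noteq> common_kernel N \<phi>"
      using \<psi>(2) unfolding I_def by blast
  qed
  ultimately show thesis
    by (rule that)
qed

text \<open>
  The dimension of the common kernel drops with each extension.
\<close>

theorem triangular_exists:
  obtains N \<phi> \<kappa> where "triangular N \<phi> \<kappa>" "common_kernel N \<phi> = {0}"
proof -
  have "triangular t \<chi> id"
    unfolding triangular_def using functional_\<chi> by simp
  moreover have "\<exists>N' \<phi>' \<kappa>'. triangular N' \<phi>' \<kappa>' \<and> common_kernel N' \<phi>' = {0}"
    if "triangular N \<phi> \<kappa>" for N \<phi> \<kappa>
    using that
  proof (induction "dim (common_kernel N \<phi>)" arbitrary: N \<phi> \<kappa> rule: less_induct)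
    case less
    show ?case
    proof (cases "common_kernel N \<phi> = {0}")
      case True
      then show ?thesis using less.prems by blast
    next
      case False
      obtain \<psi> i where T: "triangular (Suc N) (\<phi>(N := \<psi>)) (\<kappa>(N := i))"
          and K: "common_kernel (Suc N) (\<phi>(N := \<psi>)) \<subset> common_kernel N \<phi>"
        by (rule triangular_extend[OF less.prems False])
      have "span (common_kernel (Suc N) (\<phi>(N := \<psi>))) \<subset> span (common_kernel N \<phi>)"
        using K is_ideal_subspace triangular_kernel_ideal T less.prems span_eq_iff by metis
      then show ?thesis
        using less.hyps[OF dim_psubset T] by blast
    qed
  qed
  ultimately show thesis
    using that by blast
qed

text \<open>
  The coefficients of a functional \<open>\<psi>\<close> with respect to the list are its values at the dual vectors.
\<close>

lemma functional_in_span: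
  assumes "\<And>l. l < N \<Longrightarrow> functional (\<phi> l)" "common_kernel N \<phi> = {0}"
  obtains v where "\<And>\<psi> x. functional \<psi> \<Longrightarrow> \<psi> x = (\<Sum>l<N. \<phi> l x * \<psi> (v l))"
proof -
  obtain v where v: "\<And>x. x - (\<Sum>l<N. \<phi> l x \<star> v l) \<in> common_kernel N \<phi>"
    using dual_vectors[of N \<phi>] assms(1) by blast
  then have x: "x = (\<Sum>l<N. \<phi> l x \<star> v l)" for x
    using assms(2) by auto
  show thesis
    by (rule that, subst x) (simp add: functionalD)
qed

end

section \<open>Additive maps out of tensor products\<close>

text \<open>
  The additive extension of \<open>\<phi>\<close> to formal sums, of which \<open>tensor_lift\<close> takes the common value on a
  coset.
\<close>

definition tensor_eval :: "('k, 'm) module \<Rightarrow> ('a \<Rightarrow> 'b \<Rightarrow> 'm) \<Rightarrow> ('a \<times> 'b \<Rightarrow>\<^sub>0 int) \<Rightarrow> 'm" where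
  "tensor_eval M \<phi> f =
     (\<Oplus>\<^bsub>M\<^esub>p\<in>Poly_Mapping.keys f. add_pow M (Poly_Mapping.lookup f p) (\<phi> (fst p) (snd p)))"

lemma hom_free_eqI:
  assumes H: "group H" and h: "h \<in> hom (free_Abelian_group S) H" "h' \<in> hom (free_Abelian_group S) H"
    and eq: "\<And>s. s \<in> S \<Longrightarrow> h (frag_of s) = h' (frag_of s)" and f: "Poly_Mapping.keys f \<subseteq> S"
  shows "h f = h' f"
proof -
  interpret h: group_hom "free_Abelian_group S" H h
    by (rule group_hom.intro) (use H h in \<open>auto intro: group_hom_axioms.intro\<close>)
  interpret h': group_hom "free_Abelian_group S" H h'
    by (rule group_hom.intro) (use H h in \<open>auto intro: group_hom_axioms.intro\<close>)
  show ?thesis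
  proof (rule free_Abelian_group_induct[OF f])
    show "h 0 = h' 0"
      using h.hom_one h'.hom_one by simp
    fix f g assume fg: "Poly_Mapping.keys f \<subseteq> S" "Poly_Mapping.keys g \<subseteq> S" "h f = h' f" "h g = h' g"
    then have "f - g = f \<otimes>\<^bsub>free_Abelian_group S\<^esub> inv\<^bsub>free_Abelian_group S\<^esub> g"
      by simp
    then show "h (f - g) = h' (f - g)"
      using fg h.hom_mult[of f "inv\<^bsub>free_Abelian_group S\<^esub> g"] h'.hom_mult[of f "inv\<^bsub>free_Abelian_group S\<^esub> g"]
        h.hom_inv[of g] h'.hom_inv[of g] by simp
  qed (rule eq)
qed

lemma tensor_eval_hom:
  assumes M: "abelian_group M" and \<phi>: "\<And>x y. (x, y) \<in> S \<Longrightarrow> \<phi> x y \<in> carrier M"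
  shows "tensor_eval M \<phi> \<in> hom (free_Abelian_group S) (add_monoid M)"
proof -
  interpret M: abelian_group M by (rule M)
  have closed: "add_pow M k (\<phi> (fst p) (snd p)) \<in> carrier M" if "p \<in> S" for p and k :: int
    using M.add.int_pow_closed[of "\<phi> (fst p) (snd p)" k] \<phi>[of "fst p" "snd p"] that by simp
  have enlarge: "tensor_eval M \<phi> f = (\<Oplus>\<^bsub>M\<^esub>p\<in>Z. add_pow M (Poly_Mapping.lookup f p) (\<phi> (fst p) (snd p)))"
    if "finite Z" "Poly_Mapping.keys f \<subseteq> Z" "Z \<subseteq> S" for f Z
    unfolding tensor_eval_def
  proof (rule M.add.finprod_mono_neutral_cong_left[OF that(1,2)])
    show "add_pow M (Poly_Mapping.lookup f p) (\<phi> (fst p) (snd p)) = \<zero>\<^bsub>M\<^esub>"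
      if "p \<in> Z - Poly_Mapping.keys f" for p
      using that by (simp add: in_keys_iff add_pow_def)
  qed (use closed that in auto)
  show ?thesis
  proof (rule homI)
    fix f assume "f \<in> carrier (free_Abelian_group S)"
    then show "tensor_eval M \<phi> f \<in> carrier (add_monoid M)"
      unfolding tensor_eval_def using closed by (auto intro!: M.finsum_closed)
  next
    fix f g assume fg: "f \<in> carrier (free_Abelian_group S)" "g \<in> carrier (free_Abelian_group S)"
    define Z where "Z = Poly_Mapping.keys f \<union> Poly_Mapping.keys g"
    have Z: "finite Z" "Poly_Mapping.keys f \<subseteq> Z" "Poly_Mapping.keys g \<subseteq> Z" "Z \<subseteq> S"
      "Poly_Mapping.keys (f + g) \<subseteq> Z"
      using fg keys_add[of f g] unfolding Z_def by auto
    have "tensor_eval M \<phi> (f + g) =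
        (\<Oplus>\<^bsub>M\<^esub>p\<in>Z. add_pow M (Poly_Mapping.lookup f p) (\<phi> (fst p) (snd p)) \<oplus>\<^bsub>M\<^esub>
          add_pow M (Poly_Mapping.lookup g p) (\<phi> (fst p) (snd p)))"
      unfolding enlarge[OF Z(1,5,4)]
    proof (rule M.finsum_cong')
      show "add_pow M (Poly_Mapping.lookup (f + g) p) (\<phi> (fst p) (snd p)) =
          add_pow M (Poly_Mapping.lookup f p) (\<phi> (fst p) (snd p)) \<oplus>\<^bsub>M\<^esub>
          add_pow M (Poly_Mapping.lookup g p) (\<phi> (fst p) (snd p))" if "p \<in> Z" for p
        using M.add.int_pow_mult[of "\<phi> (fst p) (snd p)"] \<phi>[of "fst p" "snd p"] that Z(4)
        by (auto simp: lookup_add)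
    qed (use closed Z(4) in auto)
    also have "\<dots> = tensor_eval M \<phi> f \<oplus>\<^bsub>M\<^esub> tensor_eval M \<phi> g"
      unfolding enlarge[OF Z(1,2,4)] enlarge[OF Z(1,3,4)]
      by (rule M.finsum_addf) (use closed Z(4) in auto)
    finally show "tensor_eval M \<phi> (f \<otimes>\<^bsub>free_Abelian_group S\<^esub> g) =
        tensor_eval M \<phi> f \<otimes>\<^bsub>add_monoid M\<^esub> tensor_eval M \<phi> g"
      by simp
  qed
qed

lemma tensor_eval_frag_of:
  assumes M: "abelian_group M" and "\<phi> x y \<in> carrier M"
  shows "tensor_eval M \<phi> (frag_of (x, y)) = \<phi> x y"
proof -
  interpret M: abelian_group M by (rule M)
  show ?thesis
    using assms(2) M.add.int_pow_1 unfolding tensor_eval_def by (simp add: M.finsum_singleton)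
qed

definition balanced :: "'k ring \<Rightarrow> ('k, 'a) module \<Rightarrow> ('k, 'b) module \<Rightarrow> ('k, 'm) module \<Rightarrow>
    ('a \<Rightarrow> 'b \<Rightarrow> 'm) \<Rightarrow> bool" where
  "balanced K A B M \<phi> \<longleftrightarrow>
     (\<forall>x\<in>carrier A. \<forall>y\<in>carrier B. \<phi> x y \<in> carrier M) \<and>
     (\<forall>x\<in>carrier A. \<forall>x'\<in>carrier A. \<forall>y\<in>carrier B. \<phi> (x \<oplus>\<^bsub>A\<^esub> x') y = \<phi> x y \<oplus>\<^bsub>M\<^esub> \<phi> x' y) \<and>
     (\<forall>x\<in>carrier A. \<forall>y\<in>carrier B. \<forall>y'\<in>carrier B. \<phi> x (y \<oplus>\<^bsub>B\<^esub> y') = \<phi> x y \<oplus>\<^bsub>M\<^esub> \<phi> x y') \<and>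
     (\<forall>c\<in>carrier K. \<forall>x\<in>carrier A. \<forall>y\<in>carrier B. \<phi> (c \<odot>\<^bsub>A\<^esub> x) y = \<phi> x (c \<odot>\<^bsub>B\<^esub> y))"

locale tensor_factors =
  fixes K :: "'k ring" and A :: "('k, 'a) module" and B :: "('k, 'b) module"
  assumes A: "algebra K A" and B: "algebra K B"
begin

abbreviation "T \<equiv> tensor K A B"
abbreviation "F \<equiv> tensor_free A B"
abbreviation "Null \<equiv> tensor_null K A B"

interpretation A: algebra K A by (rule A)
interpretation B: algebra K B by (rule B)

lemma carrier_F: "f \<in> carrier F \<longleftrightarrow> Poly_Mapping.keys f \<subseteq> carrier A \<times> carrier B"
  by (simp add: tensor_free_def)

lemma frag_of_F: "x \<in> carrier A \<Longrightarrow> y \<in> carrier B \<Longrightarrow> frag_of (x, y) \<in> carrier F"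
  by (simp add: carrier_F)

lemma group_F: "comm_group F" "group F"
  using abelian_free_Abelian_group group_free_Abelian_group by (auto simp: tensor_free_def)

lemma mult_F: "f \<otimes>\<^bsub>F\<^esub> g = f + g"
  and inv_F: "f \<in> carrier F \<Longrightarrow> inv\<^bsub>F\<^esub> f = - f"
  by (simp_all add: tensor_free_def)

lemma diff_F: "f \<in> carrier F \<Longrightarrow> g \<in> carrier F \<Longrightarrow> f - g \<in> carrier F"
  using keys_diff[of f g] by (auto simp: carrier_F)

lemma add_F: "f \<in> carrier F \<Longrightarrow> g \<in> carrier F \<Longrightarrow> f + g \<in> carrier F"
  using keys_add[of f g] by (auto simp: carrier_F)

lemma tensor_rel_F: "tensor_rel K A B \<subseteq> carrier F"
  unfolding tensor_rel_def by (auto intro!: diff_F frag_of_F)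

lemma Null_subgroup: "subgroup Null F"
  unfolding tensor_null_def by (rule group.generate_is_subgroup[OF group_F(2) tensor_rel_F])

lemma Null_normal: "Null \<lhd> F"
  by (rule comm_group.subgroup_imp_normal[OF group_F(1) Null_subgroup])

lemma abelian_group_T: "abelian_group T"
proof -
  have "comm_group (add_monoid T)"
  proof -
    interpret Q: comm_group "F Mod Null"
      by (rule comm_group.abelian_FactGroup[OF group_F(1) Null_subgroup])
    have "x \<otimes>\<^bsub>add_monoid T\<^esub> y = x \<otimes>\<^bsub>F Mod Null\<^esub> y" "\<one>\<^bsub>add_monoid T\<^esub> = \<one>\<^bsub>F Mod Null\<^esub>"
        "carrier (add_monoid T) = carrier (F Mod Null)" for x y
      by (simp_all add: tensor_def FactGroup_def)
    then show ?thesis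
      using Q.m_assoc Q.m_comm Q.l_inv_ex Q.m_closed Q.one_closed Q.l_one
      by (intro comm_groupI) metis+
  qed
  then show ?thesis
    by (simp add: abelian_group_def abelian_monoid_def abelian_group_axioms_def comm_group.axioms(1))
qed

lemma class_carrier: "f \<in> carrier F \<Longrightarrow> tensor_class K A B f \<in> carrier T"
  unfolding tensor_class_def tensor_def by (auto simp: RCOSETS_def)

lemma class_hom: "tensor_class K A B \<in> hom F (add_monoid T)"
proof (rule homI)
  fix f g assume "f \<in> carrier F" "g \<in> carrier F"
  then show "tensor_class K A B (f \<otimes>\<^bsub>F\<^esub> g) = tensor_class K A B f \<otimes>\<^bsub>add_monoid T\<^esub> tensor_class K A B g"
    using normal.rcos_sum[OF Null_normal] unfolding tensor_class_def by (simp add: tensor_def)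
qed (simp add: class_carrier)

lemma class_self: "f \<in> carrier F \<Longrightarrow> f \<in> tensor_class K A B f"
  unfolding tensor_class_def by (rule group.rcos_self[OF group_F(2) _ Null_subgroup])

lemma class_of_member:
  assumes "u \<in> carrier T" "f \<in> u"
  shows "f \<in> carrier F" "u = tensor_class K A B f"
proof -
  obtain g where g: "g \<in> carrier F" "u = Null #>\<^bsub>F\<^esub> g"
    using assms(1) by (auto simp: tensor_def RCOSETS_def)
  show "f \<in> carrier F"
    using assms(2) g subgroup.subset[OF Null_subgroup] add_F unfolding r_coset_def by (auto simp: mult_F)
  show "u = tensor_class K A B f"
    unfolding tensor_class_def
    using group.repr_independence[OF group_F(2) _ g(1) Null_subgroup] assms(2) g(2) by simp
qed

lemma class_cases:
  assumes "u \<in> carrier T"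
  obtains f where "f \<in> carrier F" "f \<in> u" "u = tensor_class K A B f"
proof -
  obtain g where "g \<in> carrier F" "u = tensor_class K A B g"
    using assms by (auto simp: tensor_def RCOSETS_def tensor_class_def)
  then show thesis
    using that class_self by auto
qed

lemma eval_hom:
  assumes "abelian_group M" "balanced K A B M \<phi>"
  shows "tensor_eval M \<phi> \<in> hom F (add_monoid M)"
  unfolding tensor_free_def by (rule tensor_eval_hom) (use assms in \<open>auto simp: balanced_def\<close>)

lemma eval_frag_of:
  assumes "abelian_group M" "balanced K A B M \<phi>" "x \<in> carrier A" "y \<in> carrier B"
  shows "tensor_eval M \<phi> (frag_of (x, y)) = \<phi> x y"
  by (rule tensor_eval_frag_of) (use assms in \<open>auto simp: balanced_def\<close>)

text \<open>
  The evaluation is additive, so its kernel is a subgroup; balancedness puts the defining relations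
  into it.
\<close>

lemma eval_Null:
  assumes M: "abelian_group M" and \<phi>: "balanced K A B M \<phi>" and f: "f \<in> Null"
  shows "tensor_eval M \<phi> f = \<zero>\<^bsub>M\<^esub>"
proof -
  interpret M: abelian_group M by (rule M)
  interpret h: group_hom F "add_monoid M" "tensor_eval M \<phi>"
    by (intro group_hom.intro group_hom_axioms.intro group_F M.a_group eval_hom[OF M \<phi>])
  have diff: "tensor_eval M \<phi> (f - g) = tensor_eval M \<phi> f \<ominus>\<^bsub>M\<^esub> tensor_eval M \<phi> g"
    if "f \<in> carrier F" "g \<in> carrier F" for f g
  proof -
    have "inv\<^bsub>F\<^esub> g \<in> carrier F"
      using that(2) by simp
    then have "tensor_eval M \<phi> (f \<otimes>\<^bsub>F\<^esub> inv\<^bsub>F\<^esub> g) = tensor_eval M \<phi> f \<oplus>\<^bsub>M\<^esub> tensor_eval M \<phi> (inv\<^bsub>F\<^esub> g)"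
      using h.hom_mult[OF that(1)] by simp
    moreover have "tensor_eval M \<phi> (inv\<^bsub>F\<^esub> g) = \<ominus>\<^bsub>M\<^esub> tensor_eval M \<phi> g"
      using h.hom_inv[OF that(2)] by (simp add: a_inv_def)
    ultimately show ?thesis
      using that by (simp add: mult_F inv_F a_minus_def)
  qed
  have self: "a \<ominus>\<^bsub>M\<^esub> a = \<zero>\<^bsub>M\<^esub>" if "a \<in> carrier M" for a
    using that by (simp add: a_minus_def M.r_neg)
  have cancel: "(a \<oplus>\<^bsub>M\<^esub> b) \<ominus>\<^bsub>M\<^esub> a \<ominus>\<^bsub>M\<^esub> b = \<zero>\<^bsub>M\<^esub>"
    if "a \<in> carrier M" "b \<in> carrier M" for a b
  proof -
    have "(a \<oplus>\<^bsub>M\<^esub> b) \<ominus>\<^bsub>M\<^esub> a = b"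
      using that by (simp add: a_minus_def M.a_comm[of a b] M.a_assoc M.r_neg)
    then show "(a \<oplus>\<^bsub>M\<^esub> b) \<ominus>\<^bsub>M\<^esub> a \<ominus>\<^bsub>M\<^esub> b = \<zero>\<^bsub>M\<^esub>"
      using that by (simp add: a_minus_def M.r_neg)
  qed
  have "tensor_rel K A B \<subseteq> kernel F (add_monoid M) (tensor_eval M \<phi>)"
  proof
    fix r assume r: "r \<in> tensor_rel K A B"
    have "tensor_eval M \<phi> r = \<zero>\<^bsub>M\<^esub>"
      using r \<phi> unfolding tensor_rel_def balanced_def
      by (auto simp: diff diff_F frag_of_F eval_frag_of[OF M \<phi>] self cancel)
    then show "r \<in> kernel F (add_monoid M) (tensor_eval M \<phi>)"
      using r tensor_rel_F by (auto simp: kernel_def)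
  qed
  then have "Null \<subseteq> kernel F (add_monoid M) (tensor_eval M \<phi>)"
    unfolding tensor_null_def
    by (rule group.generate_subgroup_incl[OF group_F(2) _ h.subgroup_kernel])
  then show ?thesis
    using f by (auto simp: kernel_def)
qed

text \<open>
  Together with \<open>class_of_member\<close>, this allows every computation with \<open>tensor_lift\<close> to be carried out
  on an arbitrary representative of a coset.
\<close>

lemma lift_member:
  assumes M: "abelian_group M" and \<phi>: "balanced K A B M \<phi>" and u: "u \<in> carrier T" and f: "f \<in> u"
  shows "tensor_lift M \<phi> u = tensor_eval M \<phi> f"
proof -
  interpret M: abelian_group M by (rule M)
  have fF: "f \<in> carrier F" and u': "u = tensor_class K A B f"
    using class_of_member u f by auto
  have "tensor_eval M \<phi> g = tensor_eval M \<phi> f" if "g \<in> u" for g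
  proof -
    obtain n where n: "n \<in> Null" "g = n \<otimes>\<^bsub>F\<^esub> f"
      using \<open>g \<in> u\<close> unfolding u' tensor_class_def r_coset_def by auto
    have "n \<in> carrier F"
      using n(1) Null_subgroup subgroup.subset by blast
    then have "tensor_eval M \<phi> g = tensor_eval M \<phi> n \<oplus>\<^bsub>M\<^esub> tensor_eval M \<phi> f"
      using hom_mult[OF eval_hom[OF M \<phi>] _ fF] n(2) by simp
    moreover have "tensor_eval M \<phi> f \<in> carrier M"
      using hom_in_carrier[OF eval_hom[OF M \<phi>] fF] by simp
    ultimately show ?thesis
      using eval_Null[OF M \<phi> n(1)] by simp
  qed
  then have "tensor_eval M \<phi> ` u = {tensor_eval M \<phi> f}"
    using f by blast
  then show ?thesis
    unfolding tensor_lift_def tensor_eval_def[abs_def] by simp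
qed

lemma lift_class:
  assumes "abelian_group M" "balanced K A B M \<phi>" "f \<in> carrier F"
  shows "tensor_lift M \<phi> (tensor_class K A B f) = tensor_eval M \<phi> f"
  by (rule lift_member) (use assms class_carrier class_self in auto)

lemma lift_hom:
  assumes M: "abelian_group M" and \<phi>: "balanced K A B M \<phi>"
  shows "tensor_lift M \<phi> \<in> hom (add_monoid T) (add_monoid M)"
proof (rule homI)
  fix u assume "u \<in> carrier (add_monoid T)"
  then obtain f where "f \<in> carrier F" "u = tensor_class K A B f"
    using class_cases by auto
  then show "tensor_lift M \<phi> u \<in> carrier (add_monoid M)"
    using lift_class[OF M \<phi>] hom_in_carrier[OF eval_hom[OF M \<phi>]] by simp
next
  fix u v assume "u \<in> carrier (add_monoid T)" "v \<in> carrier (add_monoid T)"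
  then obtain f g where fg: "f \<in> carrier F" "u = tensor_class K A B f"
      "g \<in> carrier F" "v = tensor_class K A B g"
    using class_cases by (metis monoid.simps(1) partial_object.select_convs(1))
  have "u \<otimes>\<^bsub>add_monoid T\<^esub> v = tensor_class K A B (f \<otimes>\<^bsub>F\<^esub> g)"
    unfolding fg using hom_mult[OF class_hom fg(1,3)] by simp
  then have "tensor_lift M \<phi> (u \<otimes>\<^bsub>add_monoid T\<^esub> v) = tensor_eval M \<phi> (f \<otimes>\<^bsub>F\<^esub> g)"
    using lift_class[OF M \<phi>] fg add_F by (simp add: mult_F)
  also have "\<dots> = tensor_eval M \<phi> f \<otimes>\<^bsub>add_monoid M\<^esub> tensor_eval M \<phi> g"
    by (rule hom_mult[OF eval_hom[OF M \<phi>] fg(1,3)])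
  finally show "tensor_lift M \<phi> (u \<otimes>\<^bsub>add_monoid T\<^esub> v) =
      tensor_lift M \<phi> u \<otimes>\<^bsub>add_monoid M\<^esub> tensor_lift M \<phi> v"
    using lift_class[OF M \<phi>] fg by simp
qed

lemma lift_pure:
  assumes "abelian_group M" "balanced K A B M \<phi>" "x \<in> carrier A" "y \<in> carrier B"
  shows "tensor_lift M \<phi> (pure_tensor K A B x y) = \<phi> x y"
  unfolding pure_tensor_def using assms lift_class eval_frag_of frag_of_F by metis

lemma pure_carrier: "x \<in> carrier A \<Longrightarrow> y \<in> carrier B \<Longrightarrow> pure_tensor K A B x y \<in> carrier T"
  unfolding pure_tensor_def by (intro class_carrier frag_of_F)

lemma pure_eqI:
  assumes "f - g \<in> Null" "f \<in> carrier F" "g \<in> carrier F"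
  shows "tensor_class K A B f = tensor_class K A B g"
proof -
  have "f = (f - g) \<otimes>\<^bsub>F\<^esub> g"
    unfolding mult_F by simp
  then have "f \<in> Null #>\<^bsub>F\<^esub> g"
    using assms(1) unfolding r_coset_def by blast
  then show ?thesis
    unfolding tensor_class_def using group.repr_independence[OF group_F(2) _ assms(3) Null_subgroup] by simp
qed

lemma rel_Null: "r \<in> tensor_rel K A B \<Longrightarrow> r \<in> Null"
  unfolding tensor_null_def by (rule generate.incl)

lemma balanced_pure: "balanced K A B T (pure_tensor K A B)"
  unfolding balanced_def
proof (intro conjI ballI)
  fix x x' y assume c: "x \<in> carrier A" "x' \<in> carrier A" "y \<in> carrier B"
  have "tensor_class K A B (frag_of (x \<oplus>\<^bsub>A\<^esub> x', y)) =
      tensor_class K A B (frag_of (x, y) + frag_of (x', y))"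
  proof (rule pure_eqI)
    show "frag_of (x \<oplus>\<^bsub>A\<^esub> x', y) - (frag_of (x, y) + frag_of (x', y)) \<in> Null"
      by (rule rel_Null) (use c in \<open>auto simp: tensor_rel_def diff_diff_eq\<close>)
  qed (use c add_F frag_of_F in auto)
  then show "pure_tensor K A B (x \<oplus>\<^bsub>A\<^esub> x') y = pure_tensor K A B x y \<oplus>\<^bsub>T\<^esub> pure_tensor K A B x' y"
    unfolding pure_tensor_def
    using hom_mult[OF class_hom frag_of_F[OF c(1,3)] frag_of_F[OF c(2,3)]] by (simp add: mult_F)
next
  fix x y y' assume c: "x \<in> carrier A" "y \<in> carrier B" "y' \<in> carrier B"
  have "tensor_class K A B (frag_of (x, y \<oplus>\<^bsub>B\<^esub> y')) =
      tensor_class K A B (frag_of (x, y) + frag_of (x, y'))"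
  proof (rule pure_eqI)
    show "frag_of (x, y \<oplus>\<^bsub>B\<^esub> y') - (frag_of (x, y) + frag_of (x, y')) \<in> Null"
      by (rule rel_Null) (use c in \<open>auto simp: tensor_rel_def diff_diff_eq\<close>)
  qed (use c add_F frag_of_F in auto)
  then show "pure_tensor K A B x (y \<oplus>\<^bsub>B\<^esub> y') = pure_tensor K A B x y \<oplus>\<^bsub>T\<^esub> pure_tensor K A B x y'"
    unfolding pure_tensor_def
    using hom_mult[OF class_hom frag_of_F[OF c(1,2)] frag_of_F[OF c(1,3)]] by (simp add: mult_F)
next
  fix c x y assume c: "c \<in> carrier K" "x \<in> carrier A" "y \<in> carrier B"
  show "pure_tensor K A B (c \<odot>\<^bsub>A\<^esub> x) y = pure_tensor K A B x (c \<odot>\<^bsub>B\<^esub> y)"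
    unfolding pure_tensor_def
  proof (rule pure_eqI)
    show "frag_of (c \<odot>\<^bsub>A\<^esub> x, y) - frag_of (x, c \<odot>\<^bsub>B\<^esub> y) \<in> Null"
      by (rule rel_Null) (use c in \<open>auto simp: tensor_rel_def\<close>)
  qed (use c frag_of_F in auto)
qed (rule pure_carrier)

lemma balanced_comp:
  assumes "balanced K A B M \<phi>" "h \<in> hom (add_monoid M) (add_monoid M')"
  shows "balanced K A B M' (\<lambda>x y. h (\<phi> x y))"
  using assms hom_mult[OF assms(2)] hom_in_carrier[OF assms(2)] unfolding balanced_def by simp

text \<open>
  Both sides are additive and agree on pure tensors.  Applied repeatedly, this collapses a composite
  of maps between tensor products into a single \<open>tensor_lift\<close>.
\<close>

lemma hom_lift:
  fixes M :: "('k, 'm) module" and M' :: "('k, 'm') module"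
  assumes M: "abelian_group M" "abelian_group M'" and \<phi>: "balanced K A B M \<phi>"
    and h: "h \<in> hom (add_monoid M) (add_monoid M')" and u: "u \<in> carrier T"
  shows "h (tensor_lift M \<phi> u) = tensor_lift M' (\<lambda>x y. h (\<phi> x y)) u"
proof -
  interpret M': abelian_group M' by (rule M(2))
  obtain f where f: "f \<in> carrier F" "u = tensor_class K A B f"
    using u by (rule class_cases)
  have "h (tensor_eval M \<phi> f) = tensor_eval M' (\<lambda>x y. h (\<phi> x y)) f"
  proof (rule hom_free_eqI[OF M'.a_group, of "\<lambda>f. h (tensor_eval M \<phi> f)" "carrier A \<times> carrier B"
        "tensor_eval M' (\<lambda>x y. h (\<phi> x y))"])
    show "(\<lambda>f. h (tensor_eval M \<phi> f)) \<in> hom (free_Abelian_group (carrier A \<times> carrier B)) (add_monoid M')"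
      using hom_compose[OF eval_hom[OF M(1) \<phi>] h] by (simp add: tensor_free_def comp_def)
    show "tensor_eval M' (\<lambda>x y. h (\<phi> x y)) \<in> hom (free_Abelian_group (carrier A \<times> carrier B)) (add_monoid M')"
      using eval_hom[OF M(2) balanced_comp[OF \<phi> h]] by (simp add: tensor_free_def)
    show "h (tensor_eval M \<phi> (frag_of s)) = tensor_eval M' (\<lambda>x y. h (\<phi> x y)) (frag_of s)"
      if "s \<in> carrier A \<times> carrier B" for s
      using that eval_frag_of[OF M(1) \<phi>] eval_frag_of[OF M(2) balanced_comp[OF \<phi> h]] by auto
    show "Poly_Mapping.keys f \<subseteq> carrier A \<times> carrier B"
      using f(1) by (simp add: carrier_F)
  qed
  then show ?thesis
    using lift_class[OF M(1) \<phi> f(1)] lift_class[OF M(2) balanced_comp[OF \<phi> h] f(1)] f(2) by simp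
qed

end

lemma balanced_tensor_map:
  assumes "tensor_factors K A B" "tensor_factors K A' B'" "f \<in> alg_hom K A A'"
    and g: "\<And>y. y \<in> carrier B \<Longrightarrow> g y \<in> carrier B'"
      "\<And>y y'. y \<in> carrier B \<Longrightarrow> y' \<in> carrier B \<Longrightarrow> g (y \<oplus>\<^bsub>B\<^esub> y') = g y \<oplus>\<^bsub>B'\<^esub> g y'"
      "\<And>c y. c \<in> carrier K \<Longrightarrow> y \<in> carrier B \<Longrightarrow> g (c \<odot>\<^bsub>B\<^esub> y) = c \<odot>\<^bsub>B'\<^esub> g y"
  shows "balanced K A B (tensor K A' B') (\<lambda>x y. pure_tensor K A' B' (f x) (g y))"
proof -
  interpret C: tensor_factors K A' B' by (rule assms)
  have f: "f x \<in> carrier A'" "f (x \<oplus>\<^bsub>A\<^esub> x') = f x \<oplus>\<^bsub>A'\<^esub> f x'"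
    if "x \<in> carrier A" "x' \<in> carrier A" for x x'
    using that assms(3) by (auto simp: alg_hom_def ring_hom_def)
  have f_smult: "f (c \<odot>\<^bsub>A\<^esub> x) = c \<odot>\<^bsub>A'\<^esub> f x" if "c \<in> carrier K" "x \<in> carrier A" for x c
    using that assms(3) by (auto simp: alg_hom_def)
  show ?thesis
    using C.balanced_pure unfolding balanced_def by (simp add: f f_smult g)
qed

section \<open>Coordinate-free operators\<close>

lemma type_algebra_simps [simp]:
  "carrier (type_algebra s) = UNIV" "x \<otimes>\<^bsub>type_algebra s\<^esub> y = x * y" "\<one>\<^bsub>type_algebra s\<^esub> = 1"
  "\<zero>\<^bsub>type_algebra s\<^esub> = 0" "x \<oplus>\<^bsub>type_algebra s\<^esub> y = x + y" "c \<odot>\<^bsub>type_algebra s\<^esub> x = s c x"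
  by (simp_all add: type_algebra_def)

lemma ring_of_type_algebra_simps [simp]:
  "carrier (ring_of_type_algebra :: 'k::field ring) = UNIV"
  "x \<otimes>\<^bsub>(ring_of_type_algebra :: 'k ring)\<^esub> y = x * y" "\<one>\<^bsub>(ring_of_type_algebra :: 'k ring)\<^esub> = 1"
  "\<zero>\<^bsub>(ring_of_type_algebra :: 'k ring)\<^esub> = 0" "x \<oplus>\<^bsub>(ring_of_type_algebra :: 'k ring)\<^esub> y = x + y"
  by (simp_all add: ring_of_type_algebra_def)

locale scalar_algebra =
  fixes s :: "'k::field \<Rightarrow> 'a::comm_ring_1 \<Rightarrow> 'a"
  assumes scale_add_right: "s c (x + y) = s c x + s c y"
    and scale_add_left: "s (c + d) x = s c x + s d x"
    and scale_scale: "s c (s d x) = s (c * d) x"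
    and scale_1: "s 1 x = x"
    and scale_mult_left: "s c x * y = s c (x * y)"
begin

lemma scale_mult_right: "x * s c y = s c (x * y)"
  using scale_mult_left[of c y x] by (simp add: mult.commute)

lemma scale_times_scale: "s c x * s d y = s (c * d) (x * y)"
  by (simp add: scale_mult_left scale_mult_right scale_scale mult.commute[of d c])

lemma scale_eq_mult: "s c x = s c 1 * x"
  by (simp add: scale_mult_left)

lemma scale_0_left [simp]: "s 0 x = 0"
  using scale_add_left[of 0 0 x] by simp

lemma scale_0_right [simp]: "s c 0 = 0"
  using scale_add_right[of c 0 0] by simp

lemma scale_sum_right: "s c (sum f J) = (\<Sum>i\<in>J. s c (f i))"
  by (induction J rule: infinite_finite_induct) (auto simp: scale_add_right)

lemma scale_sum_left: "s (sum f J) x = (\<Sum>i\<in>J. s (f i) x)"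
  by (induction J rule: infinite_finite_induct) (auto simp: scale_add_left)

lemma scale_diff_right: "s c (x - y) = s c x - s c y"
  using scale_add_right[of c "x - y" y] by simp

lemma vector_space_scale: "vector_space s"
  by unfold_locales (auto simp: scale_add_right scale_add_left scale_scale scale_1)

end

lemma scalar_algebra_iff:
  fixes s :: "'k::field \<Rightarrow> 'b::comm_ring_1 \<Rightarrow> 'b"
  shows "algebra (ring_of_type_algebra :: 'k::field ring) (type_algebra s) \<longleftrightarrow> scalar_algebra s"
proof
  assume "algebra (ring_of_type_algebra :: 'k ring) (type_algebra s)"
  then interpret algebra "ring_of_type_algebra :: 'k ring" "type_algebra s" .
  show "scalar_algebra s"
    by unfold_locales
      (use smult_r_distr smult_l_distr smult_assoc1 smult_one smult_assoc2 in \<open>auto\<close>)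
next
  assume "scalar_algebra s"
  then interpret scalar_algebra s .
  show "algebra (ring_of_type_algebra :: 'k ring) (type_algebra s)"
  proof (rule algebraI)
    have "\<exists>y. y + x = 0" for x :: 'b
      using add.left_inverse by blast
    then show "cring (type_algebra s)"
      by (intro cringI abelian_groupI comm_monoidI) (auto simp: algebra_simps)
  qed (auto simp: scale_add_right scale_add_left scale_scale scale_1 scale_mult_left
      intro: cring_from_type_algebra)
qed

lemma abelian_group_type_algebra:
  fixes s :: "'k \<Rightarrow> 'b::comm_ring_1 \<Rightarrow> 'b"
  shows "abelian_group (type_algebra s)"
proof -
  have "\<exists>y. y + x = 0" for x :: 'b
    using add.left_inverse by blast
  then show ?thesis
    by (intro abelian_groupI) (auto simp: algebra_simps)
qed

lemma finsum_type_algebra: "finite J \<Longrightarrow> finsum (type_algebra s) f J = sum f J"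
proof (induction J rule: finite_induct)
  interpret abelian_group "type_algebra s" by (rule abelian_group_type_algebra)
  case empty
  then show ?case by simp
next
  interpret abelian_group "type_algebra s" by (rule abelian_group_type_algebra)
  case (insert i J)
  then show ?case by (simp add: finsum_insert)
qed

lemma hom_finsum_type_algebra:
  assumes M: "abelian_group M" and h: "h \<in> hom (add_monoid M) (add_monoid (type_algebra s))"
    and J: "finite J" "g \<in> J \<rightarrow> carrier M"
  shows "h (finsum M g J) = (\<Sum>i\<in>J. h (g i))"
proof -
  interpret M: abelian_group M by (rule M)
  interpret T: abelian_group "type_algebra s" by (rule abelian_group_type_algebra)
  show ?thesis
    using J
  proof (induction J rule: finite_induct)
    case empty
    have "h \<one>\<^bsub>add_monoid M\<^esub> = \<one>\<^bsub>add_monoid (type_algebra s)\<^esub>"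
      by (rule hom_one[OF h M.a_group T.a_group])
    then show ?case by simp
  next
    case (insert i J)
    then have "finsum M g (insert i J) = g i \<oplus>\<^bsub>M\<^esub> finsum M g J"
      by (intro M.finsum_insert) auto
    moreover have "h (g i \<oplus>\<^bsub>M\<^esub> finsum M g J) = h (g i) + h (finsum M g J)"
      using hom_mult[OF h, of "g i" "finsum M g J"] insert.prems by (simp add: M.finsum_closed)
    ultimately show ?case
      using insert by simp
  qed
qed

text \<open>
  A basis together with its coordinate functionals; this form is invariant under reindexing and
  avoids the unique choice in \<open>is_basis\<close>.
\<close>

definition dual_basis :: "('k::field \<Rightarrow> 'd::ab_group_add \<Rightarrow> 'd) \<Rightarrow> 'i set \<Rightarrow> ('i \<Rightarrow> 'd) \<Rightarrow> ('i \<Rightarrow> 'd \<Rightarrow> 'k) \<Rightarrow> bool" where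
  "dual_basis s J \<epsilon> coord \<longleftrightarrow> finite J \<and> (\<forall>i\<in>J. linear_functional s (coord i)) \<and>
     (\<forall>x. x = (\<Sum>i\<in>J. s (coord i x) (\<epsilon> i))) \<and> (\<forall>i\<in>J. \<forall>j\<in>J. coord i (\<epsilon> j) = (if i = j then 1 else 0))"

lemma is_basis_iff:
  "is_basis (ring_of_type_algebra :: 'k::field ring) (type_algebra s) J \<epsilon> \<longleftrightarrow>
     finite J \<and> (\<forall>x. \<exists>!c. c \<in> J \<rightarrow>\<^sub>E UNIV \<and> x = (\<Sum>i\<in>J. s (c i) (\<epsilon> i)))"
  unfolding is_basis_def by (simp add: finsum_type_algebra cong: conj_cong)

context scalar_algebra
begin

lemma is_basis_imp_dual:
  assumes "is_basis (ring_of_type_algebra :: 'k ring) (type_algebra s) J \<epsilon>"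
  obtains coord where "dual_basis s J \<epsilon> coord"
proof -
  define C where "C x c \<longleftrightarrow> c \<in> J \<rightarrow>\<^sub>E UNIV \<and> x = (\<Sum>i\<in>J. s (c i) (\<epsilon> i))" for x c
  have J: "finite J" and ex1: "\<exists>!c. C x c" for x
    using assms unfolding is_basis_iff C_def by auto
  define co where "co x = (THE c. C x c)" for x
  have co: "C x (co x)" for x
    unfolding co_def by (rule theI'[OF ex1])
  have unique: "co x i = c i" if "x = (\<Sum>i\<in>J. s (c i) (\<epsilon> i))" "i \<in> J" for x c i
  proof -
    have "C x (restrict c J)"
      unfolding C_def using that(1) by auto
    then have "co x = restrict c J"
      using ex1 co by blast
    then show ?thesis using that(2) by simp
  qed
  have sum_co: "x = (\<Sum>i\<in>J. s (co x i) (\<epsilon> i))" for x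
    using co[of x] unfolding C_def by blast
  have "dual_basis s J \<epsilon> (\<lambda>i x. co x i)"
    unfolding dual_basis_def linear_functional_def
  proof (intro conjI ballI allI)
    fix i x y assume i: "i \<in> J"
    show "co (x + y) i = co x i + co y i"
      by (rule unique[OF _ i, of "x + y" "\<lambda>i. co x i + co y i"])
        (simp add: scale_add_left sum.distrib flip: sum_co)
    show "co (s c x) i = c * co x i" for c
      by (rule unique[OF _ i, of "s c x" "\<lambda>i. c * co x i"])
        (simp add: scale_sum_right flip: scale_scale scale_sum_right sum_co)
  next
    fix i j assume i: "i \<in> J" and j: "j \<in> J"
    have "\<epsilon> j = (\<Sum>i\<in>J. if i = j then s 1 (\<epsilon> i) else 0)"
      using J j by (simp add: scale_1)
    also have "\<dots> = (\<Sum>i\<in>J. s (if i = j then 1 else 0) (\<epsilon> i))"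
      by (rule sum.cong) auto
    finally show "co (\<epsilon> j) i = (if i = j then 1 else 0)"
      by (rule unique[OF _ i])
  qed (use J sum_co in auto)
  then show thesis by (rule that)
qed

lemma dual_imp_is_basis:
  assumes d: "dual_basis s J \<epsilon> coord"
  shows "is_basis (ring_of_type_algebra :: 'k ring) (type_algebra s) J \<epsilon>"
  unfolding is_basis_iff
proof (intro conjI allI)
  show J: "finite J"
    using d unfolding dual_basis_def by blast
  fix x
  show "\<exists>!c. c \<in> J \<rightarrow>\<^sub>E UNIV \<and> x = (\<Sum>i\<in>J. s (c i) (\<epsilon> i))"
  proof (rule ex1I[of _ "\<lambda>i\<in>J. coord i x"])
    have "x = (\<Sum>i\<in>J. s (coord i x) (\<epsilon> i))"
      using d unfolding dual_basis_def by blast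
    also have "\<dots> = (\<Sum>i\<in>J. s ((\<lambda>i\<in>J. coord i x) i) (\<epsilon> i))"
      by (rule sum.cong) auto
    finally show "(\<lambda>i\<in>J. coord i x) \<in> J \<rightarrow>\<^sub>E UNIV \<and> x = (\<Sum>i\<in>J. s ((\<lambda>i\<in>J. coord i x) i) (\<epsilon> i))"
      by simp
    fix c assume c: "c \<in> J \<rightarrow>\<^sub>E UNIV \<and> x = (\<Sum>i\<in>J. s (c i) (\<epsilon> i))"
    have "coord i x = c i" if i: "i \<in> J" for i
    proof -
      have l: "linear_functional s (coord i)" and co: "\<And>j. j \<in> J \<Longrightarrow> coord i (\<epsilon> j) = (if i = j then 1 else 0)"
        using d i unfolding dual_basis_def by auto
      have "coord i x = (\<Sum>j\<in>J. c j * coord i (\<epsilon> j))"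
        using c by (simp add: linear_functionalD(2,5)[OF l])
      also have "\<dots> = (\<Sum>j\<in>J. if j = i then c j else 0)"
        by (rule sum.cong) (use co in auto)
      finally show ?thesis
        using J i by simp
    qed
    then show "c = (\<lambda>i\<in>J. coord i x)"
      using c by (intro ext) (auto simp: PiE_def extensional_def)
  qed
qed

end

locale type_D_ring = A: scalar_algebra sA + D: scalar_algebra sD
  for sA :: "'k::field \<Rightarrow> 'a::comm_ring_1 \<Rightarrow> 'a" and sD :: "'k \<Rightarrow> 'd::comm_ring_1 \<Rightarrow> 'd" +
  fixes e :: "'a \<Rightarrow> ('a \<times> 'd \<Rightarrow>\<^sub>0 int) set"
  assumes e: "e \<in> alg_hom (ring_of_type_algebra :: 'k ring) (type_algebra sA)
    (tensor (ring_of_type_algebra :: 'k ring) (type_algebra sA) (type_algebra sD))"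
begin

abbreviation K :: "'k ring" where "K \<equiv> ring_of_type_algebra"
abbreviation A :: "('k, 'a) module" where "A \<equiv> type_algebra sA"
abbreviation D :: "('k, 'd) module" where "D \<equiv> type_algebra sD"

sublocale tensor_factors K A D
  by (intro tensor_factors.intro)
    (simp_all add: scalar_algebra_iff A.scalar_algebra_axioms D.scalar_algebra_axioms)

lemmas group_A = abelian_group_type_algebra[of sA]

abbreviation functional :: "('d \<Rightarrow> 'k) \<Rightarrow> bool" where "functional \<equiv> linear_functional sD"

text \<open>
  The map \<open>id \<otimes> \<phi>\<close> on formal sums.
\<close>

definition ev :: "('d \<Rightarrow> 'k) \<Rightarrow> ('a \<times> 'd \<Rightarrow>\<^sub>0 int) \<Rightarrow> 'a" where
  "ev \<phi> = tensor_eval A (\<lambda>x d. sA (\<phi> d) x)"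

text \<open>
  The operator \<open>(id \<otimes> \<phi>) \<circ> e\<close>.  The coordinate maps are the special case of coordinate functionals.
\<close>

definition op :: "('d \<Rightarrow> 'k) \<Rightarrow> 'a \<Rightarrow> 'a" where
  "op \<phi> a = tensor_lift A (\<lambda>x d. sA (\<phi> d) x) (e a)"

lemma balanced_functional: "functional \<phi> \<Longrightarrow> balanced K A D A (\<lambda>x d. sA (\<phi> d) x)"
  unfolding balanced_def
  by (simp add: linear_functionalD A.scale_add_left A.scale_add_right A.scale_scale mult.commute)

lemma carrier_F_UNIV [simp]: "f \<in> carrier (tensor_free A D)"
  by (simp add: carrier_F)

lemma ev_frag_of: "functional \<phi> \<Longrightarrow> ev \<phi> (frag_of (x, d)) = sA (\<phi> d) x"
  unfolding ev_def using eval_frag_of[OF group_A balanced_functional] by simp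

lemma ev_add: "functional \<phi> \<Longrightarrow> ev \<phi> (f + g) = ev \<phi> f + ev \<phi> g"
  unfolding ev_def using hom_mult[OF eval_hom[OF group_A balanced_functional], of \<phi> f g]
  by (simp add: mult_F)

lemma ev_diff: "functional \<phi> \<Longrightarrow> ev \<phi> (f - g) = ev \<phi> f - ev \<phi> g"
  using ev_add[of \<phi> "f - g" g] by simp

lemma ev_0: "functional \<phi> \<Longrightarrow> ev \<phi> 0 = 0"
  using ev_add[of \<phi> 0 0] by simp

lemma e_carrier: "e a \<in> carrier T"
  using e by (auto simp: alg_hom_def ring_hom_def)

lemma op_ev: "functional \<phi> \<Longrightarrow> f \<in> e a \<Longrightarrow> op \<phi> a = ev \<phi> f"
  unfolding op_def ev_def by (rule lift_member[OF group_A balanced_functional e_carrier])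

lemma e_rep: "\<exists>f. f \<in> e a"
  using class_cases[OF e_carrier] by metis

lemma op_eqI:
  assumes "functional \<phi>" "e a = U" "\<And>f. f \<in> U \<Longrightarrow> ev \<phi> f = b"
  shows "op \<phi> a = b"
  using e_rep[of a] assms op_ev by metis

text \<open>
  Products and scalar multiples in the tensor product are unions of cosets over all representatives.
  As \<open>ev \<phi>\<close> is constant on cosets, \<open>op\<close> of such an element can be read off from any representative.
\<close>

lemma ev_class:
  assumes "functional \<phi>" "f \<in> tensor_class K A D g"
  shows "ev \<phi> f = ev \<phi> g"
proof -
  have c: "tensor_class K A D g \<in> carrier T"
    by (rule class_carrier) simp
  have "tensor_lift A (\<lambda>x d. sA (\<phi> d) x) (tensor_class K A D g) = ev \<phi> h"
    if "h \<in> tensor_class K A D g" for h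
    unfolding ev_def by (rule lift_member[OF group_A balanced_functional[OF assms(1)] c that])
  then show ?thesis
    using assms(2) class_self[of g] by (metis carrier_F_UNIV)
qed

lemma op_add:
  assumes "functional \<phi>"
  shows "op \<phi> (a + b) = op \<phi> a + op \<phi> b"
proof -
  have "e (a + b) = e a \<oplus>\<^bsub>T\<^esub> e b"
    using e by (auto simp: alg_hom_def ring_hom_def)
  then show ?thesis
    unfolding op_def
    using hom_mult[OF lift_hom[OF group_A balanced_functional[OF assms]], of "e a" "e b"] e_carrier
    by simp
qed

lemma op_scale:
  assumes \<phi>: "functional \<phi>"
  shows "op \<phi> (sA c a) = sA c (op \<phi> a)"
proof (rule op_eqI[OF \<phi>])
  show "e (sA c a) = (\<Union>f\<in>e a. tensor_class K A D (frag_extend (\<lambda>(x, y). frag_of (sA c x, y)) f))"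
    using e by (auto simp: alg_hom_def tensor_def)
  fix h assume "h \<in> (\<Union>f\<in>e a. tensor_class K A D (frag_extend (\<lambda>(x, y). frag_of (sA c x, y)) f))"
  then obtain f where f: "f \<in> e a" "h \<in> tensor_class K A D (frag_extend (\<lambda>(x, y). frag_of (sA c x, y)) f)"
    by blast
  have "ev \<phi> (frag_extend (\<lambda>(x, y). frag_of (sA c x, y)) f) = sA c (ev \<phi> f)"
  proof (rule free_Abelian_group_induct[of f UNIV])
    fix p :: "'a \<times> 'd"
    show "ev \<phi> (frag_extend (\<lambda>(x, y). frag_of (sA c x, y)) (frag_of p)) = sA c (ev \<phi> (frag_of p))"
      by (cases p) (simp add: ev_frag_of[OF \<phi>] A.scale_scale mult.commute)
  qed (simp_all add: ev_0[OF \<phi>] ev_diff[OF \<phi>] frag_extend_diff A.scale_diff_right)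
  then show "ev \<phi> h = sA c (op \<phi> a)"
    using ev_class[OF \<phi> f(2)] op_ev[OF \<phi> f(1)] by simp
qed

text \<open>
  The product rule for \<open>op \<phi>\<close> is dual to the expansion of \<open>\<phi> (x * y)\<close> in products of functionals.
\<close>

lemma op_mult:
  assumes \<phi>: "functional \<phi>" and \<alpha>: "\<And>j. j \<in> J \<Longrightarrow> functional (\<alpha> j)" and \<beta>: "\<And>j. j \<in> J \<Longrightarrow> functional (\<beta> j)"
    and prod: "\<And>x y. \<phi> (x * y) = (\<Sum>j\<in>J. \<alpha> j x * \<beta> j y)"
  shows "op \<phi> (a * b) = (\<Sum>j\<in>J. op (\<alpha> j) a * op (\<beta> j) b)"
proof (rule op_eqI[OF \<phi>])
  define pr where "pr f g = frag_extend (\<lambda>(x, y). frag_extend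
      (\<lambda>(x', y'). frag_of (x * x', y * y')) g) f" for f g :: "'a \<times> 'd \<Rightarrow>\<^sub>0 int"
  show "e (a * b) = (\<Union>f\<in>e a. \<Union>g\<in>e b. tensor_class K A D (pr f g))"
    using e by (auto simp: alg_hom_def ring_hom_def tensor_def pr_def)
  fix h assume "h \<in> (\<Union>f\<in>e a. \<Union>g\<in>e b. tensor_class K A D (pr f g))"
  then obtain f g where fg: "f \<in> e a" "g \<in> e b" "h \<in> tensor_class K A D (pr f g)"
    by blast
  have base: "ev \<phi> (pr (frag_of (x, y)) g) = (\<Sum>j\<in>J. sA (\<alpha> j y) x * ev (\<beta> j) g)" for x y
    unfolding pr_def frag_extend_of prod.case
  proof (rule free_Abelian_group_induct[of g UNIV])
    fix p :: "'a \<times> 'd"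
    show "ev \<phi> (frag_extend (\<lambda>(x', y'). frag_of (x * x', y * y')) (frag_of p)) =
        (\<Sum>j\<in>J. sA (\<alpha> j y) x * ev (\<beta> j) (frag_of p))"
      by (cases p) (simp add: ev_frag_of[OF \<phi>] ev_frag_of[OF \<beta>] prod A.scale_sum_left
          A.scale_times_scale cong: sum.cong)
  qed (simp_all add: ev_0[OF \<phi>] ev_0[OF \<beta>] ev_diff[OF \<phi>] ev_diff[OF \<beta>] frag_extend_diff
      right_diff_distrib sum_subtractf cong: sum.cong)
  have "ev \<phi> (pr f g) = (\<Sum>j\<in>J. ev (\<alpha> j) f * ev (\<beta> j) g)"
  proof (rule free_Abelian_group_induct[of f UNIV])
    fix p :: "'a \<times> 'd"
    show "ev \<phi> (pr (frag_of p) g) = (\<Sum>j\<in>J. ev (\<alpha> j) (frag_of p) * ev (\<beta> j) g)"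
      by (cases p) (simp add: base ev_frag_of[OF \<alpha>] cong: sum.cong)
  next
    fix f f' assume "ev \<phi> (pr f g) = (\<Sum>j\<in>J. ev (\<alpha> j) f * ev (\<beta> j) g)"
      "ev \<phi> (pr f' g) = (\<Sum>j\<in>J. ev (\<alpha> j) f' * ev (\<beta> j) g)"
    then show "ev \<phi> (pr (f - f') g) = (\<Sum>j\<in>J. ev (\<alpha> j) (f - f') * ev (\<beta> j) g)"
      by (simp add: pr_def ev_diff[OF \<phi>] ev_diff[OF \<alpha>] frag_extend_diff left_diff_distrib
          sum_subtractf cong: sum.cong)
  qed (simp_all add: pr_def ev_0[OF \<phi>] ev_0[OF \<alpha>] cong: sum.cong)
  also have "\<dots> = (\<Sum>j\<in>J. op (\<alpha> j) a * op (\<beta> j) b)"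
    by (rule sum.cong) (use op_ev[OF \<alpha> fg(1)] op_ev[OF \<beta> fg(2)] in auto)
  finally show "ev \<phi> h = (\<Sum>j\<in>J. op (\<alpha> j) a * op (\<beta> j) b)"
    using ev_class[OF \<phi> fg(3)] by simp
qed

lemma op_combination:
  assumes \<phi>: "functional \<phi>" and \<psi>: "\<And>j. j \<in> J \<Longrightarrow> functional (\<psi> j)"
    and comb: "\<And>x. \<phi> x = (\<Sum>j\<in>J. c j * \<psi> j x)"
  shows "op \<phi> a = (\<Sum>j\<in>J. sA (c j) (op (\<psi> j) a))"
proof -
  obtain f where f: "f \<in> e a"
    using e_rep by blast
  have "ev \<phi> f = (\<Sum>j\<in>J. sA (c j) (ev (\<psi> j) f))"
  proof (rule free_Abelian_group_induct[of f UNIV])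
    fix p :: "'a \<times> 'd"
    show "ev \<phi> (frag_of p) = (\<Sum>j\<in>J. sA (c j) (ev (\<psi> j) (frag_of p)))"
      by (cases p) (simp add: ev_frag_of[OF \<phi>] ev_frag_of[OF \<psi>] comb A.scale_sum_left A.scale_scale
          cong: sum.cong)
  qed (simp_all add: ev_0[OF \<phi>] ev_0[OF \<psi>] ev_diff[OF \<phi>] ev_diff[OF \<psi>] A.scale_diff_right
      sum_subtractf cong: sum.cong)
  then show ?thesis
    using op_ev[OF \<phi> f] op_ev[OF \<psi> f] by (simp cong: sum.cong)
qed

text \<open>
  In particular a family of coordinate maps is determined by \<open>e\<close> and the basis.
\<close>

lemma op_coordinate_maps:
  assumes cm: "coordinate_maps K D A e J \<epsilon> \<delta>" and J: "finite J" and \<phi>: "functional \<phi>"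
  shows "op \<phi> r = (\<Sum>i\<in>J. sA (\<phi> (\<epsilon> i)) (\<delta> i r))"
proof -
  have "e r = (\<Oplus>\<^bsub>T\<^esub>i\<in>J. pure_tensor K A D (\<delta> i r) (\<epsilon> i))"
    using cm unfolding coordinate_maps_def by simp
  then have "op \<phi> r = (\<Sum>i\<in>J. tensor_lift A (\<lambda>x d. sA (\<phi> d) x) (pure_tensor K A D (\<delta> i r) (\<epsilon> i)))"
    unfolding op_def
    using hom_finsum_type_algebra[OF abelian_group_T lift_hom[OF group_A balanced_functional[OF \<phi>]] J]
      pure_carrier by simp
  then show ?thesis
    using lift_pure[OF group_A balanced_functional[OF \<phi>]] by simp
qed

lemma dual_basis_coordinate_maps:
  assumes d: "dual_basis sD J \<epsilon> coord"
  shows "coordinate_maps K D A e J \<epsilon> (\<lambda>i. op (coord i))"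
  unfolding coordinate_maps_def
proof (intro conjI ballI)
  fix r
  interpret T: abelian_group T by (rule abelian_group_T)
  have J: "finite J" and co: "\<And>i. i \<in> J \<Longrightarrow> functional (coord i)" and x: "\<And>x. x = (\<Sum>i\<in>J. sD (coord i x) (\<epsilon> i))"
    using d unfolding dual_basis_def by blast+
  obtain f where f: "f \<in> e r"
    using e_rep by blast
  define h where "h f = (\<Oplus>\<^bsub>T\<^esub>i\<in>J. pure_tensor K A D (ev (coord i) f) (\<epsilon> i))" for f
  have pc: "pure_tensor K A D y z \<in> carrier T" for y z
    by (rule pure_carrier) simp_all
  have pl: "pure_tensor K A D (y + y') z = pure_tensor K A D y z \<oplus>\<^bsub>T\<^esub> pure_tensor K A D y' z"
    and pr: "pure_tensor K A D y (z + z') = pure_tensor K A D y z \<oplus>\<^bsub>T\<^esub> pure_tensor K A D y z'"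
    and ps: "pure_tensor K A D (sA c y) z = pure_tensor K A D y (sD c z)" for y y' z z' c
    using balanced_pure unfolding balanced_def by simp_all
  have h: "h \<in> hom (free_Abelian_group UNIV) (add_monoid T)"
  proof (rule homI)
    fix f g
    have "h (f + g) = (\<Oplus>\<^bsub>T\<^esub>i\<in>J. pure_tensor K A D (ev (coord i) f) (\<epsilon> i) \<oplus>\<^bsub>T\<^esub>
        pure_tensor K A D (ev (coord i) g) (\<epsilon> i))"
      unfolding h_def by (rule T.finsum_cong') (simp_all add: ev_add co pl pc)
    also have "\<dots> = h f \<oplus>\<^bsub>T\<^esub> h g"
      unfolding h_def by (rule T.finsum_addf) (simp_all add: pc)
    finally show "h (f \<otimes>\<^bsub>free_Abelian_group UNIV\<^esub> g) = h f \<otimes>\<^bsub>add_monoid T\<^esub> h g"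
      by simp
  qed (simp add: h_def pc T.finsum_closed)
  have sum_pure: "pure_tensor K A D y (\<Sum>i\<in>I. z i) = (\<Oplus>\<^bsub>T\<^esub>i\<in>I. pure_tensor K A D y (z i))" if "finite I" for y z I
    using that
  proof (induction I rule: finite_induct)
    case empty
    have "pure_tensor K A D y (0 + 0) = pure_tensor K A D y 0 \<oplus>\<^bsub>T\<^esub> pure_tensor K A D y 0"
      by (rule pr)
    then show ?case
      using T.add.l_cancel_one[of "pure_tensor K A D y 0" "pure_tensor K A D y 0"] pc by simp
  next
    case (insert i I)
    then show ?case using T.finsum_insert[of I i] pc by (simp add: pr)
  qed
  have "tensor_class K A D f = h f"
  proof (rule hom_free_eqI[OF T.a_group _ h])
    show "tensor_class K A D \<in> hom (free_Abelian_group UNIV) (add_monoid T)"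
      using class_hom by (simp add: tensor_free_def)
    fix p :: "'a \<times> 'd"
    obtain y z where p: "p = (y, z)"
      by (cases p)
    have "tensor_class K A D (frag_of p) = pure_tensor K A D y (\<Sum>i\<in>J. sD (coord i z) (\<epsilon> i))"
      using x[of z] by (simp add: p pure_tensor_def)
    also have "\<dots> = (\<Oplus>\<^bsub>T\<^esub>i\<in>J. pure_tensor K A D y (sD (coord i z) (\<epsilon> i)))"
      by (rule sum_pure[OF J])
    also have "\<dots> = h (frag_of p)"
      unfolding h_def by (rule T.finsum_cong') (simp_all add: p ev_frag_of co ps pc)
    finally show "tensor_class K A D (frag_of p) = h (frag_of p)" .
  qed simp
  then have "e r = h f"
    using class_of_member(2)[OF e_carrier f] by simp
  also have "\<dots> = (\<Oplus>\<^bsub>T\<^esub>i\<in>J. pure_tensor K A D (op (coord i) r) (\<epsilon> i))"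
    unfolding h_def by (rule T.finsum_cong') (simp_all add: pc op_ev[OF co f])
  finally show "e r = (\<Oplus>\<^bsub>T\<^esub>i\<in>J. pure_tensor K A D (op (coord i) r) (\<epsilon> i))" .
qed simp

lemma ideal_type_algebra_iff:
  "ideal I A \<longleftrightarrow> 0 \<in> I \<and> (\<forall>a\<in>I. \<forall>b\<in>I. a + b \<in> I) \<and> (\<forall>a\<in>I. \<forall>r. r * a \<in> I)"
proof
  assume "ideal I A"
  then interpret I: ideal I A .
  show "0 \<in> I \<and> (\<forall>a\<in>I. \<forall>b\<in>I. a + b \<in> I) \<and> (\<forall>a\<in>I. \<forall>r. r * a \<in> I)"
    using additive_subgroup.zero_closed[OF I.is_additive_subgroup]
      additive_subgroup.a_closed[OF I.is_additive_subgroup] I.I_l_closed by simp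
next
  assume I: "0 \<in> I \<and> (\<forall>a\<in>I. \<forall>b\<in>I. a + b \<in> I) \<and> (\<forall>a\<in>I. \<forall>r. r * a \<in> I)"
  interpret alg: algebra K A
    by (simp add: scalar_algebra_iff A.scalar_algebra_axioms)
  have minus: "- a \<in> I" if "a \<in> I" for a
    using I that by (metis mult_minus1)
  show "ideal I A"
  proof (rule idealI)
    show "ring A" ..
    show "subgroup I (add_monoid A)"
    proof (rule group.subgroupI[OF alg.a_group])
      fix a assume "a \<in> I"
      moreover have "inv\<^bsub>add_monoid A\<^esub> a = - a"
        by (rule group.inv_equality[OF alg.a_group]) simp_all
      ultimately show "inv\<^bsub>add_monoid A\<^esub> a \<in> I"
        using minus by simp
    qed (use I in auto)
  qed (use I in \<open>auto simp: mult.commute\<close>)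
qed

text \<open>
  Stability under the coordinate maps of one basis already gives stability under all \<open>op \<phi>\<close>, as these
  are their linear combinations.  The definition quantifies over bases indexed by \<open>{..m}\<close>, hence the
  reindexing of \<open>\<epsilon>\<close>.
\<close>

lemma D_ideal_iff:
  fixes \<epsilon> :: "'i::finite \<Rightarrow> 'd"
  assumes basis: "is_basis K D UNIV \<epsilon>"
  shows "D_ideal K D A e I \<longleftrightarrow> 0 \<in> I \<and> (\<forall>a\<in>I. \<forall>b\<in>I. a + b \<in> I) \<and> (\<forall>a\<in>I. \<forall>r. r * a \<in> I) \<and>
    (\<forall>\<phi>. functional \<phi> \<longrightarrow> (\<forall>a\<in>I. op \<phi> a \<in> I))" (is "_ \<longleftrightarrow> ?R")
proof
  assume I: "D_ideal K D A e I"
  then have ideal: "0 \<in> I \<and> (\<forall>a\<in>I. \<forall>b\<in>I. a + b \<in> I) \<and> (\<forall>a\<in>I. \<forall>r. r * a \<in> I)"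
    unfolding D_ideal_def ideal_type_algebra_iff by blast
  obtain coord where coord: "dual_basis sD UNIV \<epsilon> coord"
    by (rule D.is_basis_imp_dual[OF basis])
  define m where "m = card (UNIV :: 'i set) - 1"
  have "card {..m} = card (UNIV :: 'i set)"
    using finite_UNIV_card_ge_0[where 'a = 'i] by (simp add: m_def)
  then obtain h :: "nat \<Rightarrow> 'i" where h: "bij_betw h {..m} UNIV"
    using finite_same_card_bij[of "{..m}" "UNIV :: 'i set"] by auto
  have inj: "h i = h j \<longleftrightarrow> i = j" if "i \<le> m" "j \<le> m" for i j
    using h that by (auto simp: bij_betw_def inj_on_def)
  have dual: "dual_basis sD {..m} (\<lambda>i. \<epsilon> (h i)) (\<lambda>i. coord (h i))"
    unfolding dual_basis_def
  proof (intro conjI allI)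
    fix x
    have "x = (\<Sum>i\<in>UNIV. sD (coord i x) (\<epsilon> i))"
      using coord unfolding dual_basis_def by blast
    also have "\<dots> = (\<Sum>i\<le>m. sD (coord (h i) x) (\<epsilon> (h i)))"
      by (rule sum.reindex_bij_betw[OF h, symmetric])
    finally show "x = (\<Sum>i\<le>m. sD (coord (h i) x) (\<epsilon> (h i)))" .
  qed (use coord inj in \<open>auto simp: dual_basis_def\<close>)
  have closed: "op (coord (h i)) a \<in> I" if "i \<le> m" "a \<in> I" for i a
    using I that D.dual_imp_is_basis[OF dual] dual_basis_coordinate_maps[OF dual]
    unfolding D_ideal_def by blast
  have sum_closed: "sum g Z \<in> I" if "\<And>z. z \<in> Z \<Longrightarrow> g z \<in> I" for g and Z :: "nat set"
    using that by (induction Z rule: infinite_finite_induct) (use ideal in auto)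
  have "op \<phi> a \<in> I" if \<phi>: "functional \<phi>" and a: "a \<in> I" for \<phi> a
    unfolding op_coordinate_maps[OF dual_basis_coordinate_maps[OF dual] finite_atMost \<phi>]
  proof (rule sum_closed)
    fix z assume "z \<in> {..m}"
    then show "sA (\<phi> (\<epsilon> (h z))) (op (coord (h z)) a) \<in> I"
      using closed[OF _ a] ideal A.scale_eq_mult by (metis atMost_iff)
  qed
  with ideal show ?R by blast
next
  assume I: ?R
  have "\<delta> i a \<in> I" if b: "is_basis K D {..m} \<eta>" and cm: "coordinate_maps K D A e {..m} \<eta> \<delta>"
    and i: "i \<le> m" and a: "a \<in> I" for m :: nat and \<eta> \<delta> i a
  proof -
    obtain coord where coord: "dual_basis sD {..m} \<eta> coord"
      by (rule D.is_basis_imp_dual[OF b])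
    then have f: "functional (coord i)" and co: "\<And>j. j \<le> m \<Longrightarrow> coord i (\<eta> j) = (if i = j then 1 else 0)"
      using i unfolding dual_basis_def by auto
    have "op (coord i) a = (\<Sum>j\<le>m. sA (coord i (\<eta> j)) (\<delta> j a))"
      by (rule op_coordinate_maps[OF cm finite_atMost f])
    also have "\<dots> = (\<Sum>j\<le>m. if j = i then \<delta> j a else 0)"
      by (rule sum.cong) (auto simp: co A.scale_1)
    also have "\<dots> = \<delta> i a"
      using i by simp
    finally show ?thesis
      using I f a by metis
  qed
  then show "D_ideal K D A e I"
    using I unfolding D_ideal_def ideal_type_algebra_iff by blast
qed

end

section \<open>Residue maps of local algebras\<close>

text \<open>
  Krull's theorem for the principal ideal of \<open>x\<close>, by Zorn's lemma on the ideals that contain \<open>x\<close> but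
  not \<open>\<one>\<close>.
\<close>

lemma nonunit_in_maximalideal:
  fixes L :: "('k, 'l) module"
  assumes L: "cring L" and x: "x \<in> carrier L" "x \<notin> Units L"
  shows "\<exists>M. maximalideal M L \<and> x \<in> M"
proof -
  interpret L: cring L by (rule L)
  define S where "S = {I. ideal I L \<and> x \<in> I \<and> \<one>\<^bsub>L\<^esub> \<notin> I}"
  have "\<one>\<^bsub>L\<^esub> \<notin> PIdl\<^bsub>L\<^esub> x"
    using x L.m_comm unfolding cgenideal_def Units_def by auto
  then have "PIdl\<^bsub>L\<^esub> x \<in> S"
    unfolding S_def using L.cgenideal_ideal L.cgenideal_self x(1) by blast
  moreover have "\<Union>C \<in> S" if C: "C \<noteq> {}" "subset.chain S C" for C
  proof -
    have "subset.chain {I. ideal I L} C"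
      using C(2) unfolding subset.chain_def S_def by auto
    from L.chain_Union_is_ideal[OF this] have "ideal (\<Union>C) L"
      using C(1) by simp
    then show ?thesis
      using C unfolding S_def subset.chain_def by blast
  qed
  ultimately obtain M where M: "M \<in> S" "\<And>I. I \<in> S \<Longrightarrow> M \<subseteq> I \<Longrightarrow> I = M"
    using subset_Zorn_nonempty[of S] by blast
  have "maximalideal M L"
  proof (rule maximalidealI)
    show "ideal M L" "carrier L \<noteq> M"
      using M(1) unfolding S_def by auto
    fix I assume I: "ideal I L" "M \<subseteq> I" "I \<subseteq> carrier L"
    show "I = M \<or> I = carrier L"
    proof (cases "\<one>\<^bsub>L\<^esub> \<in> I")
      case True
      then show ?thesis using ideal.one_imp_carrier[OF I(1)] by blast
    next
      case False
      then show ?thesis using M I unfolding S_def by blast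
    qed
  qed
  then show ?thesis
    using M(1) unfolding S_def by blast
qed

text \<open>
  The residue map sends \<open>x\<close> to the unique scalar \<open>c\<close> with \<open>x\<close> and \<open>c \<odot> \<one>\<close> in the same coset of the maximal
  ideal.  Uniqueness makes it a homomorphism of algebras.
\<close>

locale residue_algebra =
  fixes L :: "('k::field, 'l) module"
  assumes algebra_L: "algebra (ring_of_type_algebra :: 'k ring) L"
    and local_L: "is_local_ring L"
    and residue_L: "has_residue_field (ring_of_type_algebra :: 'k ring) L"
begin

abbreviation K where "K \<equiv> (ring_of_type_algebra :: 'k ring)"

interpretation L: algebra K L by (rule algebra_L)

lemma max_ideal: "maximalideal (max_ideal L) L"
  unfolding max_ideal_def by (rule theI') (use local_L in \<open>auto simp: is_local_ring_def\<close>)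

interpretation m: maximalideal "max_ideal L" L by (rule max_ideal)

lemma non_max_ideal_unit:
  assumes "x \<in> carrier L" "x \<notin> max_ideal L"
  shows "x \<in> Units L"
proof (rule ccontr)
  assume "x \<notin> Units L"
  then obtain M where "maximalideal M L" "x \<in> M"
    using nonunit_in_maximalideal L.M_cring assms(1) by metis
  then show False
    using assms(2) max_ideal local_L unfolding is_local_ring_def by metis
qed

abbreviation quot where "quot x \<equiv> max_ideal L +>\<^bsub>L\<^esub> x"

lemma quot_hom:
  assumes "x \<in> carrier L" "y \<in> carrier L"
  shows "quot (x \<oplus>\<^bsub>L\<^esub> y) = quot x \<oplus>\<^bsub>L Quot max_ideal L\<^esub> quot y"
    "quot (x \<otimes>\<^bsub>L\<^esub> y) = quot x \<otimes>\<^bsub>L Quot max_ideal L\<^esub> quot y"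
    "quot x \<in> carrier (L Quot max_ideal L)"
  using ring_hom_memE[OF m.rcos_ring_hom] assms by auto

abbreviation res :: "'l \<Rightarrow> 'k" where "res \<equiv> residue_map K L"

lemma quot_res:
  assumes "x \<in> carrier L"
  shows "quot (res x \<odot>\<^bsub>L\<^esub> \<one>\<^bsub>L\<^esub>) = quot x"
  using f_the_inv_into_f_bij_betw[OF residue_L[unfolded has_residue_field_def]] quot_hom(3)[OF assms assms]
  unfolding residue_map_def scalar_residue_def by blast

lemma scalar_residue_inj: "quot (c \<odot>\<^bsub>L\<^esub> \<one>\<^bsub>L\<^esub>) = quot (d \<odot>\<^bsub>L\<^esub> \<one>\<^bsub>L\<^esub>) \<Longrightarrow> c = d"
  using residue_L unfolding has_residue_field_def bij_betw_def inj_on_def scalar_residue_def by simp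

lemma res_unique:
  assumes "x \<in> carrier L" "quot (c \<odot>\<^bsub>L\<^esub> \<one>\<^bsub>L\<^esub>) = quot x"
  shows "res x = c"
  by (rule scalar_residue_inj) (use assms quot_res in simp)

lemma scalar_one_carrier: "c \<odot>\<^bsub>L\<^esub> \<one>\<^bsub>L\<^esub> \<in> carrier L"
  by (rule L.smult_closed) simp_all

lemma res_add:
  assumes "x \<in> carrier L" "y \<in> carrier L"
  shows "res (x \<oplus>\<^bsub>L\<^esub> y) = res x + res y"
proof (rule res_unique)
  have "(res x + res y) \<odot>\<^bsub>L\<^esub> \<one>\<^bsub>L\<^esub> = res x \<odot>\<^bsub>L\<^esub> \<one>\<^bsub>L\<^esub> \<oplus>\<^bsub>L\<^esub> res y \<odot>\<^bsub>L\<^esub> \<one>\<^bsub>L\<^esub>"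
    using L.smult_l_distr[of "res x" "res y" "\<one>\<^bsub>L\<^esub>"] by simp
  then show "quot ((res x + res y) \<odot>\<^bsub>L\<^esub> \<one>\<^bsub>L\<^esub>) = quot (x \<oplus>\<^bsub>L\<^esub> y)"
    using quot_hom(1) scalar_one_carrier quot_res assms by simp
qed (use assms in simp)

lemma scalar_one_mult: "x \<in> carrier L \<Longrightarrow> (c \<odot>\<^bsub>L\<^esub> \<one>\<^bsub>L\<^esub>) \<otimes>\<^bsub>L\<^esub> x = c \<odot>\<^bsub>L\<^esub> x"
  using L.smult_assoc2[of c "\<one>\<^bsub>L\<^esub>" x] by simp

lemma res_mult:
  assumes "x \<in> carrier L" "y \<in> carrier L"
  shows "res (x \<otimes>\<^bsub>L\<^esub> y) = res x * res y"
proof (rule res_unique)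
  have "(res x * res y) \<odot>\<^bsub>L\<^esub> \<one>\<^bsub>L\<^esub> = (res x \<odot>\<^bsub>L\<^esub> \<one>\<^bsub>L\<^esub>) \<otimes>\<^bsub>L\<^esub> (res y \<odot>\<^bsub>L\<^esub> \<one>\<^bsub>L\<^esub>)"
    using L.smult_assoc1[of "res x" "res y" "\<one>\<^bsub>L\<^esub>"] scalar_one_mult[OF scalar_one_carrier] by simp
  then show "quot ((res x * res y) \<odot>\<^bsub>L\<^esub> \<one>\<^bsub>L\<^esub>) = quot (x \<otimes>\<^bsub>L\<^esub> y)"
    using quot_hom(2) scalar_one_carrier quot_res assms by simp
qed (use assms in simp)

lemma res_smult:
  assumes "x \<in> carrier L"
  shows "res (c \<odot>\<^bsub>L\<^esub> x) = c * res x"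
  using res_mult[OF scalar_one_carrier assms, of c] res_unique[OF scalar_one_carrier refl, of c]
    scalar_one_mult[OF assms] by simp

lemma res_one: "res \<one>\<^bsub>L\<^esub> = 1"
  by (rule res_unique) (use L.smult_one[of "\<one>\<^bsub>L\<^esub>"] in simp_all)

lemma res_nonzero_unit:
  assumes x: "x \<in> carrier L" and nz: "res x \<noteq> 0"
  shows "\<exists>y\<in>carrier L. x \<otimes>\<^bsub>L\<^esub> y = \<one>\<^bsub>L\<^esub>"
proof -
  have "x \<notin> max_ideal L"
  proof
    assume "x \<in> max_ideal L"
    then have "quot x = max_ideal L"
      using m.a_rcos_const by simp
    moreover have "0 \<odot>\<^bsub>L\<^esub> \<one>\<^bsub>L\<^esub> = \<zero>\<^bsub>L\<^esub>"
      using L.smult_l_null[of "\<one>\<^bsub>L\<^esub>"] by simp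
    moreover have "quot \<zero>\<^bsub>L\<^esub> = max_ideal L"
      by (rule m.a_rcos_const) (rule additive_subgroup.zero_closed[OF m.is_additive_subgroup])
    ultimately have "res x = 0"
      by (intro res_unique[OF x]) simp
    with nz show False by blast
  qed
  then show ?thesis
    using non_max_ideal_unit[OF x] unfolding Units_def by blast
qed

end

section \<open>Associated endomorphisms as coordinate-free operators\<close>

context type_D_ring
begin

lemma self_algebra_K: "self_algebra K = type_algebra (*)"
  by (simp add: self_algebra_def type_algebra_def ring_of_type_algebra_def)

lemma scalar_algebra_self: "scalar_algebra ((*) :: 'k \<Rightarrow> 'k \<Rightarrow> 'k)"
  by unfold_locales (simp_all add: algebra_simps)

text \<open>
  All three maps in the definition of \<open>assoc_endo\<close> are induced by maps on the factors.
\<close>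

lemma assoc_endo_eq_op:
  assumes L: "residue_algebra L" and p: "p \<in> alg_hom K D L"
  shows "assoc_endo K A e L p a = op (\<lambda>d. residue_map K L (p d)) a"
proof -
  interpret L: residue_algebra L by (rule L)
  have alg: "algebra K A" "algebra K D"
    by (simp_all add: scalar_algebra_iff A.scalar_algebra_axioms D.scalar_algebra_axioms)
  interpret AL: tensor_factors K A L
    by (intro tensor_factors.intro alg L.algebra_L)
  interpret AK: tensor_factors K A "self_algebra K"
    by (intro tensor_factors.intro alg)
      (simp add: self_algebra_K scalar_algebra_iff scalar_algebra_self)
  have id: "(\<lambda>x. x) \<in> alg_hom K A A"
    by (auto simp: alg_hom_def ring_hom_def)
  have p': "p x \<in> carrier L" "p (x + y) = p x \<oplus>\<^bsub>L\<^esub> p y" "p (sD c x) = c \<odot>\<^bsub>L\<^esub> p x" for x y c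
    using p by (auto simp: alg_hom_def ring_hom_def)
  have b1: "balanced K A D (tensor K A L) (\<lambda>x y. pure_tensor K A L x (p y))"
    by (rule balanced_tensor_map[OF tensor_factors_axioms AL.tensor_factors_axioms id]) (simp_all add: p')
  have b2: "balanced K A L (tensor K A (self_algebra K))
      (\<lambda>x y. pure_tensor K A (self_algebra K) x (residue_map K L y))"
    by (rule balanced_tensor_map[OF AL.tensor_factors_axioms AK.tensor_factors_axioms id])
      (simp_all add: self_algebra_K L.res_add L.res_smult)
  have b3: "balanced K A (self_algebra K) A (\<lambda>x c. c \<odot>\<^bsub>A\<^esub> x)"
    unfolding balanced_def
    by (simp add: self_algebra_K A.scale_add_left A.scale_add_right A.scale_scale mult.commute)
  note h3 = AK.lift_hom[OF group_A b3]
  note h2 = AL.lift_hom[OF AK.abelian_group_T b2]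
  have "assoc_endo K A e L p a = tensor_lift A (\<lambda>x c. c \<odot>\<^bsub>A\<^esub> x)
      (tensor_lift (tensor K A (self_algebra K)) (\<lambda>x y. tensor_lift (tensor K A (self_algebra K))
        (\<lambda>x y. pure_tensor K A (self_algebra K) x (residue_map K L y)) (pure_tensor K A L x (p y))) (e a))"
    unfolding assoc_endo_def tensor_map_def
    by (subst hom_lift[OF AL.abelian_group_T AK.abelian_group_T b1 h2 e_carrier]) simp
  also have "\<dots> = tensor_lift A (\<lambda>x y. tensor_lift A (\<lambda>x c. c \<odot>\<^bsub>A\<^esub> x)
      (tensor_lift (tensor K A (self_algebra K))
        (\<lambda>x y. pure_tensor K A (self_algebra K) x (residue_map K L y)) (pure_tensor K A L x (p y)))) (e a)"
    by (rule hom_lift[OF AK.abelian_group_T group_A balanced_comp[OF b1 h2] h3 e_carrier])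
  also have "\<dots> = op (\<lambda>d. residue_map K L (p d)) a"
    unfolding op_def using AK.lift_pure[OF group_A b3] AL.lift_pure[OF AK.abelian_group_T b2]
    by (simp add: p' self_algebra_K)
  finally show ?thesis .
qed

end

section \<open>The polynomial ring\<close>

lemma update_eq_add: "a \<notin> Poly_Mapping.keys f \<Longrightarrow> Poly_Mapping.update a b f = f + Poly_Mapping.single a b"
  by (rule poly_mapping_eqI) (auto simp add: lookup_update lookup_add lookup_single in_keys_iff when_def)

lemma D_poly_const_add: "D_poly_const (a + b) = D_poly_const a + D_poly_const b"
  and D_poly_const_mult: "D_poly_const (a * b) = D_poly_const a * D_poly_const b"
  and D_poly_const_0: "D_poly_const 0 = 0"
  and D_poly_const_1: "D_poly_const 1 = 1"
  by (simp_all add: D_poly_const_def single_add mult_single)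

lemma D_poly_const_of_nat: "D_poly_const (of_nat n) = of_nat n"
  by (induction n) (simp_all add: D_poly_const_0 D_poly_const_1 D_poly_const_add)

lemma D_poly_const_minus: "D_poly_const (- a) = - D_poly_const a"
  by (simp add: D_poly_const_def single_uminus)

lemma D_poly_const_power: "D_poly_const (a ^ n) = D_poly_const a ^ n"
  by (induction n) (simp_all add: D_poly_const_1 D_poly_const_mult)

lemma D_poly_generated:
  fixes q :: "('n, 'i, 'r::comm_ring_1) D_poly"
  assumes G: "range D_poly_const \<subseteq> gen_subring G" "\<And>j \<theta>. D_poly_var j \<theta> \<in> gen_subring G"
  shows "q \<in> gen_subring G"
proof -
  have const_mem: "D_poly_const c \<in> gen_subring G" for c
    using G(1) by blast
  have power: "y ^ k \<in> gen_subring G" if "y \<in> gen_subring G" for y and k :: nat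
  proof (induction k)
    case 0
    then show ?case using const_mem[of 1] by (simp add: D_poly_const_1)
  next
    case (Suc k)
    then show ?case using that by (simp add: gen_subring.mult)
  qed
  have monomial: "Poly_Mapping.single m 1 \<in> gen_subring G" for m :: "('n \<times> ('i \<Rightarrow> nat)) \<Rightarrow>\<^sub>0 nat"
  proof (induction m rule: update_induct)
    case const
    then show ?case using const_mem[of 1] by (simp add: D_poly_const_1)
  next
    case (update m v k)
    obtain j \<theta> where v: "v = (j, \<theta>)"
      by (cases v)
    have "Poly_Mapping.single (Poly_Mapping.single v k) 1 = (D_poly_var j \<theta> :: ('n, 'i, 'r) D_poly) ^ k"
    proof (induction k)
      case 0
      then show ?case by simp
    next
      case (Suc k)
      have "Poly_Mapping.single v (Suc k) = Poly_Mapping.single v 1 + Poly_Mapping.single v k"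
        by (simp add: single_add[symmetric])
      then show ?case
        using Suc mult_single[of "Poly_Mapping.single v 1" "1 :: 'r" "Poly_Mapping.single v k" 1]
        by (simp add: D_poly_var_def v)
    qed
    then have "Poly_Mapping.single (Poly_Mapping.update v k m) (1 :: 'r) =
        Poly_Mapping.single m 1 * D_poly_var j \<theta> ^ k"
      using update_eq_add[OF update(1), of k] mult_single[of m "1 :: 'r" "Poly_Mapping.single v k" 1]
      by simp
    then show ?case
      using gen_subring.mult[OF update(3) power[OF G(2)]] by simp
  qed
  show ?thesis
  proof (induction q rule: update_induct)
    case const
    then show ?case using const_mem[of 0] by (simp add: D_poly_const_0)
  next
    case (update q m c)
    have "Poly_Mapping.single m c = D_poly_const c * Poly_Mapping.single m 1"
      by (simp add: D_poly_const_def mult_single)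
    then have "Poly_Mapping.single m c \<in> gen_subring G"
      using gen_subring.mult[OF const_mem monomial] by simp
    then show ?case
      using gen_subring.add[OF update(3)] by (simp add: update_eq_add[OF update(1)])
  qed
qed

locale D_poly_ring = R: type_D_ring sR sD e
  for sR :: "'k::field \<Rightarrow> 'r::comm_ring_1 \<Rightarrow> 'r" and sD :: "'k \<Rightarrow> 'd::comm_ring_1 \<Rightarrow> 'd"
    and e :: "'r \<Rightarrow> ('r \<times> 'd \<Rightarrow>\<^sub>0 int) set" +
  fixes \<epsilon> :: "'i::finite \<Rightarrow> 'd"
    and E :: "('n::finite, 'i, 'r) D_poly \<Rightarrow> (('n, 'i, 'r) D_poly \<times> 'd \<Rightarrow>\<^sub>0 int) set"
  assumes basis: "is_basis (ring_of_type_algebra :: 'k ring) (type_algebra sD) UNIV \<epsilon>"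
    and D_structure: "is_D_poly_structure (ring_of_type_algebra :: 'k ring) (type_algebra sD) \<epsilon> sR e E"
begin

definition sS :: "'k \<Rightarrow> ('n, 'i, 'r) D_poly \<Rightarrow> ('n, 'i, 'r) D_poly" where
  "sS c q = D_poly_const (sR c 1) * q"

lemma D_poly_algebra_eq: "D_poly_algebra sR = type_algebra sS"
  by (simp add: D_poly_algebra_def sS_def[abs_def])

lemma scalar_algebra_sS: "scalar_algebra sS"
proof
  fix c d :: 'k and q q' :: "('n, 'i, 'r) D_poly"
  show "sS (c + d) q = sS c q + sS d q"
    by (simp add: sS_def R.A.scale_add_left D_poly_const_add distrib_right)
  have "sR (c * d) 1 = sR c 1 * sR d 1"
    by (simp add: R.A.scale_times_scale)
  then show "sS c (sS d q) = sS (c * d) q"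
    by (simp add: sS_def D_poly_const_mult mult.assoc)
qed (simp_all add: sS_def distrib_left R.A.scale_1 D_poly_const_1 mult.assoc)

sublocale S: type_D_ring sS sD E
proof (intro type_D_ring.intro type_D_ring_axioms.intro scalar_algebra_sS R.D.scalar_algebra_axioms)
  show "E \<in> alg_hom R.K (type_algebra sS) (tensor R.K (type_algebra sS) R.D)"
    using D_structure unfolding is_D_poly_structure_def D_poly_algebra_eq by (simp add: Let_def)
qed

lemma sS_const: "sS c (D_poly_const a) = D_poly_const (sR c a)"
  using R.A.scale_eq_mult[of c a] by (simp add: sS_def D_poly_const_mult)

text \<open>
  The inclusion of the coefficients is compatible with the \<open>\<D>\<close>-structures.
\<close>

lemma op_const:
  assumes \<phi>: "R.functional \<phi>"
  shows "S.op \<phi> (D_poly_const r) = D_poly_const (R.op \<phi> r)"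
proof -
  have c: "D_poly_const \<in> alg_hom R.K R.A S.A"
    by (auto simp: alg_hom_def ring_hom_def D_poly_const_add D_poly_const_mult D_poly_const_1 sS_const)
  have b: "balanced R.K R.A R.D (tensor R.K S.A R.D) (\<lambda>x y. pure_tensor R.K S.A R.D (D_poly_const x) y)"
    by (rule balanced_tensor_map[OF R.tensor_factors_axioms S.tensor_factors_axioms c]) simp_all
  have h: "D_poly_const \<in> hom (add_monoid R.A) (add_monoid S.A)"
    by (rule homI) (simp_all add: D_poly_const_add)
  have E: "E (D_poly_const r) = tensor_map R.K S.A R.D D_poly_const (\<lambda>d. d) (e r)"
    using D_structure unfolding is_D_poly_structure_def D_poly_algebra_eq by (simp add: Let_def)
  have "S.op \<phi> (D_poly_const r) = tensor_lift S.A (\<lambda>x y. tensor_lift S.A (\<lambda>x d. sS (\<phi> d) x)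
      (pure_tensor R.K S.A R.D (D_poly_const x) y)) (e r)"
    unfolding S.op_def E tensor_map_def
    by (rule R.hom_lift[OF S.abelian_group_T S.group_A b
          S.lift_hom[OF S.group_A S.balanced_functional[OF \<phi>]] R.e_carrier])
  also have "\<dots> = tensor_lift S.A (\<lambda>x y. D_poly_const (sR (\<phi> y) x)) (e r)"
    using S.lift_pure[OF S.group_A S.balanced_functional[OF \<phi>]] by (simp add: sS_const)
  also have "\<dots> = D_poly_const (R.op \<phi> r)"
    unfolding R.op_def
    by (rule R.hom_lift[OF R.group_A S.group_A R.balanced_functional[OF \<phi>] h R.e_carrier, symmetric])
  finally show ?thesis .
qed

lemma op_var:
  assumes \<phi>: "R.functional \<phi>"
  shows "S.op \<phi> (D_poly_var j \<theta>) = (\<Sum>k\<in>UNIV. sS (\<phi> (\<epsilon> k)) (D_poly_var j (\<theta>(k := Suc (\<theta> k)))))"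
proof -
  have E: "E (D_poly_var j \<theta>) = (\<Oplus>\<^bsub>S.T\<^esub>k\<in>UNIV. pure_tensor R.K S.A R.D (D_poly_var j (\<theta>(k := Suc (\<theta> k)))) (\<epsilon> k))"
    using D_structure unfolding is_D_poly_structure_def D_poly_algebra_eq by (simp add: Let_def)
  have "S.op \<phi> (D_poly_var j \<theta>) = (\<Sum>k\<in>UNIV. tensor_lift S.A (\<lambda>x d. sS (\<phi> d) x)
      (pure_tensor R.K S.A R.D (D_poly_var j (\<theta>(k := Suc (\<theta> k)))) (\<epsilon> k)))"
    unfolding S.op_def E
    using S.pure_carrier by (intro hom_finsum_type_algebra[OF S.abelian_group_T
          S.lift_hom[OF S.group_A S.balanced_functional[OF \<phi>]]]) simp_all
  then show ?thesis
    using S.lift_pure[OF S.group_A S.balanced_functional[OF \<phi>]] by simp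
qed

lemma op_sum:
  assumes "R.functional \<phi>"
  shows "S.op \<phi> (sum f J) = (\<Sum>i\<in>J. S.op \<phi> (f i))"
proof (induction J rule: infinite_finite_induct)
  case empty
  show ?case using S.op_add[OF assms, of 0 0] by simp
next
  case (infinite J)
  then show ?case using S.op_add[OF assms, of 0 0] by simp
qed (simp add: S.op_add[OF assms])

text \<open>
  On the linear span of the indeterminates \<open>d\<^sup>\<theta> x\<^sub>j\<close> with \<open>j\<close> fixed, every operator is a linear
  combination of shifts of \<open>\<theta>\<close>, so any two operators commute there.
\<close>

inductive_set var_span :: "'n \<Rightarrow> ('n, 'i, 'r) D_poly set" for j where
  zero: "0 \<in> var_span j"
| step: "y \<in> var_span j \<Longrightarrow> sS c (D_poly_var j \<theta>) + y \<in> var_span j"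

lemma var_span_add: "y \<in> var_span j \<Longrightarrow> z \<in> var_span j \<Longrightarrow> y + z \<in> var_span j"
  by (induction rule: var_span.induct) (auto simp: add.assoc intro: var_span.intros)

lemma var_span_scaled_var: "sS c (D_poly_var j \<theta>) \<in> var_span j"
  using var_span.step[OF var_span.zero] by simp

lemma var_span_sum: "(\<And>i. i \<in> J \<Longrightarrow> f i \<in> var_span j) \<Longrightarrow> sum f J \<in> var_span j"
  by (induction J rule: infinite_finite_induct) (auto intro: var_span.zero var_span_add)

lemma op_scaled_var:
  "R.functional \<phi> \<Longrightarrow> S.op \<phi> (sS c (D_poly_var j \<theta>)) =
    (\<Sum>k\<in>UNIV. sS (c * \<phi> (\<epsilon> k)) (D_poly_var j (\<theta>(k := Suc (\<theta> k)))))"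
  by (simp add: S.op_scale op_var S.A.scale_sum_right S.A.scale_scale)

lemma op_zero: "R.functional \<phi> \<Longrightarrow> S.op \<phi> 0 = 0"
  using S.op_add[of \<phi> 0 0] by simp

lemma op_var_span: "y \<in> var_span j \<Longrightarrow> R.functional \<phi> \<Longrightarrow> S.op \<phi> y \<in> var_span j"
  by (induction rule: var_span.induct)
    (auto simp: S.op_add op_zero op_scaled_var
      intro!: var_span.zero var_span_add var_span_sum var_span_scaled_var)

lemma op_commute:
  assumes "y \<in> var_span j" "R.functional \<phi>" "R.functional \<psi>"
  shows "S.op \<phi> (S.op \<psi> y) = S.op \<psi> (S.op \<phi> y)"
  using assms(1)
proof (induction rule: var_span.induct)
  case zero
  then show ?case using assms by (simp add: op_zero)
next
  case (step y c \<theta>)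
  have shift: "(\<theta>(k := Suc (\<theta> k)))(l := Suc ((\<theta>(k := Suc (\<theta> k))) l)) =
      (\<theta>(l := Suc (\<theta> l)))(k := Suc ((\<theta>(l := Suc (\<theta> l))) k))" for k l
    by auto
  have two: "S.op \<phi> (S.op \<psi> (sS c (D_poly_var j \<theta>))) = (\<Sum>k\<in>UNIV. \<Sum>l\<in>UNIV.
      sS (c * \<psi> (\<epsilon> k) * \<phi> (\<epsilon> l)) (D_poly_var j ((\<theta>(k := Suc (\<theta> k)))(l := Suc ((\<theta>(k := Suc (\<theta> k))) l)))))"
    if "R.functional \<phi>" "R.functional \<psi>" for \<phi> \<psi>
    by (simp only: op_scaled_var[OF that(2)] op_sum[OF that(1)] op_scaled_var[OF that(1)])
  have "S.op \<phi> (S.op \<psi> (sS c (D_poly_var j \<theta>))) = S.op \<psi> (S.op \<phi> (sS c (D_poly_var j \<theta>)))"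
    unfolding two[OF assms(2,3)] two[OF assms(3,2)]
    by (subst sum.swap, subst shift) (simp only: mult_ac)
  then show ?case
    using step.IH assms by (simp add: S.op_add)
qed

end

section \<open>Ranking and Dickson's lemma\<close>

text \<open>
  The most significant position is the highest one, so that raising a higher position gives the
  larger exponent.
\<close>

definition lex_below :: "nat \<Rightarrow> (nat \<Rightarrow> nat) \<Rightarrow> (nat \<Rightarrow> nat) \<Rightarrow> bool" where
  "lex_below N \<theta> \<eta> \<longleftrightarrow> (\<exists>l<N. \<theta> l < \<eta> l \<and> (\<forall>k. l < k \<longrightarrow> k < N \<longrightarrow> \<theta> k = \<eta> k))"

lemma wf_lex_below: "wf {(\<theta>, \<eta>). lex_below N \<theta> \<eta>}"
proof (induction N)
  case 0
  then show ?case by (simp add: lex_below_def)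
next
  case (Suc N)
  have "wf (inv_image (less_than <*lex*> {(\<theta>, \<eta>). lex_below N \<theta> \<eta>}) (\<lambda>\<theta>. (\<theta> N, \<theta>)))"
    using Suc by (intro wf_inv_image wf_lex_prod) auto
  then show ?case
  proof (rule wf_subset, safe)
    fix \<theta> \<eta> assume "lex_below (Suc N) \<theta> \<eta>"
    then obtain l where l: "l < Suc N" "\<theta> l < \<eta> l" "\<And>k. l < k \<Longrightarrow> k < Suc N \<Longrightarrow> \<theta> k = \<eta> k"
      unfolding lex_below_def by blast
    show "(\<theta>, \<eta>) \<in> inv_image (less_than <*lex*> {(\<theta>, \<eta>). lex_below N \<theta> \<eta>}) (\<lambda>\<theta>. (\<theta> N, \<theta>))"
    proof (cases "l = N")
      case True
      then show ?thesis using l(2) by simp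
    next
      case False
      then have "l < N" "\<theta> N = \<eta> N"
        using l(1) l(3)[of N] by auto
      moreover have "lex_below N \<theta> \<eta>"
        unfolding lex_below_def using \<open>l < N\<close> l(2,3) by (intro exI[of _ l]) simp
      ultimately show ?thesis by simp
    qed
  qed
qed

lemma lex_below_trans: "lex_below N \<theta> \<eta> \<Longrightarrow> lex_below N \<eta> \<zeta> \<Longrightarrow> lex_below N \<theta> \<zeta>"
proof -
  assume "lex_below N \<theta> \<eta>" "lex_below N \<eta> \<zeta>"
  then obtain l m where l: "l < N" "\<theta> l < \<eta> l" "\<And>k. l < k \<Longrightarrow> k < N \<Longrightarrow> \<theta> k = \<eta> k"
      and m: "m < N" "\<eta> m < \<zeta> m" "\<And>k. m < k \<Longrightarrow> k < N \<Longrightarrow> \<eta> k = \<zeta> k"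
    unfolding lex_below_def by blast
  show ?thesis
    unfolding lex_below_def
  proof (intro exI[of _ "max l m"] conjI allI impI)
    show "\<theta> (max l m) < \<zeta> (max l m)"
      using l m by (cases l m rule: linorder_cases) (auto simp: max_def)
  qed (use l m in auto)
qed

lemma lex_below_total:
  assumes "\<And>l. l \<ge> N \<Longrightarrow> \<theta> l = 0" "\<And>l. l \<ge> N \<Longrightarrow> \<eta> l = 0"
  shows "lex_below N \<theta> \<eta> \<or> \<theta> = \<eta> \<or> lex_below N \<eta> \<theta>"
proof (cases "\<theta> = \<eta>")
  case False
  define Z where "Z = {l. \<theta> l \<noteq> \<eta> l}"
  have Z: "Z \<subseteq> {..<N}"
    unfolding Z_def using assms by (metis (mono_tags, lifting) lessThan_iff linorder_not_le mem_Collect_eq subsetI)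
  then have fin: "finite Z" by (rule finite_subset) simp
  have "Z \<noteq> {}" using False unfolding Z_def by auto
  then have max: "Max Z \<in> Z"
    by (rule Max_in[OF fin])
  have above: "\<theta> k = \<eta> k" if "Max Z < k" for k
    using Max_ge[OF fin, of k] that unfolding Z_def by auto
  have "Max Z < N" "\<theta> (Max Z) < \<eta> (Max Z) \<or> \<eta> (Max Z) < \<theta> (Max Z)"
    using max Z unfolding Z_def by auto
  then show ?thesis
    unfolding lex_below_def using above[symmetric] above by blast
qed simp

text \<open>
  Of the two kinds of monotone subsequence, a decreasing one is eventually constant.
\<close>

lemma nat_mono_subsequence:
  fixes g :: "nat \<Rightarrow> nat"
  obtains r :: "nat \<Rightarrow> nat" where "strict_mono r" "mono (\<lambda>n. g (r n))"
proof -
  obtain r where r: "strict_mono r" "monoseq (\<lambda>n. g (r n))"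
    using seq_monosub[of g] by blast
  from r(2) consider "\<And>m n. m \<le> n \<Longrightarrow> g (r m) \<le> g (r n)" | "\<And>m n. m \<le> n \<Longrightarrow> g (r n) \<le> g (r m)"
    unfolding monoseq_def by blast
  then show thesis
  proof cases
    case 1
    then show thesis using that[OF r(1)] by (auto simp: mono_def)
  next
    case 2
    obtain n0 where n0: "\<And>n. g (r n0) \<le> g (r n)"
      using ex_has_least_nat[of "\<lambda>_. True" 0 "\<lambda>n. g (r n)"] by auto
    have "strict_mono (\<lambda>n. r (n0 + n))"
      using r(1) by (simp add: strict_mono_def)
    moreover have "g (r (n0 + n)) = g (r n0)" for n
      using 2[of n0 "n0 + n"] n0[of "n0 + n"] by simp
    ultimately show thesis
      using that[of "\<lambda>n. r (n0 + n)"] by (simp add: mono_def)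
  qed
qed

lemma simultaneous_mono_subsequence:
  fixes g :: "nat \<Rightarrow> nat \<Rightarrow> nat"
  shows "\<exists>r :: nat \<Rightarrow> nat. strict_mono r \<and> (\<forall>c<M. mono (\<lambda>n. g c (r n)))"
proof (induction M)
  case 0
  then show ?case by (intro exI[of _ id]) (simp add: strict_mono_def)
next
  case (Suc M)
  then obtain r :: "nat \<Rightarrow> nat" where r: "strict_mono r" "\<And>c. c < M \<Longrightarrow> mono (\<lambda>n. g c (r n))"
    by blast
  obtain r' :: "nat \<Rightarrow> nat" where r': "strict_mono r'" "mono (\<lambda>n. g M (r (r' n)))"
    using nat_mono_subsequence[of "\<lambda>n. g M (r n)"] by blast
  have "strict_mono (\<lambda>n. r (r' n))"
    using r(1) r'(1) by (simp add: strict_mono_def)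
  moreover have "mono (\<lambda>n. g c (r (r' n)))" if "c < Suc M" for c
    using that r(2)[of c] r'(2) strict_mono_mono[OF r'(1)] by (cases "c = M") (auto simp: mono_def)
  ultimately show ?case by blast
qed

definition shift :: "nat \<Rightarrow> 'n \<times> (nat \<Rightarrow> nat) \<Rightarrow> 'n \<times> (nat \<Rightarrow> nat)" where
  "shift l v = (fst v, (snd v)(l := Suc (snd v l)))"

lemma foldr_shift_replicate: "foldr shift (replicate k l) (j, \<theta>) = (j, \<theta>(l := \<theta> l + k))"
  by (induction k) (auto simp: shift_def)

lemma shift_word_exists:
  assumes "\<And>l. \<theta> l \<le> \<eta> l" "\<And>l. l \<ge> N \<Longrightarrow> \<theta> l = \<eta> l"
  shows "\<exists>w. set w \<subseteq> {..<N} \<and> (j, \<eta>) = foldr shift w (j, \<theta>)"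
  using assms
proof (induction N arbitrary: \<eta>)
  case 0
  then have "\<theta> = \<eta>" by auto
  then show ?case by (intro exI[of _ "[]"]) simp
next
  case (Suc N)
  have "\<exists>w. set w \<subseteq> {..<N} \<and> (j, \<eta>(N := \<theta> N)) = foldr shift w (j, \<theta>)"
    by (rule Suc.IH) (use Suc.prems in \<open>auto simp: le_Suc_eq\<close>)
  then obtain w where w: "set w \<subseteq> {..<N}" "(j, \<eta>(N := \<theta> N)) = foldr shift w (j, \<theta>)"
    by blast
  have "foldr shift (replicate (\<eta> N - \<theta> N) N @ w) (j, \<theta>) = (j, \<eta>)"
    unfolding foldr_append o_apply w(2)[symmetric] foldr_shift_replicate
    using Suc.prems(1)[of N] by simp
  then show ?case
    using w(1) by (intro exI[of _ "replicate (\<eta> N - \<theta> N) N @ w"]) (auto simp: less_Suc_eq)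
qed

lemma shift_dickson:
  fixes f :: "nat \<Rightarrow> 'n::finite \<times> (nat \<Rightarrow> nat)" and d :: "nat \<Rightarrow> nat"
  assumes f: "\<And>n l. l \<ge> N \<Longrightarrow> snd (f n) l = 0"
  shows "\<exists>i j w. i < j \<and> d i \<le> d j \<and> set w \<subseteq> {..<N} \<and> f j = foldr shift w (f i)"
proof -
  obtain code :: "'n \<Rightarrow> nat" where code: "inj code"
    using finite_imp_inj_to_nat_seg[of "UNIV :: 'n set"] by auto
  define b where "b = Max (range code)"
  have b: "code i \<le> b" for i
    unfolding b_def by (rule Max_ge) auto
  \<comment> \<open>If the code of the first component and its complement to \<open>b\<close> are both monotone, the code is
    constant.\<close>
  define g where "g c n = (if c < N then snd (f n) c else if c = N then code (fst (f n))
      else if c = Suc N then b - code (fst (f n)) else d n)" for c n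
  obtain r :: "nat \<Rightarrow> nat" where r: "strict_mono r" "\<And>c. c < Suc (Suc (Suc N)) \<Longrightarrow> mono (\<lambda>n. g c (r n))"
    using simultaneous_mono_subsequence[of "Suc (Suc (Suc N))" g] by blast
  have le: "g c (r 0) \<le> g c (r 1)" if "c < Suc (Suc (Suc N))" for c
    using r(2)[OF that] by (simp add: mono_def)
  have "code (fst (f (r 0))) = code (fst (f (r 1)))"
    using le[of N] le[of "Suc N"] b[of "fst (f (r 0))"] b[of "fst (f (r 1))"] by (simp add: g_def)
  then have fst: "fst (f (r 0)) = fst (f (r 1))"
    using code by (simp add: inj_def)
  have snd: "snd (f (r 0)) l \<le> snd (f (r 1)) l" for l
    using le[of l] f by (cases "l < N") (auto simp: g_def)
  obtain w where w: "set w \<subseteq> {..<N}"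
      "(fst (f (r 1)), snd (f (r 1))) = foldr shift w (fst (f (r 1)), snd (f (r 0)))"
    using shift_word_exists[of "snd (f (r 0))" "snd (f (r 1))" N "fst (f (r 1))"] snd f by metis
  have "f (r 1) = foldr shift w (f (r 0))"
    using w(2) fst by (metis prod.collapse)
  moreover have "d (r 0) \<le> d (r 1)"
    using le[of "Suc (Suc N)"] by (simp add: g_def)
  moreover have "r 0 < r 1"
    using r(1) by (simp add: strict_mono_def)
  ultimately show ?thesis
    using w(1) by blast
qed

primrec iterate :: "(nat \<Rightarrow> 'a \<Rightarrow> 'a) \<Rightarrow> nat \<Rightarrow> (nat \<Rightarrow> nat) \<Rightarrow> 'a \<Rightarrow> 'a" where
  "iterate \<delta> 0 \<theta> y = y"
| "iterate \<delta> (Suc n) \<theta> y = (\<delta> n ^^ \<theta> n) (iterate \<delta> n \<theta> y)"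

lemma iterate_cong: "(\<And>l. l < n \<Longrightarrow> \<theta> l = \<eta> l) \<Longrightarrow> iterate \<delta> n \<theta> y = iterate \<delta> n \<eta> y"
  by (induction n) simp_all

lemma iterate_0: "iterate \<delta> n (\<lambda>_. 0) y = y"
  by (induction n) simp_all

text \<open>
  On elements where the operators commute, applying \<open>\<delta> l\<close> once more can be moved to the place where
  \<open>iterate\<close> applies it.
\<close>

lemma iterate_shift:
  assumes closed: "\<And>l z. l < n \<Longrightarrow> z \<in> W \<Longrightarrow> \<delta> l z \<in> W"
    and comm: "\<And>k l z. k < n \<Longrightarrow> l < n \<Longrightarrow> z \<in> W \<Longrightarrow> \<delta> k (\<delta> l z) = \<delta> l (\<delta> k z)"
    and y: "y \<in> W"
  shows "iterate \<delta> n \<theta> y \<in> W \<and> (\<forall>l<n. \<delta> l (iterate \<delta> n \<theta> y) = iterate \<delta> n (\<theta>(l := Suc (\<theta> l))) y)"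
  using closed comm
proof (induction n)
  case 0
  then show ?case using y by simp
next
  case (Suc n)
  note closed = Suc.prems(1) and comm = Suc.prems(2)
  have "iterate \<delta> n \<theta> y \<in> W \<and> (\<forall>l<n. \<delta> l (iterate \<delta> n \<theta> y) = iterate \<delta> n (\<theta>(l := Suc (\<theta> l))) y)"
    by (rule Suc.IH) (use Suc.prems in auto)
  then have IH: "iterate \<delta> n \<theta> y \<in> W" "\<And>l. l < n \<Longrightarrow> \<delta> l (iterate \<delta> n \<theta> y) = iterate \<delta> n (\<theta>(l := Suc (\<theta> l))) y"
    by blast+
  have power: "(\<delta> n ^^ k) z \<in> W \<and> (\<forall>l<Suc n. \<delta> l ((\<delta> n ^^ k) z) = (\<delta> n ^^ k) (\<delta> l z))" if "z \<in> W" for z k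
  proof (induction k)
    case 0
    then show ?case using that by simp
  next
    case (Suc k)
    then have k: "(\<delta> n ^^ k) z \<in> W" "\<And>l. l < Suc n \<Longrightarrow> \<delta> l ((\<delta> n ^^ k) z) = (\<delta> n ^^ k) (\<delta> l z)"
      by blast+
    have "(\<delta> n ^^ Suc k) z \<in> W"
      using closed[of n, OF _ k(1)] by simp
    moreover have "\<delta> l ((\<delta> n ^^ Suc k) z) = (\<delta> n ^^ Suc k) (\<delta> l z)" if "l < Suc n" for l
      using comm[of l n, OF that _ k(1)] by (simp only: funpow.simps o_apply k(2)[OF that] lessI)
    ultimately show ?case by blast
  qed
  have "\<delta> l (iterate \<delta> (Suc n) \<theta> y) = iterate \<delta> (Suc n) (\<theta>(l := Suc (\<theta> l))) y" if "l < Suc n" for l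
  proof (cases "l = n")
    case True
    then show ?thesis
      using iterate_cong[of n "\<theta>(n := Suc (\<theta> n))" \<theta> \<delta> y] by simp
  next
    case False
    then show ?thesis
      using that power[OF IH(1), of "\<theta> n"] IH(2)[of l] by simp
  qed
  moreover have "iterate \<delta> (Suc n) \<theta> y \<in> W"
    unfolding iterate.simps using power[OF IH(1)] by blast
  ultimately show ?case
    by blast
qed

section \<open>Perfect ideals in terms of a triangular system\<close>

lemma sum_Plus_pairs:
  fixes l :: nat
  shows "(\<Sum>i\<in>UNIV <+> ({..<l} \<times> {..<l}). g i) =
    g (Inl True) + g (Inl False) + (\<Sum>j<l. \<Sum>k<l. g (Inr (j, k)))"
  by (simp add: sum.Plus UNIV_bool sum.cartesian_product add.commute)

lemma (in type_D_ring) op_Leibniz: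
  fixes l :: nat
  assumes f: "functional \<phi>" "functional \<sigma>" "\<And>j. j < l \<Longrightarrow> functional (\<psi> j)"
    and prod: "\<And>x y. \<phi> (x * y) = \<sigma> x * \<phi> y + \<phi> x * \<sigma> y + (\<Sum>j<l. \<Sum>k<l. c j k * (\<psi> j x * \<psi> k y))"
  shows "op \<phi> (a * b) = op \<sigma> a * op \<phi> b + op \<phi> a * op \<sigma> b +
    (\<Sum>j<l. \<Sum>k<l. sA (c j k) 1 * (op (\<psi> j) a * op (\<psi> k) b))"
proof -
  \<comment> \<open>The two twisted terms and the double sum are merged into one indexed sum of products.\<close>
  define J :: "(bool + nat \<times> nat) set" where "J = UNIV <+> ({..<l} \<times> {..<l})"
  define \<alpha> where "\<alpha> i = (case i of Inl s \<Rightarrow> if s then \<sigma> else \<phi> | Inr (j, k) \<Rightarrow> (\<lambda>x. c j k * \<psi> j x))"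
    for i :: "bool + nat \<times> nat"
  define \<beta> where "\<beta> i = (case i of Inl s \<Rightarrow> if s then \<phi> else \<sigma> | Inr (j, k) \<Rightarrow> \<psi> k)"
    for i :: "bool + nat \<times> nat"
  note sum_J = sum_Plus_pairs[of _ l, folded J_def]
  have scaled: "functional (\<lambda>x. c j k * \<psi> j x)" if "j < l" for j k
    using f(3)[OF that] by (auto simp: linear_functional_def algebra_simps)
  have "functional (\<alpha> i)" "functional (\<beta> i)" if "i \<in> J" for i
    using that f scaled unfolding J_def \<alpha>_def \<beta>_def by auto
  moreover have "\<phi> (x * y) = (\<Sum>i\<in>J. \<alpha> i x * \<beta> i y)" for x y
    unfolding sum_J by (simp add: \<alpha>_def \<beta>_def prod mult.assoc)
  ultimately have "op \<phi> (a * b) = (\<Sum>i\<in>J. op (\<alpha> i) a * op (\<beta> i) b)"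
    by (rule op_mult[OF f(1)])
  also have "\<dots> = op \<sigma> a * op \<phi> b + op \<phi> a * op \<sigma> b +
      (\<Sum>j<l. \<Sum>k<l. op (\<lambda>x. c j k * \<psi> j x) a * op (\<psi> k) b)"
    unfolding sum_J by (simp add: \<alpha>_def \<beta>_def)
  also have "(\<Sum>j<l. \<Sum>k<l. op (\<lambda>x. c j k * \<psi> j x) a * op (\<psi> k) b) =
      (\<Sum>j<l. \<Sum>k<l. sA (c j k) 1 * (op (\<psi> j) a * op (\<psi> k) b))"
  proof (intro sum.cong refl)
    fix j k assume "j \<in> {..<l}"
    then have j: "j < l" by simp
    have "op (\<lambda>x. c j k * \<psi> j x) a = sA (c j k) (op (\<psi> j) a)"
      using op_combination[OF scaled[OF j], where J = "{()}" and \<psi> = "\<lambda>_. \<psi> j"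
        and c = "\<lambda>_. c j k" and a = a] f(3)[OF j] by simp
    then show "op (\<lambda>x. c j k * \<psi> j x) a * op (\<psi> k) b = sA (c j k) 1 * (op (\<psi> j) a * op (\<psi> k) b)"
      by (simp add: A.scale_mult_left)
  qed
  finally show ?thesis .
qed

locale triangular_D_ring = type_D_ring sA sD e + V: split_algebra sD Basis t \<chi>
  for sA :: "'k::field \<Rightarrow> 'a::comm_ring_1 \<Rightarrow> 'a" and sD :: "'k \<Rightarrow> 'd::comm_ring_1 \<Rightarrow> 'd"
    and e :: "'a \<Rightarrow> ('a \<times> 'd \<Rightarrow>\<^sub>0 int) set" and Basis t \<chi> +
  fixes N :: nat and \<phi> :: "nat \<Rightarrow> 'd \<Rightarrow> 'k" and \<kappa> :: "nat \<Rightarrow> nat"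
  assumes triangular: "V.triangular N \<phi> \<kappa>" and kernel: "V.common_kernel N \<phi> = {0}"
begin

lemma functional_\<phi>: "l < N \<Longrightarrow> functional (\<phi> l)"
  using triangular unfolding V.triangular_def by blast

lemma t_le_N: "t \<le> N" and character: "l < t \<Longrightarrow> \<phi> l = \<chi> l" "l < t \<Longrightarrow> \<kappa> l = l"
  and \<kappa>_less: "l < N \<Longrightarrow> t \<le> l \<Longrightarrow> \<kappa> l < t"
  using triangular unfolding V.triangular_def by auto

lemma \<kappa>_fixed_iff: "l < N \<Longrightarrow> \<kappa> l = l \<longleftrightarrow> l < t"
  using character(2) \<kappa>_less by (metis leI less_irrefl less_le_trans)

lemma twisted:
  assumes base: "\<And>z. of_int z \<in> base" "\<And>a b. a \<in> base \<Longrightarrow> b \<in> base \<Longrightarrow> a + b \<in> base"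
    "\<And>a b. a \<in> base \<Longrightarrow> b \<in> base \<Longrightarrow> a * b \<in> base" "\<And>c. sA c 1 \<in> base"
    "\<And>l a. l < N \<Longrightarrow> a \<in> base \<Longrightarrow> op (\<phi> l) a \<in> base"
  shows "twisted_operators N (\<lambda>l. op (\<phi> l)) \<kappa> base"
proof
  fix l assume l: "l < N"
  show "\<kappa> l \<le> l"
    using character(2)[of l] \<kappa>_less[OF l] by (cases "l < t") auto
  show "\<kappa> (\<kappa> l) = \<kappa> l"
    using character(2) \<kappa>_less[OF l] by (cases "l < t") auto
  show "op (\<phi> l) (a + b) = op (\<phi> l) a + op (\<phi> l) b" for a b
    by (rule op_add[OF functional_\<phi>[OF l]])
  show "op (\<phi> l) (a * b) = op (\<phi> l) a * op (\<phi> l) b" if "\<kappa> l = l" for a b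
  proof -
    have lt: "l < t"
      using \<kappa>_fixed_iff[OF l] that by simp
    show ?thesis
      using op_mult[OF functional_\<phi>[OF l], of "{()}" "\<lambda>_. \<phi> l" "\<lambda>_. \<phi> l" a b]
        functional_\<phi>[OF l] V.\<chi>_mult[OF lt] character(1)[OF lt] by simp
  qed
  show "\<exists>c. (\<forall>j k. c j k \<in> base) \<and> (\<forall>a b. op (\<phi> l) (a * b) =
      op (\<phi> (\<kappa> l)) a * op (\<phi> l) b + op (\<phi> l) a * op (\<phi> (\<kappa> l)) b +
      (\<Sum>j<l. \<Sum>k<l. c j k * (op (\<phi> j) a * op (\<phi> k) b)))" if lt: "\<kappa> l < l"
  proof -
    have "t \<le> l"
      using lt character(2)[of l] by (cases "l < t") auto
    then obtain c where c: "\<And>x y. \<phi> l (x * y) =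
        \<phi> (\<kappa> l) x * \<phi> l y + \<phi> l x * \<phi> (\<kappa> l) y + (\<Sum>j<l. \<Sum>k<l. c j k * (\<phi> j x * \<phi> k y))"
      using triangular l unfolding V.triangular_def by blast
    show ?thesis
    proof (intro exI[of _ "\<lambda>j k. sA (c j k) 1"] conjI allI base(4))
      show "op (\<phi> l) (a * b) = op (\<phi> (\<kappa> l)) a * op (\<phi> l) b + op (\<phi> l) a * op (\<phi> (\<kappa> l)) b +
          (\<Sum>j<l. \<Sum>k<l. sA (c j k) 1 * (op (\<phi> j) a * op (\<phi> k) b))" for a b
        by (rule op_Leibniz) (use functional_\<phi> l lt c in auto)
    qed
  qed
qed (use base in auto)

lemma op_in_span:
  obtains v where "\<And>\<psi> a. functional \<psi> \<Longrightarrow> op \<psi> a = (\<Sum>l<N. sA (\<psi> (v l)) (op (\<phi> l) a))"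
proof -
  obtain v where v: "\<And>\<psi> x. functional \<psi> \<Longrightarrow> \<psi> x = (\<Sum>l<N. \<phi> l x * \<psi> (v l))"
    using V.functional_in_span[OF functional_\<phi> kernel] by blast
  have "op \<psi> a = (\<Sum>l<N. sA (\<psi> (v l)) (op (\<phi> l) a))" if \<psi>: "functional \<psi>" for \<psi> a
  proof (rule op_combination[OF \<psi>])
    show "\<psi> x = (\<Sum>l<N. \<psi> (v l) * \<phi> l x)" for x
      by (subst v[OF \<psi>]) (simp only: mult.commute)
  qed (simp add: functional_\<phi>)
  then show thesis by (rule that)
qed

lemma power_type_algebra: "a [^]\<^bsub>A\<^esub> (n::nat) = a ^ n"
  by (induction n) (simp_all add: nat_pow_def mult.commute)

text \<open>
  The functionals \<open>\<phi> l\<close> span all functionals, and those with \<open>\<kappa> l = l\<close> are precisely the characters.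
\<close>

lemma perfect_D_ideal_iff:
  fixes \<epsilon> :: "'i::finite \<Rightarrow> 'd"
  assumes basis: "is_basis K D UNIV \<epsilon>"
    and endo: "\<And>i a. i < t \<Longrightarrow> assoc_endo K A e (L i) (p i) a = op (\<chi> i) a"
  shows "perfect_D_ideal K D t L p A e I \<longleftrightarrow> twisted_operators.perfect N (\<lambda>l. op (\<phi> l)) \<kappa> I"
proof -
  interpret twisted_operators N "\<lambda>l. op (\<phi> l)" \<kappa> UNIV
    by (rule twisted) auto
  obtain v where v: "\<And>\<psi> a. functional \<psi> \<Longrightarrow> op \<psi> a = (\<Sum>l<N. sA (\<psi> (v l)) (op (\<phi> l) a))"
    using op_in_span by blast
  define ring_ideal where "ring_ideal \<longleftrightarrow> 0 \<in> I \<and> (\<forall>a\<in>I. \<forall>b\<in>I. a + b \<in> I) \<and> (\<forall>a\<in>I. \<forall>r. r * a \<in> I)"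
  have all_ops: "(\<forall>\<psi>. functional \<psi> \<longrightarrow> (\<forall>a\<in>I. op \<psi> a \<in> I)) \<longleftrightarrow> (\<forall>l<N. \<forall>a\<in>I. op (\<phi> l) a \<in> I)"
    if I: ring_ideal
  proof safe
    fix \<psi> a assume ops: "\<forall>l<N. \<forall>a\<in>I. op (\<phi> l) a \<in> I" and \<psi>: "functional \<psi>" and a: "a \<in> I"
    have sum_closed: "sum g Z \<in> I" if "\<And>z. z \<in> Z \<Longrightarrow> g z \<in> I" for g and Z :: "nat set"
      using that by (induction Z rule: infinite_finite_induct) (use I in \<open>auto simp: ring_ideal_def\<close>)
    have "sA (\<psi> (v l)) (op (\<phi> l) a) \<in> I" if "l < N" for l
      using ops that a I A.scale_eq_mult[of "\<psi> (v l)" "op (\<phi> l) a"] unfolding ring_ideal_def by simp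
    then show "op \<psi> a \<in> I"
      unfolding v[OF \<psi>] by (intro sum_closed) simp
  qed (use functional_\<phi> in blast)
  have chars: "(\<forall>a. \<forall>i<t. a * op (\<chi> i) a \<in> I \<longrightarrow> a \<in> I) \<longleftrightarrow>
      (\<forall>l<N. \<kappa> l = l \<longrightarrow> (\<forall>a. a * op (\<phi> l) a \<in> I \<longrightarrow> a \<in> I))"
    using character t_le_N \<kappa>_fixed_iff by (metis less_le_trans)
  have ideal: "D_ideal K D A e I \<longleftrightarrow> ring_ideal \<and> (\<forall>l<N. \<forall>a\<in>I. op (\<phi> l) a \<in> I)"
    unfolding D_ideal_iff[OF basis] using all_ops unfolding ring_ideal_def by blast
  have "perfect_D_ideal K D t L p A e I \<longleftrightarrow> D_ideal K D A e I \<and> (\<forall>a. \<forall>n::nat. a ^ n \<in> I \<longrightarrow> a \<in> I) \<and>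
      (\<forall>a. \<forall>i<t. a * op (\<chi> i) a \<in> I \<longrightarrow> a \<in> I)"
    unfolding perfect_D_ideal_def by (simp add: power_type_algebra endo cong: conj_cong)
  then show ?thesis
    unfolding perfect_def chars ideal ring_ideal_def by blast
qed

end

section \<open>The chain condition for the polynomial ring\<close>

text \<open>
  The residue characters detect units: an element whose components all have nonzero residue is
  invertible in each local factor, hence in the product.
\<close>

lemma split_algebra_of_decomposition:
  fixes sD :: "'k::field \<Rightarrow> 'd::comm_ring_1 \<Rightarrow> 'd" and L :: "nat \<Rightarrow> ('k, 'l) module"
    and \<epsilon> :: "'i::finite \<Rightarrow> 'd"
  defines "K \<equiv> (ring_of_type_algebra :: 'k ring)" and "D \<equiv> type_algebra sD"
  assumes D: "algebra K D" and basis: "is_basis K D UNIV \<epsilon>"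
    and dec: "local_decomposition K D t L p"
    and residue: "\<And>i. i < t \<Longrightarrow> has_residue_field K (L i)"
  obtains Basis where "split_algebra sD Basis t (\<lambda>i d. residue_map K (L i) (p i d))"
proof -
  interpret D: scalar_algebra sD
    using D unfolding K_def D_def scalar_algebra_iff .
  interpret vs: vector_space sD
    by (rule D.vector_space_scale)
  obtain coord where coord: "dual_basis sD UNIV \<epsilon> coord"
    using D.is_basis_imp_dual basis unfolding K_def D_def by blast
  obtain Basis where B: "Basis \<subseteq> range \<epsilon>" "vs.independent Basis" "range \<epsilon> \<subseteq> vs.span Basis"
    by (rule vs.maximal_independent_subset)
  have span: "x \<in> vs.span Basis" for x
  proof -
    have "x = (\<Sum>i\<in>UNIV. sD (coord i x) (\<epsilon> i))"
      using coord unfolding dual_basis_def by blast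
    also have "\<dots> \<in> vs.span Basis"
      using B(3) by (intro vs.span_sum vs.span_scale) auto
    finally show ?thesis .
  qed
  have L: "residue_algebra (L i)" and p: "p i \<in> alg_hom K D (L i)" if "i < t" for i
    using dec residue[OF that] that unfolding local_decomposition_def K_def
    by (auto intro: residue_algebra.intro)
  have p_carrier: "p i x \<in> carrier (L i)" and p_add: "p i (x + y) = p i x \<oplus>\<^bsub>L i\<^esub> p i y"
    and p_mult: "p i (x * y) = p i x \<otimes>\<^bsub>L i\<^esub> p i y" and p_one: "p i 1 = \<one>\<^bsub>L i\<^esub>"
    and p_scale: "p i (sD c x) = c \<odot>\<^bsub>L i\<^esub> p i x" if "i < t" for i x y c
    using p[OF that] unfolding alg_hom_def ring_hom_def D_def K_def by auto
  have bij: "bij_betw (\<lambda>x. \<lambda>i\<in>{..<t}. p i x) UNIV (\<Pi>\<^sub>E i\<in>{..<t}. carrier (L i))"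
    using dec unfolding local_decomposition_def D_def by simp
  have "split_algebra sD Basis t (\<lambda>i d. residue_map K (L i) (p i d))"
    unfolding K_def
  proof (unfold_locales, goal_cases)
    case 1
    show ?case using B(1) by (rule finite_subset) simp
  next
    case 2
    show ?case by (rule B(2))
  next
    case 3
    show ?case using span by blast
  next
    case (9 x)
    \<comment> \<open>The components of \<open>x\<close> are units, and their inverses glue.\<close>
    have "\<forall>i. \<exists>y. i < t \<longrightarrow> y \<in> carrier (L i) \<and> p i x \<otimes>\<^bsub>L i\<^esub> y = \<one>\<^bsub>L i\<^esub>"
      using residue_algebra.res_nonzero_unit[OF L p_carrier] 9 by blast
    then obtain y where y: "\<And>i. i < t \<Longrightarrow> y i \<in> carrier (L i) \<and> p i x \<otimes>\<^bsub>L i\<^esub> y i = \<one>\<^bsub>L i\<^esub>"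
      by metis
    then have "(\<lambda>i\<in>{..<t}. y i) \<in> (\<Pi>\<^sub>E i\<in>{..<t}. carrier (L i))"
      by auto
    then obtain z where z: "(\<lambda>i\<in>{..<t}. y i) = (\<lambda>i\<in>{..<t}. p i z)"
      using bij unfolding bij_betw_def by (metis (no_types, lifting) imageE)
    have "p i z = y i" if "i < t" for i
      using fun_cong[OF z, of i] that by simp
    then have "(\<lambda>i\<in>{..<t}. p i (x * z)) = (\<lambda>i\<in>{..<t}. p i 1)"
      using y by (intro restrict_ext) (simp add: p_mult p_one)
    then have "x * z = 1"
      using bij unfolding bij_betw_def inj_on_def by blast
    then show ?case by blast
  qed (simp_all add: D.scale_mult_left p_add p_mult p_one p_scale p_carrier
      residue_algebra.res_add[OF L] residue_algebra.res_mult[OF L] residue_algebra.res_smult[OF L]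
      residue_algebra.res_one[OF L])
  then show thesis by (rule that)
qed

locale triangular_D_poly_ring = D_poly_ring sR sD e \<epsilon> E + R: triangular_D_ring sR sD e Basis t \<chi> N \<phi> \<kappa>
  for sR :: "'k::field \<Rightarrow> 'r::comm_ring_1 \<Rightarrow> 'r" and sD :: "'k \<Rightarrow> 'd::comm_ring_1 \<Rightarrow> 'd"
    and e :: "'r \<Rightarrow> ('r \<times> 'd \<Rightarrow>\<^sub>0 int) set" and \<epsilon> :: "'i::finite \<Rightarrow> 'd"
    and E :: "('n::finite, 'i, 'r) D_poly \<Rightarrow> (('n, 'i, 'r) D_poly \<times> 'd \<Rightarrow>\<^sub>0 int) set"
    and Basis t \<chi> N \<phi> \<kappa> +
  assumes of_nat_unit_R: "n > 0 \<Longrightarrow> \<exists>y. of_nat n * y = (1 :: 'r)"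
begin

sublocale S: triangular_D_ring sS sD E Basis t \<chi> N \<phi> \<kappa>
  by (intro triangular_D_ring.intro S.type_D_ring_axioms R.V.split_algebra_axioms
      triangular_D_ring_axioms.intro R.triangular R.kernel)

sublocale TR: twisted_operators N "\<lambda>l. R.op (\<phi> l)" \<kappa> UNIV
  by (rule R.twisted) auto

sublocale TS: twisted_operators N "\<lambda>l. S.op (\<phi> l)" \<kappa> "range D_poly_const"
proof (rule S.twisted)
  show "of_int z \<in> range D_poly_const" for z
  proof -
    have "D_poly_const (of_int z) = of_int z"
      by (cases z rule: int_cases2) (simp_all add: D_poly_const_of_nat D_poly_const_minus)
    then show ?thesis by (metis rangeI)
  qed
  show "sS c 1 \<in> range D_poly_const" for c
    by (simp add: sS_def)
  show "S.op (\<phi> l) a \<in> range D_poly_const" if "l < N" "a \<in> range D_poly_const" for l a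
    using that op_const[OF S.functional_\<phi>] by auto
qed (auto simp flip: D_poly_const_add D_poly_const_mult)

definition vars :: "('n \<times> (nat \<Rightarrow> nat)) set" where
  "vars = {v. \<forall>l\<ge>N. snd v l = 0}"

text \<open>
  Ties between different indeterminates are broken by an arbitrary enumeration.
\<close>

definition rank_less :: "'n \<times> (nat \<Rightarrow> nat) \<Rightarrow> 'n \<times> (nat \<Rightarrow> nat) \<Rightarrow> bool" where
  "rank_less v w \<longleftrightarrow> lex_below N (snd v) (snd w) \<or>
     snd v = snd w \<and> to_nat_on (UNIV :: 'n set) (fst v) < to_nat_on (UNIV :: 'n set) (fst w)"

text \<open>
  Derivatives of \<open>x\<^sub>j\<close> with respect to the triangular system, in place of the chosen basis of \<open>\<D>\<close>.
\<close>

definition deriv_var :: "'n \<times> (nat \<Rightarrow> nat) \<Rightarrow> ('n, 'i, 'r) D_poly" where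
  "deriv_var v = iterate (\<lambda>l. S.op (\<phi> l)) N (snd v) (D_poly_var (fst v) (\<lambda>_. 0))"

lemma op_deriv_var:
  assumes "l < N"
  shows "S.op (\<phi> l) (deriv_var v) = deriv_var (shift l v)"
proof -
  have "sS 1 (D_poly_var (fst v) (\<lambda>_. 0)) \<in> var_span (fst v)"
    by (rule var_span_scaled_var)
  then have "D_poly_var (fst v) (\<lambda>_. 0) \<in> var_span (fst v)"
    by (simp add: S.A.scale_1)
  from iterate_shift[OF _ _ this, of N "\<lambda>l. S.op (\<phi> l)" "snd v"] assms show ?thesis
    unfolding deriv_var_def shift_def using op_var_span op_commute S.functional_\<phi> by simp
qed

lemma wf_rank_less: "wf {(v, w). rank_less v w}"
proof -
  have "wf (inv_image ({(\<theta>, \<eta>). lex_below N \<theta> \<eta>} <*lex*> less_than)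
      (\<lambda>v :: 'n \<times> (nat \<Rightarrow> nat). (snd v, to_nat_on (UNIV :: 'n set) (fst v))))"
    by (intro wf_inv_image wf_lex_prod wf_lex_below wf_less_than)
  then show ?thesis
    by (rule wf_subset) (auto simp: rank_less_def)
qed

text \<open>
  The subring generated by the constants and the new derivatives is stable under the triangular
  system, hence under all operators, in particular those of the chosen basis.  It contains the
  \<open>x\<^sub>j\<close>, and so all indeterminates \<open>d\<^sup>\<theta> x\<^sub>j\<close>.
\<close>

lemma generated_by_deriv_vars:
  "y \<in> gen_subring (range D_poly_const \<union> deriv_var ` vars)"
proof -
  define G where "G = range D_poly_const \<union> deriv_var ` vars"
  have const: "D_poly_const c \<in> gen_subring G" for c
    by (rule gen_subring.gen) (simp add: G_def)
  have scale: "sS c y \<in> gen_subring G" if "y \<in> gen_subring G" for c y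
    using gen_subring.mult[OF const that] by (simp add: sS_def)
  have sum_closed: "sum g Z \<in> gen_subring G" if "\<And>z. z \<in> Z \<Longrightarrow> g z \<in> gen_subring G" for g and Z :: "nat set"
    using that const[of 0]
    by (induction Z rule: infinite_finite_induct) (auto simp: D_poly_const_0 gen_subring.add)
  have step: "S.op (\<phi> l) y \<in> gen_subring G" if "y \<in> gen_subring G" "l < N" for l y
  proof (rule TS.\<delta>_gen_subring[OF that(1) order_refl _ _ that(2)])
    show "range D_poly_const \<subseteq> G"
      by (simp add: G_def)
    fix g k assume g: "g \<in> G" and k: "k < N"
    then consider "g \<in> range D_poly_const" | v where "v \<in> vars" "g = deriv_var v"
      unfolding G_def by blast
    then show "S.op (\<phi> k) g \<in> gen_subring G"
    proof cases
      case 1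
      then have "S.op (\<phi> k) g \<in> range D_poly_const"
        by (rule TS.base_\<delta>[OF k])
      then obtain c where "S.op (\<phi> k) g = D_poly_const c"
        by (rule rangeE)
      then show ?thesis using const by simp
    next
      case 2
      have "shift k v \<in> vars"
        using 2(1) k by (auto simp: vars_def shift_def)
      then show ?thesis
        unfolding 2(2) op_deriv_var[OF k] by (intro gen_subring.gen) (simp add: G_def)
    qed
  qed
  have op_closed: "S.op \<psi> y \<in> gen_subring G" if "R.functional \<psi>" "y \<in> gen_subring G" for \<psi> y
  proof -
    obtain v where v: "\<And>\<psi> a. R.functional \<psi> \<Longrightarrow> S.op \<psi> a = (\<Sum>l<N. sS (\<psi> (v l)) (S.op (\<phi> l) a))"
      using S.op_in_span by blast
    have "(\<Sum>l<N. sS (\<psi> (v l)) (S.op (\<phi> l) y)) \<in> gen_subring G"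
      by (rule sum_closed) (simp add: scale step[OF that(2)])
    then show ?thesis
      by (simp add: v[OF that(1)])
  qed
  obtain coord where coord: "dual_basis sD UNIV \<epsilon> coord"
    by (rule R.D.is_basis_imp_dual[OF basis])
  have var: "D_poly_var j \<theta> \<in> gen_subring G" for j \<theta>
  proof (induction "sum \<theta> UNIV" arbitrary: \<theta> rule: less_induct)
    case less
    show ?case
    proof (cases "\<theta> = (\<lambda>_. 0)")
      case True
      have "deriv_var (j, \<lambda>_. 0) \<in> gen_subring G"
        by (rule gen_subring.gen) (auto simp: G_def vars_def)
      then show ?thesis
        by (simp add: True deriv_var_def iterate_0)
    next
      case False
      then obtain k where k: "\<theta> k > 0"
        by auto
      define \<theta>' where "\<theta>' = \<theta>(k := \<theta> k - 1)"
      have "sum \<theta>' UNIV < sum \<theta> UNIV"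
        by (rule sum_strict_mono_ex1) (use k in \<open>auto simp: \<theta>'_def intro!: exI[of _ k]\<close>)
      then have IH: "D_poly_var j \<theta>' \<in> gen_subring G"
        by (rule less.hyps)
      have f: "R.functional (coord k)" and c: "coord k (\<epsilon> l) = (if k = l then 1 else 0)" for l
        using coord unfolding dual_basis_def by auto
      have "S.op (coord k) (D_poly_var j \<theta>') =
          (\<Sum>l\<in>UNIV. if l = k then D_poly_var j (\<theta>'(l := Suc (\<theta>' l))) else 0)"
        unfolding op_var[OF f] by (rule sum.cong) (auto simp: c S.A.scale_1)
      also have "\<dots> = D_poly_var j (\<theta>'(k := Suc (\<theta>' k)))"
        by simp
      also have "\<theta>'(k := Suc (\<theta>' k)) = \<theta>"
        using k by (auto simp: \<theta>'_def)
      finally show ?thesis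
        using op_closed[OF f IH] by simp
    qed
  qed
  show ?thesis
    unfolding G_def[symmetric] by (rule D_poly_generated) (use const var in auto)
qed

sublocale ranked_generators N "\<lambda>l. S.op (\<phi> l)" \<kappa> "range D_poly_const" vars rank_less shift deriv_var
proof
  fix u v w and l k :: nat
  show "v \<in> vars \<Longrightarrow> l < N \<Longrightarrow> shift l v \<in> vars"
    by (auto simp: vars_def shift_def)
  show "v \<in> vars \<Longrightarrow> l < N \<Longrightarrow> S.op (\<phi> l) (deriv_var v) = deriv_var (shift l v)"
    by (rule op_deriv_var)
  show "wf {(v, w). rank_less v w}"
    by (rule wf_rank_less)
  show "rank_less u v \<Longrightarrow> rank_less v w \<Longrightarrow> rank_less u w"
    unfolding rank_less_def using lex_below_trans by auto
  show "rank_less v w \<or> v = w \<or> rank_less w v" if "v \<in> vars" "w \<in> vars"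
  proof -
    have "lex_below N (snd v) (snd w) \<or> snd v = snd w \<or> lex_below N (snd w) (snd v)"
      by (rule lex_below_total) (use that in \<open>auto simp: vars_def\<close>)
    moreover have "to_nat_on (UNIV :: 'n set) (fst v) < to_nat_on (UNIV :: 'n set) (fst w) \<or> fst v = fst w \<or>
        to_nat_on (UNIV :: 'n set) (fst w) < to_nat_on (UNIV :: 'n set) (fst v)"
      using inj_on_to_nat_on[of "UNIV :: 'n set"] by (metis UNIV_I countable_finite finite inj_onD nat_neq_iff)
    ultimately show ?thesis
      unfolding rank_less_def by (auto simp: prod_eq_iff)
  qed
  show "rank_less v w \<Longrightarrow> rank_less (shift l v) (shift l w)"
    unfolding rank_less_def lex_below_def shift_def by auto
  show "l < N \<Longrightarrow> k < l \<Longrightarrow> rank_less (shift k v) (shift l v)"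
    unfolding rank_less_def lex_below_def shift_def by auto
  show "\<exists>y. of_nat n * y = (1 :: ('n, 'i, 'r) D_poly)" if n: "n > 0" for n
  proof -
    obtain y :: 'r where "of_nat n * y = 1"
      using of_nat_unit_R[OF n] by blast
    then have "of_nat n * D_poly_const y = (1 :: ('n, 'i, 'r) D_poly)"
      by (simp add: D_poly_const_1 flip: D_poly_const_of_nat D_poly_const_mult)
    then show ?thesis by blast
  qed
  show "y \<in> gen_subring (range D_poly_const \<union> deriv_var ` vars)" for y
    by (rule generated_by_deriv_vars)
  show "\<exists>i j w. i < j \<and> d i \<le> d j \<and> set w \<subseteq> {..<N} \<and> f j = foldr shift w (f i)"
    if "\<And>n. f n \<in> vars" for f :: "nat \<Rightarrow> 'n \<times> (nat \<Rightarrow> nat)" and d :: "nat \<Rightarrow> nat"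
    by (rule shift_dickson) (use that in \<open>auto simp: vars_def\<close>)
qed

text \<open>
  The trace of a perfect ideal on the coefficients is a perfect ideal of \<open>R\<close>, and is finitely
  generated there.
\<close>

theorem chains_stabilise_polynomials:
  assumes "chains_stabilise TR.perfect"
  shows "chains_stabilise TS.perfect"
proof (rule chains_stabilise_perfect)
  fix P assume P: "TS.perfect P"
  have contract: "TR.perfect {r. D_poly_const r \<in> Q}" if Q: "TS.perfect Q" for Q
    unfolding TR.perfect_def
  proof (intro conjI ballI allI impI; unfold mem_Collect_eq)
    show "D_poly_const 0 \<in> Q"
      using TS.perfectD(1)[OF Q] by (simp add: D_poly_const_0)
  next
    fix a b assume "D_poly_const a \<in> Q" "D_poly_const b \<in> Q"
    then show "D_poly_const (a + b) \<in> Q"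
      unfolding D_poly_const_add by (rule TS.perfectD(2)[OF Q])
  next
    fix a r assume "D_poly_const a \<in> Q"
    then show "D_poly_const (r * a) \<in> Q"
      unfolding D_poly_const_mult by (rule TS.perfectD(3)[OF Q])
  next
    fix a :: 'r and n assume "D_poly_const (a ^ n) \<in> Q"
    then show "D_poly_const a \<in> Q"
      unfolding D_poly_const_power by (rule TS.perfectD(5)[OF Q])
  next
    fix l a assume l: "l < N" and "D_poly_const a \<in> Q"
    then show "D_poly_const (R.op (\<phi> l) a) \<in> Q"
      unfolding op_const[OF S.functional_\<phi>[OF l], symmetric] by (rule TS.perfectD(7)[OF Q])
  next
    fix l a assume l: "l < N" "\<kappa> l = l" and "D_poly_const (a * R.op (\<phi> l) a) \<in> Q"
    then show "D_poly_const a \<in> Q"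
      unfolding D_poly_const_mult op_const[OF S.functional_\<phi>[OF l(1)], symmetric]
      by (rule TS.perfectD(8)[OF Q])
  qed
  have "fin_generated TR.perfect {r. D_poly_const r \<in> P}"
    by (rule fin_generated_if_chains_stabilise[OF TR.perfect_Inter assms contract[OF P]])
  then obtain F where F: "finite F" "F \<subseteq> {r. D_poly_const r \<in> P}"
      "\<And>J. TR.perfect J \<Longrightarrow> F \<subseteq> J \<Longrightarrow> {r. D_poly_const r \<in> P} \<subseteq> J"
    unfolding fin_generated_def by blast
  show "\<exists>F. finite F \<and> F \<subseteq> P \<inter> range D_poly_const \<and>
      (\<forall>Q. TS.perfect Q \<longrightarrow> F \<subseteq> Q \<longrightarrow> P \<inter> range D_poly_const \<subseteq> Q)"
  proof (intro exI[of _ "D_poly_const ` F"] conjI allI impI)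
    show "P \<inter> range D_poly_const \<subseteq> Q" if "TS.perfect Q" "D_poly_const ` F \<subseteq> Q" for Q
      using F(3)[OF contract[OF that(1)]] that(2) by blast
  qed (use F in auto)
qed

end

text \<open>
  A triangular system for \<open>\<D>\<close> turns perfect \<open>\<D>\<close>-ideals of \<open>R\<close> and of the polynomial ring into perfect
  ideals for finitely many twisted operators, to which the chain condition just proved applies.
\<close>

theorem theorem1p1:
  fixes sD :: "'k::field \<Rightarrow> 'd::comm_ring_1 \<Rightarrow> 'd"
    and \<epsilon> :: "'i::finite \<Rightarrow> 'd"
    and t :: nat
    and L :: "nat \<Rightarrow> ('k, 'l) module"
    and p :: "nat \<Rightarrow> 'd \<Rightarrow> 'l"
    and sR :: "'k \<Rightarrow> 'r::comm_ring_1 \<Rightarrow> 'r"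
    and e :: "'r \<Rightarrow> ('r \<times> 'd \<Rightarrow>\<^sub>0 int) set"
    and E :: "('n::finite, 'i, 'r) D_poly \<Rightarrow> (('n, 'i, 'r) D_poly \<times> 'd \<Rightarrow>\<^sub>0 int) set"
  defines "K \<equiv> (ring_of_type_algebra :: 'k ring)"
    and "D \<equiv> type_algebra sD"
    and "R \<equiv> type_algebra sR"
    and "S \<equiv> (D_poly_algebra sR :: ('k, ('n, 'i, 'r) D_poly) module)"
  assumes "algebra K D" and "is_basis K D UNIV \<epsilon>"
    and "local_decomposition K D t L p"
    and "\<And>i. i < t \<Longrightarrow> has_residue_field K (L i)"
    and "D_star_ring K D R e"
    and "\<And>i. i < t \<Longrightarrow> inj_on (assoc_endo K R e (L i) (p i)) (carrier R)"
    and "\<exists>sQ. algebra (ring_of_type_algebra :: rat ring) (type_algebra sQ :: (rat, 'r) module)"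
    and "is_D_poly_structure K D \<epsilon> sR e E"
    and "acc_perfect_D_ideals K D t L p R e"
  shows "acc_perfect_D_ideals K D t L p S E"
proof -
  define \<chi> where "\<chi> i d = residue_map K (L i) (p i d)" for i d
  obtain Basis where "split_algebra sD Basis t \<chi>"
    unfolding \<chi>_def K_def
    by (rule split_algebra_of_decomposition[OF assms(5-8)[unfolded K_def D_def]])
  then interpret V: split_algebra sD Basis t \<chi> .
  obtain N \<phi> \<kappa> where T: "V.triangular N \<phi> \<kappa>" "V.common_kernel N \<phi> = {0}"
    by (rule V.triangular_exists)
  have D_ring: "algebra K R" "e \<in> alg_hom K R (tensor K R D)"
    using assms(9) unfolding D_star_ring_def D_ring_def by auto
  interpret R: type_D_ring sR sD e
    by (intro type_D_ring.intro type_D_ring_axioms.intro)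
      (use D_ring assms(5) in \<open>simp_all add: K_def R_def D_def scalar_algebra_iff\<close>)
  interpret DP: D_poly_ring sR sD e \<epsilon> E
    by unfold_locales (use assms(6,12) in \<open>simp_all add: K_def D_def\<close>)
  have unit: "\<exists>y. of_nat n * y = (1 :: 'r)" if n: "n > 0" for n
  proof -
    obtain sQ :: "rat \<Rightarrow> 'r \<Rightarrow> 'r" where "scalar_algebra sQ"
      using assms(11) scalar_algebra_iff by blast
    then interpret Q: scalar_algebra sQ .
    have "of_nat n = sQ (of_nat n) 1"
      by (induction n) (simp_all add: Q.scale_add_left Q.scale_1)
    then have "of_nat n * sQ (1 / of_nat n) 1 = 1"
      using n by (simp add: Q.scale_times_scale Q.scale_1)
    then show ?thesis by blast
  qed
  interpret P: triangular_D_poly_ring sR sD e \<epsilon> E Basis t \<chi> N \<phi> \<kappa>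
    by (intro triangular_D_poly_ring.intro triangular_D_ring.intro triangular_D_ring_axioms.intro
        triangular_D_poly_ring_axioms.intro DP.D_poly_ring_axioms R.type_D_ring_axioms
        V.split_algebra_axioms T unit)
  have L: "residue_algebra (L i)" "p i \<in> alg_hom K D (L i)" if "i < t" for i
    using assms(7) assms(8)[OF that] that unfolding local_decomposition_def K_def
    by (auto intro: residue_algebra.intro)
  have \<chi>_eq: "\<chi> i = (\<lambda>d. residue_map K (L i) (p i d))" for i
    by (rule ext) (simp add: \<chi>_def)
  have basis: "is_basis R.K R.D UNIV \<epsilon>"
    using assms(6) unfolding K_def D_def .
  have S_eq: "S = DP.S.A"
    unfolding S_def by (rule DP.D_poly_algebra_eq)
  have perfect_R: "perfect_D_ideal K D t L p R e I \<longleftrightarrow> P.TR.perfect I" for I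
    unfolding K_def D_def R_def
    by (rule P.R.perfect_D_ideal_iff[OF basis])
      (use R.assoc_endo_eq_op[OF L[unfolded K_def D_def]] in \<open>simp add: \<chi>_eq K_def\<close>)
  have perfect_S: "perfect_D_ideal K D t L p S E I \<longleftrightarrow> P.TS.perfect I" for I
    unfolding K_def D_def S_eq
    by (rule P.S.perfect_D_ideal_iff[OF basis])
      (use DP.S.assoc_endo_eq_op[OF L[unfolded K_def D_def]] in \<open>simp add: \<chi>_eq K_def\<close>)
  show ?thesis
    using P.chains_stabilise_polynomials assms(13)
    unfolding acc_perfect_D_ideals_def chains_stabilise_def perfect_R perfect_S .
qed

end
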